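(* Let $G=(V,D,B)$ be a directed mixed graph (possibly cyclic), let $W\subseteq V$ be HTC-identified with witness sets $(Y_u)_{u\in W}$ and HTC ordering $\prec$, and let $X^{(1)},X^{(2)},\dots$ be i.i.d. from $P_0=P_{(\beta,\varepsilon)}\in\mathcal{M}_G$, satisfying the standing regularity conditions (Hellinger differentiability and non-degeneracy) given in the context. Let $v\in W$, let $\hat\beta_v$ be the HTC estimator and $\hat{\mathcal{V}}_v$ the asymptotic variance estimator based on $X^{(1)},\dots,X^{(n)}$. For $\alpha\in(0,1)$, write $z_{\alpha/2}$ for the $\alpha/2$ quantile of the standard normal distribution and $\chi^2_{k,1-\alpha}$ for the $(1-\alpha)$ quantile of the chi-squared distribution $\chi^2_k$ with $k$ degrees of freedom. The following hold. (i) (Confidence ellipsoid.) An asymptotic $(1-\alpha)$ confidence region for $\beta_v\in\mathbb{R}^{|\mathrm{pa}(v)|}$ is $$\mathcal{C}_n=\{\beta'\in\mathbb{R}^{|\mathrm{pa}(v)|}: n(\hat\beta_v-\beta')^\top\hat{\mathcal{V}}_v^{-1}(\hat\beta_v-\beta')\le\chi^2_{|\mathrm{pa}(v)|,1-\alpha}\}.$$ (ii) (Marginal intervals.) An asymptotic $(1-\alpha)$ confidence interval for the edge coefficient $\beta_{p_jv}$, $p_j\in\mathrm{pa}(v)$, is $$\hat\beta_{p_jv}\pm z_{\alpha/2}\sqrt{\hat{\mathcal{V}}_v[j,j]/n}.$$ (iii) (Wald test.) For $H_0\colon C\beta_v=c$ with full row rank $C\in\mathbb{R}^{r\times|\mathrm{pa}(v)|}$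 and $c\in\mathbb{R}^r$, the Wald statistic satisfies $$W_n=n(C\hat\beta_v-c)^\top(C\hat{\mathcal{V}}_vC^\top)^{-1}(C\hat\beta_v-c)\xrightarrow{d}\chi^2_r\quad\text{under }H_0.$$ The matrix $C\hat{\mathcal{V}}_vC^\top$ is generically invertible because $C$ has full row rank.
   Context: Graphs. A directed mixed graph $G=(V,D,B)$ has a finite vertex set $V$, directed edges $D\subseteq V^2$ (written $v\to w$) and bidirected edges $B\subseteq\binom V2$ (written $v\leftrightarrow w$), with no self-loops; directed cycles are allowed. $\mathrm{pa}(v)=\{w:w\to v\in D\}$, $\mathrm{sib}(v)=\{w:w\leftrightarrow v\in B\}$, and for $U\subseteq V$, $\mathrm{sib}(U)=\{v\in V\setminus U: v\leftrightarrow w\in B\text{ for some }w\in U\}$. A half-trek is a path $\pi$ of the form $v_0\to v_1\to\cdots\to v_\ell$ or $v_0\leftrightarrow v_1\to\cdots\to v_\ell$, with $\mathrm{Left}(\pi)=\{v_0\}$, $\mathrm{Right}(\pi)=\{v_1,\dots,v_\ell\}$. $\mathrm{htr}(v)$ is the set of $w\in V\setminus(\{v\}\cup\mathrm{sib}(v))$ such that there is a half-trek from $v$ to $w$. A system of half-treks has no sided intersection if $\mathrm{Left}(\pi_i)\cap\mathrm{Left}(\pi_j)=\emptyset=\mathrm{Right}(\pi_i)\cap\mathrm{Right}(\pi_j)$ for all $i\ne j$. Half-trek criterion (HTC). $Y\subset V$ satisfies the HTC for $v$ if (i) $|Y|=|\mathrm{pa}(v)|$; (ii) $Y\cap(\{v\}\cup\mathrm{sib}(v))=\emptyset$;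 (iii) there is a system of half-treks from $Y$ to $\mathrm{pa}(v)$ with no sided intersection. $W\subseteq V$ is HTC-identified with witness sets $(Y_u)_{u\in W}$ and HTC ordering $\prec$ (a total order on $W$) if $Y_u$ satisfies the HTC for $u$ for each $u\in W$, and $w\prec u$ (in particular $w\in W$) whenever $w\in Y_u\cap\mathrm{htr}(u)$. Model. $\mathcal{B}$ is the set of $\beta\in\mathbb{R}^{|V|\times|V|}$ with $\beta_{wv}=0$ whenever $w\to v\notin D$ and $\det(I-\beta)\neq0$. $\mathcal{E}$ is the set of mean-zero $\mathbb{R}^{|V|}$-valued random vectors $\varepsilon$ with finite fourth moment such that $\varepsilon_U$ is independent of $\varepsilon_{V\setminus(U\cup\mathrm{sib}(U))}$ for every $U\subseteq V$ connected in $(V,B)$. $P_{(\beta,\varepsilon)}$ is the distribution of $X=(I-\beta)^{-\top}\varepsilon$, the solution of $X=\beta^\top X+\varepsilon$, and $\mathcal{M}_G=\{P_{(\beta,\varepsilon)}:\beta\in\mathcal{B},\varepsilon\in\mathcal{E}\}$. Expectations $\mathrm{E}$ are under $P_0$; $\varepsilon_v=X_v-\beta_v^\top X_{\mathrm{pa}(v)}$ is regarded as a function of $X$; $\beta_v=(\beta_{p_1v},\dots,\beta_{p_kv})^\top$ for $\mathrm{pa}(v)=\{p_1,\dots,p_k\}$. Instruments. For $v\in W$ and $y\in Y_v$: $Z_y=\varepsilon_y=X_y-\beta_y^\top X_{\mathrm{pa}(y)}$ if $y\in\mathrm{htr}(v)$ and $Z_y=X_y$ if $y\notin\mathrm{htr}(v)$.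 $A_v=\mathrm{E}[Z_{Y_v}X_{\mathrm{pa}(v)}^\top]$. Standing regularity conditions at the true parameter. (a) Hellinger differentiability: every parametric path $\gamma\mapsto P_\gamma$ in $\mathcal{M}_G$ through $P_0$ is differentiable in quadratic mean at $\gamma=0$, i.e. there is a mean-zero square-integrable score $S$ with $\int\big(\frac{dP_\gamma^{1/2}-dP_0^{1/2}}{\gamma}-\frac12S\,dP_0^{1/2}\big)^2\to0$ as $\gamma\to0$. (b) Non-degeneracy: $A_u$ is invertible for every HTC-identified node $u$. Row contributions and asymptotic variance, defined recursively along $\prec$ together with $\phi_{\beta_u}=A_u^{-1}R_u$ for $u\in W$ (its entry for the edge $q\to u$ is denoted $\phi_{\beta_{qu}}$): $R_v=(R_{y,v})_{y\in Y_v}$ with $$R_{y,v}=\begin{cases}X_y\varepsilon_v,& y\notin\mathrm{htr}(v),\\ \varepsilon_y\varepsilon_v-\sum_{q\in\mathrm{pa}(y)}\mathrm{E}[X_q\varepsilon_v]\,\phi_{\beta_{qy}},& y\in\mathrm{htr}(v),\end{cases}$$ and $\mathcal{V}_v=A_v^{-1}\mathrm{E}[R_vR_v^\top]A_v^{-\top}$, which is the asymptotic variance of $\sqrt n(\hat\beta_v-\beta_v)$. HTC estimator. Recursively along $\prec$, $\hat\beta_v=\hat A_v^{-1}\hat b_v$ with $\hat A_v=\frac1n\sum_{i=1}^n\hat Z_{Y_v}^{(i)}(X^{(i)}_{\mathrm{pa}(v)})^\top$ and $\hat b_v=\frac1n\sum_{i=1}^n\hat Z_{Y_v}^{(i)}X_v^{(i)}$,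 where for $y\in Y_v$, $\hat Z_y^{(i)}=X_y^{(i)}-\hat\beta_y^\top X^{(i)}_{\mathrm{pa}(y)}$ if $y\in\mathrm{htr}(v)$ and $\hat Z^{(i)}_y=X^{(i)}_y$ otherwise. Variance estimator. $\hat{\mathcal{V}}_v$ is obtained from $\mathcal{V}_v$ by replacing every expectation by the corresponding empirical moment (with the estimated coefficients plugged in). Explicitly, with $\hat\varepsilon_u^{(i)}=X_u^{(i)}-\hat\beta_u^\top X_{\mathrm{pa}(u)}^{(i)}$, define recursively $\hat\phi_{\beta_u}^{(i)}=\hat A_u^{-1}\hat R_u^{(i)}$, $\hat R_{y,u}^{(i)}=X_y^{(i)}\hat\varepsilon_u^{(i)}$ for $y\in Y_u\setminus\mathrm{htr}(u)$, and $\hat R_{y,u}^{(i)}=\hat\varepsilon_y^{(i)}\hat\varepsilon_u^{(i)}-\sum_{q\in\mathrm{pa}(y)}\big(\frac1n\sum_{l=1}^nX_q^{(l)}\hat\varepsilon_u^{(l)}\big)\hat\phi^{(i)}_{\beta_{qy}}$ for $y\in Y_u\cap\mathrm{htr}(u)$; then $\hat{\mathcal{V}}_v=\hat A_v^{-1}\big(\frac1n\sum_{i=1}^n\hat R_v^{(i)}\hat R_v^{(i)\top}\big)\hat A_v^{-\top}$. Terminology. A set is an asymptotic $(1-\alpha)$ confidence region if its probability under $P_0$ of containing the true value tends to $1-\alpha$ as $n\to\infty$. "Generically" refers to the model parameters: a property holds generically if it holds outside an exceptional set of $(\beta,\Omega)$, $\Omega=\mathrm{Cov}(\varepsilon)$,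 of Lebesgue measure zero. *)

theory Defs
  imports
    "HOL-Probability.Probability"
    "Jordan_Normal_Form.Gauss_Jordan_Elimination"
    "Jordan_Normal_Form.DL_Rank"
begin

(* Random vectors indexed by the vertices live in real ^ 'v. Vectors and matrices indexed by
   pa(v) or Y_v have a size that depends on v; for them we use the Jordan_Normal_Form types. *)

no_notation vec_index (infixl "$" 100)
notation vec_index (infixl "$v" 100)
hide_const (open) Finite_Cartesian_Product.vec Finite_Cartesian_Product.mat Finite_Cartesian_Product.row
hide_const (open) Determinant.det

section \<open>Directed mixed graphs and the half-trek criterion\<close>

text \<open>The vertex set is the finite type \<open>'v\<close>; a pair \<open>(w, v)\<close> in \<open>dir\<close> is the edge
  \<open>w \<rightarrow> v\<close>, a set \<open>{v, w}\<close> in \<open>bid\<close> is the edge \<open>v \<leftrightarrow> w\<close>.\<close>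

record 'v mgraph =
  dir :: "('v \<times> 'v) set"
  bid :: "'v set set"

definition mixed_graph :: "'v mgraph \<Rightarrow> bool" where
  "mixed_graph G \<longleftrightarrow> (\<forall>v. (v, v) \<notin> dir G) \<and> bid G \<subseteq> {{v, w} | v w. v \<noteq> w}"

definition pa :: "'v mgraph \<Rightarrow> 'v \<Rightarrow> 'v set" where
  "pa G v = {w. (w, v) \<in> dir G}"

definition sib :: "'v mgraph \<Rightarrow> 'v \<Rightarrow> 'v set" where
  "sib G v = {w. {w, v} \<in> bid G}"

definition sib_set :: "'v mgraph \<Rightarrow> 'v set \<Rightarrow> 'v set" where
  "sib_set G U = {v. v \<notin> U \<and> (\<exists>w\<in>U. {v, w} \<in> bid G)}"

definition directed_walk :: "'v mgraph \<Rightarrow> 'v list \<Rightarrow> bool" where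
  "directed_walk G vs \<longleftrightarrow> vs \<noteq> [] \<and> successively (\<lambda>a b. (a, b) \<in> dir G) vs"

text \<open>A half-trek is given by its vertex sequence \<open>v\<^sub>0, \<dots>, v\<^sub>l\<close>; \<open>[v\<^sub>0]\<close> is the trivial one.\<close>

definition half_trek :: "'v mgraph \<Rightarrow> 'v list \<Rightarrow> bool" where
  "half_trek G vs \<longleftrightarrow> directed_walk G vs \<or>
     (directed_walk G (tl vs) \<and> {hd vs, hd (tl vs)} \<in> bid G)"

definition left_side :: "'v list \<Rightarrow> 'v set" where
  "left_side vs = {hd vs}"

definition right_side :: "'v list \<Rightarrow> 'v set" where
  "right_side vs = set (tl vs)"

definition htr :: "'v mgraph \<Rightarrow> 'v \<Rightarrow> 'v set" where
  "htr G v = {w. w \<notin> {v} \<union> sib G v \<and> (\<exists>vs. half_trek G vs \<and> hd vs = v \<and> last vs = w)}"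

text \<open>A system of half-treks from \<open>Y\<close> to \<open>P\<close> has one half-trek \<open>\<pi> y\<close> starting at each \<open>y \<in> Y\<close>,
  and their end points run through \<open>P\<close> bijectively.\<close>

definition half_trek_system :: "'v mgraph \<Rightarrow> 'v set \<Rightarrow> 'v set \<Rightarrow> ('v \<Rightarrow> 'v list) \<Rightarrow> bool" where
  "half_trek_system G Y P \<pi> \<longleftrightarrow>
     (\<forall>y\<in>Y. half_trek G (\<pi> y) \<and> hd (\<pi> y) = y) \<and> bij_betw (\<lambda>y. last (\<pi> y)) Y P"

definition no_sided_intersection :: "'v set \<Rightarrow> ('v \<Rightarrow> 'v list) \<Rightarrow> bool" where
  "no_sided_intersection Y \<pi> \<longleftrightarrow> (\<forall>y\<in>Y. \<forall>y'\<in>Y. y \<noteq> y' \<longrightarrow>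
     left_side (\<pi> y) \<inter> left_side (\<pi> y') = {} \<and> right_side (\<pi> y) \<inter> right_side (\<pi> y') = {})"

definition satisfies_HTC :: "'v mgraph \<Rightarrow> 'v set \<Rightarrow> 'v \<Rightarrow> bool" where
  "satisfies_HTC G Y v \<longleftrightarrow>
     card Y = card (pa G v) \<and>
     Y \<inter> ({v} \<union> sib G v) = {} \<and>
     (\<exists>\<pi>. half_trek_system G Y (pa G v) \<pi> \<and> no_sided_intersection Y \<pi>)"

definition HTC_identified ::
    "'v mgraph \<Rightarrow> 'v set \<Rightarrow> ('v \<Rightarrow> 'v set) \<Rightarrow> ('v \<times> 'v) set \<Rightarrow> bool" where
  "HTC_identified G W Y prec \<longleftrightarrow>
     prec \<subseteq> W \<times> W \<and> strict_linear_order_on W prec \<and>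
     (\<forall>u\<in>W. satisfies_HTC G (Y u) u \<and> (\<forall>w \<in> Y u \<inter> htr G u. (w, u) \<in> prec))"

section \<open>The model\<close>

definition coefficients :: "'v::finite mgraph \<Rightarrow> (real ^ 'v ^ 'v) set" where
  "coefficients G = {\<beta>. (\<forall>w v. (w, v) \<notin> dir G \<longrightarrow> \<beta> $ w $ v = 0) \<and>
     det (Finite_Cartesian_Product.mat 1 - \<beta>) \<noteq> 0}"

definition bid_connected :: "'v mgraph \<Rightarrow> 'v set \<Rightarrow> bool" where
  "bid_connected G U \<longleftrightarrow> U \<noteq> {} \<and>
     (\<forall>a\<in>U. \<forall>b\<in>U. (a, b) \<in> {(x, y). x \<in> U \<and> y \<in> U \<and> {x, y} \<in> bid G}\<^sup>*)"

definition subvector :: "'v set \<Rightarrow> real ^ 'v \<Rightarrow> 'v \<Rightarrow> real" where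
  "subvector U x = restrict (\<lambda>u. x $ u) U"

text \<open>The admissible errors enter only through their distribution \<open>Q\<close>, so the class of errors
  is a set of laws.\<close>

definition error_laws :: "'v::finite mgraph \<Rightarrow> (real ^ 'v) measure set" where
  "error_laws G = {Q. prob_space Q \<and> sets Q = sets borel \<and>
     (\<forall>v. integrable Q (\<lambda>e. (e $ v) ^ 4)) \<and>
     (\<forall>v. (\<integral>e. e $ v \<partial>Q) = 0) \<and>
     (\<forall>U. bid_connected G U \<longrightarrow>
        prob_space.indep_var Q
          (PiM U (\<lambda>_. borel)) (subvector U)
          (PiM (- (U \<union> sib_set G U)) (\<lambda>_. borel)) (subvector (- (U \<union> sib_set G U))))}"

definition model_law :: "real ^ 'v ^ 'v \<Rightarrow> (real ^ 'v) measure \<Rightarrow> (real ^ 'v::finite) measure" where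
  "model_law \<beta> Q =
     distr Q borel (\<lambda>e. matrix_inv (transpose (Finite_Cartesian_Product.mat 1 - \<beta>)) *v e)"

definition error_cov :: "(real ^ 'v) measure \<Rightarrow> real ^ 'v ^ 'v::finite" where
  "error_cov Q = (\<chi> v w. \<integral>e. e $ v * e $ w \<partial>Q)"

section \<open>Differentiability in quadratic mean\<close>

definition measure_sum :: "'b measure \<Rightarrow> 'b measure \<Rightarrow> 'b measure" where
  "measure_sum M N = measure_of (space M) (sets M) (\<lambda>A. emeasure M A + emeasure N A)"

text \<open>The integral \<open>\<integral> ((dP\<^sup>1\<^sup>/\<^sup>2 - dP\<^sub>0\<^sup>1\<^sup>/\<^sup>2) / \<gamma> - S dP\<^sub>0\<^sup>1\<^sup>/\<^sup>2 / 2)\<^sup>2\<close> does not depend on the measure with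
  respect to which the densities are taken; we use \<open>P + P\<^sub>0\<close>.\<close>

definition dqm_remainder ::
    "'b measure \<Rightarrow> 'b measure \<Rightarrow> ('b \<Rightarrow> real) \<Rightarrow> real \<Rightarrow> ennreal" where
  "dqm_remainder P\<^sub>0 P S \<gamma> =
     (let \<nu> = measure_sum P\<^sub>0 P;
          p\<^sub>0 = (\<lambda>x. sqrt (enn2real (RN_deriv \<nu> P\<^sub>0 x)));
          p = (\<lambda>x. sqrt (enn2real (RN_deriv \<nu> P x)))
      in \<integral>\<^sup>+x. ennreal (((p x - p\<^sub>0 x) / \<gamma> - S x * p\<^sub>0 x / 2)\<^sup>2) \<partial>\<nu>)"

definition dqm :: "(real \<Rightarrow> 'b measure) \<Rightarrow> bool" where
  "dqm P \<longleftrightarrow> (\<exists>S \<in> borel_measurable (P 0).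
     integrable (P 0) (\<lambda>x. (S x)\<^sup>2) \<and> (\<integral>x. S x \<partial>P 0) = 0 \<and>
     ((\<lambda>\<gamma>. dqm_remainder (P 0) (P \<gamma>) S \<gamma>) \<longlongrightarrow> 0) (at 0))"

text \<open>A parametric path is a curve in the model along which the parameters, the coefficient matrix
  and the error law, vary smoothly. Some smoothness has to be part of the notion: through every
  law in the model there are curves that are not differentiable in quadratic mean (discontinuous
  ones, or ones with a singular mixture component of mass \<open>\<gamma>\<^sup>2\<close>), so that a condition on all curves
  would be unsatisfiable. The regularity condition says that smoothness of the parameters carries
  over to the law of \<open>X\<close>; \<open>\<gamma> \<mapsto> (\<beta> + \<gamma> h, Q)\<close> is an example of a path.\<close>

definition parametric_path :: "'v::finite mgraph \<Rightarrow> (real \<Rightarrow> (real ^ 'v) measure) \<Rightarrow> bool" where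
  "parametric_path G P \<longleftrightarrow> (\<exists>\<beta> Q.
     (\<forall>\<^sub>F \<gamma> in nhds 0. \<beta> \<gamma> \<in> coefficients G \<and> Q \<gamma> \<in> error_laws G \<and> P \<gamma> = model_law (\<beta> \<gamma>) (Q \<gamma>)) \<and>
     \<beta> differentiable (at 0) \<and> dqm Q)"

definition Hellinger_differentiable :: "'v::finite mgraph \<Rightarrow> (real ^ 'v) measure \<Rightarrow> bool" where
  "Hellinger_differentiable G P\<^sub>0 \<longleftrightarrow> (\<forall>P. parametric_path G P \<and> P 0 = P\<^sub>0 \<longrightarrow> dqm P)"

section \<open>Instruments, estimator and asymptotic variance\<close>

text \<open>An arbitrary but fixed enumeration \<open>p\<^sub>1, \<dots>, p\<^sub>k\<close> of a finite set.\<close>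

definition listing :: "'v::finite set \<Rightarrow> 'v list" where
  "listing A = (SOME xs. set xs = A \<and> distinct xs)"

abbreviation nth_elem :: "'v::finite set \<Rightarrow> nat \<Rightarrow> 'v" where
  "nth_elem A i \<equiv> listing A ! i"

text \<open>Inverse of a square matrix, with value \<open>0\<close> for a singular one. The latter affects
  estimators only on events whose probability tends to \<open>0\<close>.\<close>

definition inv_mat :: "real Matrix.mat \<Rightarrow> real Matrix.mat" where
  "inv_mat A = (case mat_inverse A of Some B \<Rightarrow> B | None \<Rightarrow> 0\<^sub>m (dim_row A) (dim_row A))"

definition quad_form :: "real Matrix.mat \<Rightarrow> real Matrix.vec \<Rightarrow> real" where
  "quad_form A x = scalar_prod x (A *\<^sub>v x)"

text \<open>The column \<open>\<beta>\<^sub>v\<close>.\<close>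

definition coef :: "'v::finite mgraph \<Rightarrow> real ^ 'v ^ 'v \<Rightarrow> 'v \<Rightarrow> real Matrix.vec" where
  "coef G \<beta> v = Matrix.vec (card (pa G v)) (\<lambda>j. \<beta> $ nth_elem (pa G v) j $ v)"

text \<open>The population quantities and their estimators are given by the same formulas. These take as
  arguments an expectation functional \<open>E\<close> and a family \<open>b\<close> of coefficient vectors: the population
  version has \<open>E = E\<^sub>P\<close> and the true \<open>\<beta>\<close>, the estimators have the empirical mean and \<open>\<beta>\<close>-hat.\<close>

type_synonym 'v expect = "(real ^ 'v \<Rightarrow> real) \<Rightarrow> real"
type_synonym 'v coefs = "'v \<Rightarrow> real Matrix.vec"

definition resid :: "'v::finite mgraph \<Rightarrow> 'v coefs \<Rightarrow> 'v \<Rightarrow> real ^ 'v \<Rightarrow> real" where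
  "resid G b v x = x $ v - (\<Sum>j<card (pa G v). b v $v j * x $ nth_elem (pa G v) j)"

definition instr :: "'v::finite mgraph \<Rightarrow> 'v coefs \<Rightarrow> 'v \<Rightarrow> 'v \<Rightarrow> real ^ 'v \<Rightarrow> real" where
  "instr G b v y x = (if y \<in> htr G v then resid G b y x else x $ y)"

definition Amat ::
    "'v::finite mgraph \<Rightarrow> ('v \<Rightarrow> 'v set) \<Rightarrow> 'v expect \<Rightarrow> 'v coefs \<Rightarrow> 'v \<Rightarrow> real Matrix.mat" where
  "Amat G Y E b v = Matrix.mat (card (Y v)) (card (pa G v))
     (\<lambda>(i, j). E (\<lambda>x. instr G b v (nth_elem (Y v) i) x * x $ nth_elem (pa G v) j))"

definition bvec ::
    "'v::finite mgraph \<Rightarrow> ('v \<Rightarrow> 'v set) \<Rightarrow> 'v expect \<Rightarrow> 'v coefs \<Rightarrow> 'v \<Rightarrow> real Matrix.vec" where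
  "bvec G Y E b v = Matrix.vec (card (Y v)) (\<lambda>i. E (\<lambda>x. instr G b v (nth_elem (Y v) i) x * x $ v))"

text \<open>Recursion along the ordering. The recursive calls at \<open>v\<close> concern only \<open>Y v \<inter> htr G v\<close>, whose
  members precede \<open>v\<close>; so \<open>wfrec\<close> yields the intended equation.\<close>

definition HTC_coefs ::
    "'v::finite mgraph \<Rightarrow> ('v \<Rightarrow> 'v set) \<Rightarrow> ('v \<times> 'v) set \<Rightarrow> 'v expect \<Rightarrow> 'v coefs" where
  "HTC_coefs G Y prec E = wfrec prec (\<lambda>b v. inv_mat (Amat G Y E b v) *\<^sub>v bvec G Y E b v)"

lemma HTC_identified_wf:
  fixes G :: "'v::finite mgraph"
  assumes "HTC_identified G W Y prec"
  shows "wf prec"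
proof -
  have "trans prec" "irrefl prec"
    using assms by (auto simp: HTC_identified_def strict_linear_order_on_def)
  then have "acyclic prec"
    by (simp add: acyclic_irrefl)
  then show ?thesis
    by (simp add: finite_acyclic_wf)
qed

lemma nth_elem_in:
  assumes "i < card A"
  shows "nth_elem A i \<in> A"
proof -
  have "set (listing A) = A \<and> distinct (listing A)"
    unfolding listing_def by (rule someI_ex) (metis finite_distinct_list finite)
  then show ?thesis
    using assms by (metis distinct_card nth_mem)
qed

lemma HTC_coefs_rec:
  fixes G :: "'v::finite mgraph"
  assumes "HTC_identified G W Y prec" and "v \<in> W"
  shows "HTC_coefs G Y prec E v =
    inv_mat (Amat G Y E (HTC_coefs G Y prec E) v) *\<^sub>v bvec G Y E (HTC_coefs G Y prec E) v"
proof -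
  let ?b = "HTC_coefs G Y prec E"
  have prec: "(y, v) \<in> prec" if "y \<in> Y v" "y \<in> htr G v" for y
    using assms that by (auto simp: HTC_identified_def)
  have "instr G (cut ?b prec v) v y x = instr G ?b v y x" if "y \<in> Y v" for y x
    using prec[OF that] by (auto simp: instr_def resid_def cut_def)
  then have "Amat G Y E (cut ?b prec v) v = Amat G Y E ?b v"
    and "bvec G Y E (cut ?b prec v) v = bvec G Y E ?b v"
    by (auto simp: Amat_def bvec_def nth_elem_in intro!: eq_matI eq_vecI)
  then show ?thesis
    using wfrec[OF HTC_identified_wf[OF assms(1)],
        of "\<lambda>b v. inv_mat (Amat G Y E b v) *\<^sub>v bvec G Y E b v" v]
    by (simp add: HTC_coefs_def)
qed

definition row_contrib ::
    "'v::finite mgraph \<Rightarrow> ('v \<Rightarrow> 'v set) \<Rightarrow> 'v expect \<Rightarrow> 'v coefs \<Rightarrow>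
     ('v \<Rightarrow> real ^ 'v \<Rightarrow> real Matrix.vec) \<Rightarrow> 'v \<Rightarrow> real ^ 'v \<Rightarrow> real Matrix.vec" where
  "row_contrib G Y E b \<phi> v x = Matrix.vec (card (Y v)) (\<lambda>i.
     let y = nth_elem (Y v) i in
     if y \<in> htr G v
     then resid G b y x * resid G b v x -
          (\<Sum>j<card (pa G y). E (\<lambda>x'. x' $ nth_elem (pa G y) j * resid G b v x') * (\<phi> y x $v j))
     else x $ y * resid G b v x)"

definition influence ::
    "'v::finite mgraph \<Rightarrow> ('v \<Rightarrow> 'v set) \<Rightarrow> ('v \<times> 'v) set \<Rightarrow> 'v expect \<Rightarrow> 'v coefs \<Rightarrow>
     'v \<Rightarrow> real ^ 'v \<Rightarrow> real Matrix.vec" where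
  "influence G Y prec E b =
     wfrec prec (\<lambda>\<phi> v x. inv_mat (Amat G Y E b v) *\<^sub>v row_contrib G Y E b \<phi> v x)"

lemma influence_rec:
  fixes G :: "'v::finite mgraph"
  assumes "HTC_identified G W Y prec" and "v \<in> W"
  shows "influence G Y prec E b v x =
    inv_mat (Amat G Y E b v) *\<^sub>v row_contrib G Y E b (influence G Y prec E b) v x"
proof -
  let ?p = "influence G Y prec E b"
  have prec: "(y, v) \<in> prec" if "y \<in> Y v" "y \<in> htr G v" for y
    using assms that by (auto simp: HTC_identified_def)
  have "row_contrib G Y E b (cut ?p prec v) v x = row_contrib G Y E b ?p v x"
    using prec by (auto simp: row_contrib_def nth_elem_in cut_def Let_def intro!: eq_vecI)
  then show ?thesis
    using fun_cong[OF wfrec[OF HTC_identified_wf[OF assms(1)],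
        of "\<lambda>\<phi> v x. inv_mat (Amat G Y E b v) *\<^sub>v row_contrib G Y E b \<phi> v x" v], of x]
    by (simp add: influence_def)
qed

definition asym_var ::
    "'v::finite mgraph \<Rightarrow> ('v \<Rightarrow> 'v set) \<Rightarrow> ('v \<times> 'v) set \<Rightarrow> 'v expect \<Rightarrow> 'v coefs \<Rightarrow>
     'v \<Rightarrow> real Matrix.mat" where
  "asym_var G Y prec E b v =
     (let R = row_contrib G Y E b (influence G Y prec E b) v;
          A = inv_mat (Amat G Y E b v)
      in A * Matrix.mat (card (Y v)) (card (Y v)) (\<lambda>(i, j). E (\<lambda>x. (R x $v i) * (R x $v j))) *
         transpose_mat A)"

definition expect_under :: "(real ^ 'v) measure \<Rightarrow> 'v::finite expect" where
  "expect_under P f = (\<integral>x. f x \<partial>P)"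

definition empirical :: "nat \<Rightarrow> (nat \<Rightarrow> real ^ 'v) \<Rightarrow> 'v::finite expect" where
  "empirical n xs f = (\<Sum>i<n. f (xs i)) / real n"

definition beta_hat ::
    "'v::finite mgraph \<Rightarrow> ('v \<Rightarrow> 'v set) \<Rightarrow> ('v \<times> 'v) set \<Rightarrow> nat \<Rightarrow> (nat \<Rightarrow> real ^ 'v) \<Rightarrow> 'v coefs" where
  "beta_hat G Y prec n xs = HTC_coefs G Y prec (empirical n xs)"

definition V_hat ::
    "'v::finite mgraph \<Rightarrow> ('v \<Rightarrow> 'v set) \<Rightarrow> ('v \<times> 'v) set \<Rightarrow> nat \<Rightarrow> (nat \<Rightarrow> real ^ 'v) \<Rightarrow>
     'v \<Rightarrow> real Matrix.mat" where
  "V_hat G Y prec n xs = asym_var G Y prec (empirical n xs) (beta_hat G Y prec n xs)"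

text \<open>The asymptotic variance itself at the parameter \<open>(\<beta>, Q)\<close>.\<close>

definition V_true ::
    "'v::finite mgraph \<Rightarrow> ('v \<Rightarrow> 'v set) \<Rightarrow> ('v \<times> 'v) set \<Rightarrow> real ^ 'v ^ 'v \<Rightarrow>
     (real ^ 'v) measure \<Rightarrow> 'v \<Rightarrow> real Matrix.mat" where
  "V_true G Y prec \<beta> Q = asym_var G Y prec (expect_under (model_law \<beta> Q)) (coef G \<beta>)"

section \<open>Assumptions and conclusions\<close>

definition regular_parameter ::
    "'v::finite mgraph \<Rightarrow> 'v set \<Rightarrow> ('v \<Rightarrow> 'v set) \<Rightarrow> real ^ 'v ^ 'v \<Rightarrow> (real ^ 'v) measure \<Rightarrow> bool" where
  "regular_parameter G W Y \<beta> Q \<longleftrightarrow>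
     \<beta> \<in> coefficients G \<and> Q \<in> error_laws G \<and>
     Hellinger_differentiable G (model_law \<beta> Q) \<and>
     (\<forall>u\<in>W. invertible_mat (Amat G Y (expect_under (model_law \<beta> Q)) (coef G \<beta>) u))"

definition iid_sample ::
    "'a measure \<Rightarrow> (nat \<Rightarrow> 'a \<Rightarrow> real ^ 'v) \<Rightarrow> (real ^ 'v::finite) measure \<Rightarrow> bool" where
  "iid_sample M X P \<longleftrightarrow> prob_space M \<and>
     prob_space.indep_vars M (\<lambda>_. borel) X UNIV \<and> (\<forall>i. distr M borel (X i) = P)"

definition asymptotic_confidence_region ::
    "'a measure \<Rightarrow> real \<Rightarrow> 'b \<Rightarrow> (nat \<Rightarrow> 'a \<Rightarrow> 'b set) \<Rightarrow> bool" where
  "asymptotic_confidence_region M level \<theta> C \<longleftrightarrow>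
     (\<lambda>n. measure M {\<omega> \<in> space M. \<theta> \<in> C n \<omega>}) \<longlonglongrightarrow> level"

text \<open>Law of the sum of squares of \<open>k\<close> independent standard normal variables.\<close>

definition chi_squared :: "nat \<Rightarrow> real measure" where
  "chi_squared k =
     distr (PiM {..<k} (\<lambda>_. std_normal_distribution)) borel (\<lambda>z. \<Sum>i<k. (z i)\<^sup>2)"

definition quantile :: "real measure \<Rightarrow> real \<Rightarrow> real" where
  "quantile \<mu> p = Inf {x. p \<le> cdf \<mu> x}"

text \<open>The free parameters are the entries \<open>\<beta>\<^sub>w\<^sub>v\<close> for the directed edges and the entries of \<open>\<Omega>\<close> on the
  diagonal (coordinate \<open>{v} = {v, v}\<close>) and for the bidirected edges (coordinate \<open>{v, w}\<close>); all other
  entries vanish. ``Lebesgue measure zero'' refers to these coordinates.\<close>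

definition parameter_space :: "'v::finite mgraph \<Rightarrow> (('v \<times> 'v) + 'v set \<Rightarrow> real) measure" where
  "parameter_space G = PiM (dir G <+> (range (\<lambda>v. {v}) \<union> bid G)) (\<lambda>_. lborel)"

definition param_coefficients ::
    "'v::finite mgraph \<Rightarrow> (('v \<times> 'v) + 'v set \<Rightarrow> real) \<Rightarrow> real ^ 'v ^ 'v" where
  "param_coefficients G \<theta> = (\<chi> w v. if (w, v) \<in> dir G then \<theta> (Inl (w, v)) else 0)"

definition param_cov ::
    "'v::finite mgraph \<Rightarrow> (('v \<times> 'v) + 'v set \<Rightarrow> real) \<Rightarrow> real ^ 'v ^ 'v" where
  "param_cov G \<theta> = (\<chi> v w. if v = w \<or> {v, w} \<in> bid G then \<theta> (Inr {v, w}) else 0)"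

definition generically ::
    "'v::finite mgraph \<Rightarrow> (real ^ 'v ^ 'v \<Rightarrow> real ^ 'v ^ 'v \<Rightarrow> bool) \<Rightarrow> bool" where
  "generically G \<Phi> \<longleftrightarrow> (AE \<theta> in parameter_space G. \<Phi> (param_coefficients G \<theta>) (param_cov G \<theta>))"

end

(* The influence function phi_u = A_u^{-1} R_u is the linear part of the estimator: along the HTC
   ordering, sqrt n (beta_hat_u - beta_u) equals the normalised sum of phi_u(X_i) up to o_P(1), because
   the error made in replacing an instrument X_y - beta_y^T X_pa(y) by its estimate is, to first order,
   the correction term in R_{y,u}.  Convergence in probability is convergence along a filter on pairs
   (n, omega), so that the continuous mapping theorem is the calculus of limits.

   The asymptotic variance E[phi phi^T] is positive definite at every regular parameter, not only at
   generic ones.  If a^T phi vanished P_0-almost surely, then along a path beta + gamma h the laws would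
   put mass o(gamma^2) on the set where a^T phi does not vanish (differentiability in quadratic mean), so
   the derivative of E_gamma[a^T phi] at 0 would be zero; a direct computation gives a^T h instead.

   The chi-squared limit avoids multivariate weak convergence: after whitening, the Laplace transform of
   the squared norm of the normalised sum is a Gaussian average of its characteristic function, which the
   univariate central limit theorem controls; by Weierstrass approximation the Laplace transforms
   determine the limits of the distribution functions. *)

theory Submission
  imports Defs
begin

text \<open>Fourth moments of the errors are what E[R R^T] asks for: a row contribution has degree
  two in X, so the averages in the variance estimator have summands with a first moment only. Hence
  the law of large numbers is proved by truncation. Every plug-in quantity is a polynomial in X with
  random coefficients; these leave the empirical mean by linearity, so no law of large numbers
  uniform in the coefficients is called for.

  Invertibility of A_u identifies \<beta>_u, but it does not prevent a combination of the influence
  functions from vanishing almost surely. This is the obstacle that differentiability in quadratic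
  mean removes. The test path keeps the law of the errors and moves only column u of \<beta>, in the
  direction a itself, so that a^T h becomes the squared norm of a.

  Ellipsoid and marginal intervals are Wald statements, with C the identity and C a unit row. The
  limit of distribution functions needs r > 0, since chi-squared with no degrees of freedom is a
  point mass.\<close>

section \<open>Convergence in probability\<close>

text \<open>Limits along this filter are limits in probability. The exceptional set \<open>A\<close> allows for events
  that are not known to be measurable.\<close>

definition whp :: "'a measure \<Rightarrow> (nat \<times> 'a) filter" where
  "whp M = Abs_filter (\<lambda>P. \<forall>\<eta>>0. \<exists>N. \<forall>n\<ge>N. \<exists>A\<in>sets M. measure M A \<le> \<eta> \<and> (\<forall>\<omega>\<in>space M - A. P (n, \<omega>)))"

text \<open>Only closure under conjunction has content: the tolerance \<eta> is split evenly between
  two exceptional sets. An exceptional set covers the event of failure, which may itself fail to be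
  measurable.\<close>

lemma eventually_whp:
  "eventually P (whp M) \<longleftrightarrow>
    (\<forall>\<eta>>0. \<exists>N. \<forall>n\<ge>N. \<exists>A\<in>sets M. measure M A \<le> \<eta> \<and> (\<forall>\<omega>\<in>space M - A. P (n, \<omega>)))"
proof -
  have "is_filter (\<lambda>P. \<forall>\<eta>>0. \<exists>N::nat. \<forall>n\<ge>N. \<exists>A\<in>sets M. measure M A \<le> \<eta> \<and> (\<forall>\<omega>\<in>space M - A. P (n, \<omega>)))"
    (is "is_filter ?F")
  proof (rule is_filter.intro)
    show "?F (\<lambda>x. True)"
      by (auto intro!: bexI[of _ "{}"])
  next
    fix P Q assume P: "?F P" and Q: "?F Q"
    show "?F (\<lambda>x. P x \<and> Q x)"
    proof (intro allI impI)
      fix \<eta> :: real assume "\<eta> > 0"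
      then have \<eta>: "\<eta> / 2 > 0" by simp
      obtain N where N: "\<forall>n\<ge>N. \<exists>A\<in>sets M. measure M A \<le> \<eta> / 2 \<and> (\<forall>\<omega>\<in>space M - A. P (n, \<omega>))"
        using P \<eta> by blast
      obtain N' where N': "\<forall>n\<ge>N'. \<exists>A\<in>sets M. measure M A \<le> \<eta> / 2 \<and> (\<forall>\<omega>\<in>space M - A. Q (n, \<omega>))"
        using Q \<eta> by blast
      show "\<exists>N. \<forall>n\<ge>N. \<exists>A\<in>sets M. measure M A \<le> \<eta> \<and> (\<forall>\<omega>\<in>space M - A. P (n, \<omega>) \<and> Q (n, \<omega>))"
      proof (intro exI[of _ "max N N'"] allI impI)
        fix n assume "max N N' \<le> n"
        then have n: "N \<le> n" "N' \<le> n" by auto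
        obtain A where "A \<in> sets M" "measure M A \<le> \<eta> / 2" "\<forall>\<omega>\<in>space M - A. P (n, \<omega>)"
          using N n by blast
        moreover obtain B where "B \<in> sets M" "measure M B \<le> \<eta> / 2" "\<forall>\<omega>\<in>space M - B. Q (n, \<omega>)"
          using N' n by blast
        ultimately show "\<exists>A\<in>sets M. measure M A \<le> \<eta> \<and> (\<forall>\<omega>\<in>space M - A. P (n, \<omega>) \<and> Q (n, \<omega>))"
          using measure_Un_le[of A M B] by (intro bexI[of _ "A \<union> B"]) auto
      qed
    qed
  next
    fix P Q assume "\<forall>x. P x \<longrightarrow> Q x" "?F P"
    then show "?F Q" by meson
  qed
  then show ?thesis
    unfolding whp_def by (rule eventually_Abs_filter)
qed

text \<open>For measurable events the event of failure is the smallest exceptional set, so the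
  filter recovers convergence of probabilities.\<close>

lemma (in prob_space) eventually_whp_null:
  assumes [measurable]: "\<And>n. {\<omega> \<in> space M. \<not> P (n, \<omega>)} \<in> sets M"
  shows "eventually P (whp M) \<longleftrightarrow> (\<lambda>n. prob {\<omega> \<in> space M. \<not> P (n, \<omega>)}) \<longlonglongrightarrow> 0"
proof
  assume P: "eventually P (whp M)"
  show "(\<lambda>n. prob {\<omega> \<in> space M. \<not> P (n, \<omega>)}) \<longlonglongrightarrow> 0"
  proof (rule tendstoI)
    fix e :: real assume "e > 0"
    then obtain N where N: "\<forall>n\<ge>N. \<exists>A\<in>sets M. measure M A \<le> e / 2 \<and> (\<forall>\<omega>\<in>space M - A. P (n, \<omega>))"
      using P unfolding eventually_whp by (meson half_gt_zero)
    have "prob {\<omega> \<in> space M. \<not> P (n, \<omega>)} < e" if "n \<ge> N" for n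
    proof -
      obtain A where A: "A \<in> sets M" "prob A \<le> e / 2" "\<forall>\<omega>\<in>space M - A. P (n, \<omega>)"
        using N \<open>n \<ge> N\<close> by blast
      then have "prob {\<omega> \<in> space M. \<not> P (n, \<omega>)} \<le> prob A"
        by (intro finite_measure_mono) auto
      then show ?thesis using A \<open>e > 0\<close> by linarith
    qed
    then show "\<forall>\<^sub>F n in sequentially. dist (prob {\<omega> \<in> space M. \<not> P (n, \<omega>)}) 0 < e"
      unfolding eventually_sequentially by (intro exI[of _ N]) auto
  qed
next
  assume P: "(\<lambda>n. prob {\<omega> \<in> space M. \<not> P (n, \<omega>)}) \<longlonglongrightarrow> 0"
  show "eventually P (whp M)"
    unfolding eventually_whp
  proof (intro allI impI)
    fix \<eta> :: real assume "\<eta> > 0"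
    then obtain N where "\<forall>n\<ge>N. prob {\<omega> \<in> space M. \<not> P (n, \<omega>)} < \<eta>"
      using order_tendstoD(2)[OF P] by (auto simp: eventually_sequentially)
    then show "\<exists>N. \<forall>n\<ge>N. \<exists>A\<in>sets M. prob A \<le> \<eta> \<and> (\<forall>\<omega>\<in>space M - A. P (n, \<omega>))"
      using assms by (intro exI[of _ N] allI impI bexI[of _ "{\<omega> \<in> space M. \<not> P (_, \<omega>)}"]) (auto intro: less_imp_le)
  qed
qed

lemma (in prob_space) eventually_whp_prob:
  assumes [measurable]: "\<And>n. {\<omega> \<in> space M. P (n, \<omega>)} \<in> sets M"
  shows "eventually P (whp M) \<longleftrightarrow> (\<lambda>n. prob {\<omega> \<in> space M. P (n, \<omega>)}) \<longlonglongrightarrow> 1"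
proof -
  have eq: "{\<omega> \<in> space M. \<not> P (n, \<omega>)} = space M - {\<omega> \<in> space M. P (n, \<omega>)}" for n
    by auto
  have "eventually P (whp M) \<longleftrightarrow> (\<lambda>n. 1 - prob {\<omega> \<in> space M. P (n, \<omega>)}) \<longlonglongrightarrow> 0"
    by (subst eventually_whp_null) (auto simp: eq prob_compl intro!: sets.compl_sets assms)
  also have "\<dots> \<longleftrightarrow> (\<lambda>n. prob {\<omega> \<in> space M. P (n, \<omega>)}) \<longlonglongrightarrow> 1"
  proof
    assume "(\<lambda>n. 1 - prob {\<omega> \<in> space M. P (n, \<omega>)}) \<longlonglongrightarrow> 0"
    from tendsto_diff[OF tendsto_const[of 1] this]
    show "(\<lambda>n. prob {\<omega> \<in> space M. P (n, \<omega>)}) \<longlonglongrightarrow> 1" by simp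
  next
    assume "(\<lambda>n. prob {\<omega> \<in> space M. P (n, \<omega>)}) \<longlonglongrightarrow> 1"
    from tendsto_diff[OF tendsto_const[of 1] this]
    show "(\<lambda>n. 1 - prob {\<omega> \<in> space M. P (n, \<omega>)}) \<longlonglongrightarrow> 0" by simp
  qed
  finally show ?thesis .
qed

lemma eventually_whp_ge: "eventually (\<lambda>z. N \<le> fst z) (whp M)"
  unfolding eventually_whp by (intro allI impI exI[of _ N] bexI[of _ "{}"]) auto

text \<open>Markov's inequality. The hypothesis asks for an eventual bound at every level rather
  than for a limit, which is the form in which a truncation argument delivers it.\<close>

lemma (in prob_space) tendsto_whp_if_L1:
  fixes T :: "nat \<times> 'a \<Rightarrow> real"
  assumes int: "\<And>n. integrable M (\<lambda>\<omega>. T (n, \<omega>))"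
    and lim: "\<And>e. e > 0 \<Longrightarrow> eventually (\<lambda>n. expectation (\<lambda>\<omega>. \<bar>T (n, \<omega>)\<bar>) \<le> e) sequentially"
  shows "(T \<longlongrightarrow> 0) (whp M)"
proof (rule tendstoI)
  fix e :: real assume e: "e > 0"
  have [measurable]: "(\<lambda>\<omega>. T (n, \<omega>)) \<in> borel_measurable M" for n
    using int by auto
  have le: "prob {\<omega> \<in> space M. \<not> dist (T (n, \<omega>)) 0 < e} \<le> expectation (\<lambda>\<omega>. \<bar>T (n, \<omega>)\<bar>) / e" for n
  proof -
    have "{\<omega> \<in> space M. \<not> dist (T (n, \<omega>)) 0 < e} = {\<omega> \<in> space M. \<bar>T (n, \<omega>)\<bar> \<ge> e}"
      by auto
    then show ?thesis
      using integral_Markov_inequality_measure[of M "\<lambda>\<omega>. \<bar>T (n, \<omega>)\<bar>" "{}" e] int e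
      by simp
  qed
  have "(\<lambda>n. prob {\<omega> \<in> space M. \<not> dist (T (n, \<omega>)) 0 < e}) \<longlonglongrightarrow> 0"
  proof (rule tendstoI)
    fix d :: real assume d: "d > 0"
    have "eventually (\<lambda>n. expectation (\<lambda>\<omega>. \<bar>T (n, \<omega>)\<bar>) \<le> d * e / 2) sequentially"
      using d e by (intro lim) auto
    then show "eventually (\<lambda>n. dist (prob {\<omega> \<in> space M. \<not> dist (T (n, \<omega>)) 0 < e}) 0 < d) sequentially"
    proof eventually_elim
      case (elim n)
      have "expectation (\<lambda>\<omega>. \<bar>T (n, \<omega>)\<bar>) / e \<le> d / 2"
        using elim e by (simp add: field_simps)
      then have "prob {\<omega> \<in> space M. \<not> dist (T (n, \<omega>)) 0 < e} < d"
        using le[of n] d by linarith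
      then show ?case by simp
    qed
  qed
  then show "\<forall>\<^sub>F z in whp M. dist (T z) 0 < e"
    by (subst eventually_whp_null) auto
qed

text \<open>Bounded convergence: split off the event where \<open>T\<close> reaches
  \<open>e / 2\<close> in absolute value, on which \<open>K\<close> is the only bound
  available.\<close>

lemma (in prob_space) expectation_tendsto_whp:
  fixes T :: "nat \<times> 'a \<Rightarrow> real"
  assumes [measurable]: "\<And>n. (\<lambda>\<omega>. T (n, \<omega>)) \<in> borel_measurable M"
    and bound: "\<And>z. \<bar>T z\<bar> \<le> K" and lim: "(T \<longlongrightarrow> 0) (whp M)"
  shows "(\<lambda>n. expectation (\<lambda>\<omega>. T (n, \<omega>))) \<longlonglongrightarrow> 0"
proof (rule tendstoI)
  fix e :: real assume e: "e > 0"
  have K: "K \<ge> 0" using bound[of undefined] by linarith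
  have "\<forall>\<^sub>F z in whp M. \<bar>T z\<bar> < e / 2"
    using tendstoD[OF lim, of "e/2"] e by simp
  then have lim: "(\<lambda>n. prob {\<omega> \<in> space M. \<not> \<bar>T (n, \<omega>)\<bar> < e / 2}) \<longlonglongrightarrow> 0"
    by (subst (asm) eventually_whp_null) auto
  \<comment> \<open>The \<open>+ 1\<close> keeps the quotient meaningful when \<open>K = 0\<close>;
    the exceptional event then contributes less than \<open>e / 2\<close>.\<close>
  have "eventually (\<lambda>n. prob {\<omega> \<in> space M. \<not> \<bar>T (n, \<omega>)\<bar> < e / 2} < e / (2 * (K + 1))) sequentially"
    using order_tendstoD(2)[OF lim, of "e / (2 * (K + 1))"] e K by simp
  then show "eventually (\<lambda>n. dist (expectation (\<lambda>\<omega>. T (n, \<omega>))) 0 < e) sequentially"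
  proof eventually_elim
    case (elim n)
    let ?B = "{\<omega> \<in> space M. \<not> \<bar>T (n, \<omega>)\<bar> < e / 2}"
    have T: "integrable M (\<lambda>\<omega>. T (n, \<omega>))"
      by (rule integrable_const_bound[of _ K]) (auto intro!: bound)
    have B: "integrable M (indicator ?B :: 'a \<Rightarrow> real)"
      by (intro integrable_real_indicator) (auto simp: emeasure_eq_measure)
    have "\<bar>expectation (\<lambda>\<omega>. T (n, \<omega>))\<bar> \<le> expectation (\<lambda>\<omega>. \<bar>T (n, \<omega>)\<bar>)"
      by simp
    also have "\<dots> \<le> expectation (\<lambda>\<omega>. e / 2 + K * indicator ?B \<omega>)"
    proof (rule integral_mono)
      show "integrable M (\<lambda>\<omega>. e / 2 + K * indicator ?B \<omega>)"
        by (intro Bochner_Integration.integrable_add integrable_mult_right B) simp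
    qed (use bound K e T in \<open>auto simp: indicator_def intro: order_trans[OF bound]\<close>)
    also have "\<dots> = e / 2 + K * prob ?B"
      using B by (subst Bochner_Integration.integral_add) (auto simp: prob_space)
    also have "\<dots> < e"
    proof -
      have "K * prob ?B \<le> (K + 1) * prob ?B" by (simp add: algebra_simps)
      also have "\<dots> < (K + 1) * (e / (2 * (K + 1)))"
        using elim K by (intro mult_strict_left_mono) auto
      also have "\<dots> = e / 2" using K by (simp add: field_simps)
      finally show ?thesis by simp
    qed
    finally show ?case by simp
  qed
qed

section \<open>Boundedness in probability\<close>

definition bounded_in_prob :: "'a measure \<Rightarrow> (nat \<times> 'a \<Rightarrow> real) \<Rightarrow> bool" where
  "bounded_in_prob M T \<longleftrightarrow> (\<forall>\<eta>>0. \<exists>K. \<forall>n. \<exists>A\<in>sets M. measure M A \<le> \<eta> \<and> (\<forall>\<omega>\<in>space M - A. \<bar>T (n, \<omega>)\<bar> \<le> K))"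

text \<open>The Slutsky step O_P(1) o_P(1) = o_P(1): the level \<open>K\<close> is fixed before
  smallness of \<open>S\<close> is requested at \<open>e / (\<bar>K\<bar> + 1)\<close>.\<close>

lemma bounded_in_prob_mult_null:
  assumes T: "bounded_in_prob M T" and S: "(S \<longlongrightarrow> 0) (whp M)"
  shows "((\<lambda>z. T z * S z) \<longlongrightarrow> 0) (whp M)"
proof (rule tendstoI)
  fix e :: real assume e: "e > 0"
  show "\<forall>\<^sub>F z in whp M. dist (T z * S z) 0 < e"
    unfolding eventually_whp
  proof (intro allI impI)
    fix \<eta> :: real assume \<eta>: "\<eta> > 0"
    obtain K where K: "\<And>n. \<exists>A\<in>sets M. measure M A \<le> \<eta> / 2 \<and> (\<forall>\<omega>\<in>space M - A. \<bar>T (n, \<omega>)\<bar> \<le> K)"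
      using T \<eta> unfolding bounded_in_prob_def by (meson half_gt_zero)
    have "eventually (\<lambda>z. \<bar>S z\<bar> < e / (\<bar>K\<bar> + 1)) (whp M)"
      using tendstoD[OF S, of "e / (\<bar>K\<bar> + 1)"] e by simp
    then obtain N where N: "\<forall>n\<ge>N. \<exists>B\<in>sets M. measure M B \<le> \<eta> / 2 \<and>
        (\<forall>\<omega>\<in>space M - B. \<bar>S (n, \<omega>)\<bar> < e / (\<bar>K\<bar> + 1))"
      unfolding eventually_whp using \<eta> by (meson half_gt_zero)
    show "\<exists>N. \<forall>n\<ge>N. \<exists>A\<in>sets M. measure M A \<le> \<eta> \<and> (\<forall>\<omega>\<in>space M - A. dist (T (n, \<omega>) * S (n, \<omega>)) 0 < e)"
    proof (intro exI[of _ N] allI impI)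
      fix n assume n: "n \<ge> N"
      obtain A where A: "A \<in> sets M" "measure M A \<le> \<eta> / 2" "\<And>\<omega>. \<omega>\<in>space M - A \<Longrightarrow> \<bar>T (n, \<omega>)\<bar> \<le> K"
        using K by blast
      obtain B where B: "B \<in> sets M" "measure M B \<le> \<eta> / 2"
          "\<And>\<omega>. \<omega>\<in>space M - B \<Longrightarrow> \<bar>S (n, \<omega>)\<bar> < e / (\<bar>K\<bar> + 1)"
        using N n by blast
      have "measure M (A \<union> B) \<le> \<eta>"
        using measure_Un_le[OF A(1) B(1)] A(2) B(2) by simp
      moreover have "dist (T (n, \<omega>) * S (n, \<omega>)) 0 < e" if "\<omega> \<in> space M - (A \<union> B)" for \<omega>
      proof -
        have "\<bar>T (n, \<omega>) * S (n, \<omega>)\<bar> \<le> (\<bar>K\<bar> + 1) * \<bar>S (n, \<omega>)\<bar>"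
          unfolding abs_mult using A(3)[of \<omega>] that by (intro mult_right_mono) auto
        also have "\<dots> < (\<bar>K\<bar> + 1) * (e / (\<bar>K\<bar> + 1))"
          using B(3)[of \<omega>] that by (intro mult_strict_left_mono) auto
        finally show ?thesis by simp
      qed
      ultimately show "\<exists>A\<in>sets M. measure M A \<le> \<eta> \<and> (\<forall>\<omega>\<in>space M - A. dist (T (n, \<omega>) * S (n, \<omega>)) 0 < e)"
        using A(1) B(1) by (intro bexI[of _ "A \<union> B"]) auto
    qed
  qed
qed

lemma bounded_in_prob_mult:
  assumes S: "bounded_in_prob M S" and T: "bounded_in_prob M T" shows "bounded_in_prob M (\<lambda>z. S z * T z)"
  unfolding bounded_in_prob_def
proof (intro allI impI)
  fix \<eta> :: real assume \<eta>: "\<eta> > 0"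
  obtain K where K: "\<And>n. \<exists>A\<in>sets M. measure M A \<le> \<eta> / 2 \<and> (\<forall>\<omega>\<in>space M - A. \<bar>S (n, \<omega>)\<bar> \<le> K)"
    using S \<eta> unfolding bounded_in_prob_def by (meson half_gt_zero)
  obtain L where L: "\<And>n. \<exists>A\<in>sets M. measure M A \<le> \<eta> / 2 \<and> (\<forall>\<omega>\<in>space M - A. \<bar>T (n, \<omega>)\<bar> \<le> L)"
    using T \<eta> unfolding bounded_in_prob_def by (meson half_gt_zero)
  have "\<exists>A\<in>sets M. measure M A \<le> \<eta> \<and> (\<forall>\<omega>\<in>space M - A. \<bar>S (n, \<omega>) * T (n, \<omega>)\<bar> \<le> \<bar>K\<bar> * \<bar>L\<bar>)" for n
  proof -
    obtain A where A: "A \<in> sets M" "measure M A \<le> \<eta> / 2" "\<And>\<omega>. \<omega>\<in>space M - A \<Longrightarrow> \<bar>S (n, \<omega>)\<bar> \<le> K"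
      using K by blast
    obtain B where B: "B \<in> sets M" "measure M B \<le> \<eta> / 2" "\<And>\<omega>. \<omega>\<in>space M - B \<Longrightarrow> \<bar>T (n, \<omega>)\<bar> \<le> L"
      using L by blast
    have "measure M (A \<union> B) \<le> \<eta>"
      using measure_Un_le[OF A(1) B(1)] A(2) B(2) by simp
    moreover have "\<bar>S (n, \<omega>) * T (n, \<omega>)\<bar> \<le> \<bar>K\<bar> * \<bar>L\<bar>" if "\<omega> \<in> space M - (A \<union> B)" for \<omega>
      unfolding abs_mult using A(3)[of \<omega>] B(3)[of \<omega>] that by (intro mult_mono) auto
    ultimately show ?thesis
      using A(1) B(1) by (intro bexI[of _ "A \<union> B"]) auto
  qed
  then show "\<exists>K. \<forall>n. \<exists>A\<in>sets M. measure M A \<le> \<eta> \<and> (\<forall>\<omega>\<in>space M - A. \<bar>S (n, \<omega>) * T (n, \<omega>)\<bar> \<le> K)"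
    by blast
qed

text \<open>Chebyshev's inequality; since the bound \<open>C\<close> is the same for all
  \<open>n\<close>, one \<open>K\<close> serves all of them.\<close>

lemma (in prob_space) bounded_in_prob_if_L2:
  fixes T :: "nat \<times> 'a \<Rightarrow> real"
  assumes int: "\<And>n. integrable M (\<lambda>\<omega>. (T (n, \<omega>))\<^sup>2)"
    and [measurable]: "\<And>n. (\<lambda>\<omega>. T (n, \<omega>)) \<in> borel_measurable M"
    and bound: "\<And>n. expectation (\<lambda>\<omega>. (T (n, \<omega>))\<^sup>2) \<le> C"
  shows "bounded_in_prob M T"
  unfolding bounded_in_prob_def
proof (intro allI impI)
  fix \<eta> :: real assume \<eta>: "\<eta> > 0"
  \<comment> \<open>Solves \<open>(\<bar>C\<bar> + 1) / K\<^sup>2 = \<eta>\<close>; the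
    \<open>+ 1\<close> makes \<open>K\<close> positive.\<close>
  define K where "K = sqrt ((\<bar>C\<bar> + 1) / \<eta>)"
  have K: "K > 0" "K\<^sup>2 = (\<bar>C\<bar> + 1) / \<eta>" using \<eta> by (auto simp: K_def)
  have "\<exists>A\<in>sets M. prob A \<le> \<eta> \<and> (\<forall>\<omega>\<in>space M - A. \<bar>T (n, \<omega>)\<bar> \<le> K)" for n
  proof (intro bexI[of _ "{\<omega> \<in> space M. (T (n, \<omega>))\<^sup>2 \<ge> K\<^sup>2}"] conjI ballI)
    have "prob {\<omega> \<in> space M. (T (n, \<omega>))\<^sup>2 \<ge> K\<^sup>2} \<le> expectation (\<lambda>\<omega>. (T (n, \<omega>))\<^sup>2) / K\<^sup>2"
      using integral_Markov_inequality_measure[of M "\<lambda>\<omega>. (T (n, \<omega>))\<^sup>2" "{}" "K\<^sup>2"] int K(1)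
      by simp
    also have "\<dots> \<le> C / K\<^sup>2"
      using bound[of n] by (intro divide_right_mono) auto
    also have "\<dots> \<le> (\<bar>C\<bar> + 1) / K\<^sup>2" by (intro divide_right_mono) auto
    also have "\<dots> = \<eta>" using \<eta> by (simp add: K)
    finally show "prob {\<omega> \<in> space M. (T (n, \<omega>))\<^sup>2 \<ge> K\<^sup>2} \<le> \<eta>" .
  next
    fix \<omega> assume "\<omega> \<in> space M - {\<omega> \<in> space M. (T (n, \<omega>))\<^sup>2 \<ge> K\<^sup>2}"
    then have "(T (n, \<omega>))\<^sup>2 < K\<^sup>2" by auto
    then have "\<bar>T (n, \<omega>)\<bar> < \<bar>K\<bar>" using power2_less_imp_less[of "\<bar>T (n, \<omega>)\<bar>" "\<bar>K\<bar>"] by auto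
    then show "\<bar>T (n, \<omega>)\<bar> \<le> K" using K by simp
  qed auto
  then show "\<exists>K. \<forall>n. \<exists>A\<in>sets M. prob A \<le> \<eta> \<and> (\<forall>\<omega>\<in>space M - A. \<bar>T (n, \<omega>)\<bar> \<le> K)" by blast
qed


section \<open>The weak law of large numbers\<close>

lemma (in prob_space) expectation_sum_squared:
  fixes Z :: "nat \<Rightarrow> 'a \<Rightarrow> real"
  assumes indep: "indep_vars (\<lambda>_. borel) Z UNIV"
    and sq: "\<And>i. integrable M (\<lambda>\<omega>. (Z i \<omega>)\<^sup>2)"
    and mean: "\<And>i. expectation (Z i) = 0"
    and s: "\<And>i. expectation (\<lambda>\<omega>. (Z i \<omega>)\<^sup>2) = s"
  shows "integrable M (\<lambda>\<omega>. (\<Sum>i<n. Z i \<omega>)\<^sup>2)" (is ?int)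
    and "expectation (\<lambda>\<omega>. (\<Sum>i<n. Z i \<omega>)\<^sup>2) = real n * s" (is ?eq)
proof -
  have [measurable]: "random_variable borel (Z i)" for i
    using indep by (auto simp: indep_vars_def)
  have Z: "integrable M (Z i)" for i
    by (rule square_integrable_imp_integrable) (use sq in auto)
  have ij: "integrable M (\<lambda>\<omega>. Z i \<omega> * Z j \<omega>)"
      "expectation (\<lambda>\<omega>. Z i \<omega> * Z j \<omega>) = (if i = j then s else 0)" for i j
  proof -
    have "integrable M (\<lambda>\<omega>. Z i \<omega> * Z j \<omega>) \<and>
      expectation (\<lambda>\<omega>. Z i \<omega> * Z j \<omega>) = (if i = j then s else 0)"
    proof (cases "i = j")
      case True
      then show ?thesis using sq[of i] s[of i] by (simp add: power2_eq_square)
    next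
      case False
      have *: "indep_vars (\<lambda>_. borel) Z {i, j}"
        by (rule indep_vars_subset[OF indep]) auto
      show ?thesis
        using indep_vars_lebesgue_integral[OF _ * Z] indep_vars_integrable[OF _ * Z] False mean
        by simp
    qed
    then show "integrable M (\<lambda>\<omega>. Z i \<omega> * Z j \<omega>)"
      "expectation (\<lambda>\<omega>. Z i \<omega> * Z j \<omega>) = (if i = j then s else 0)" by auto
  qed
  have sum: "(\<Sum>i<n. Z i \<omega>)\<^sup>2 = (\<Sum>i<n. \<Sum>j<n. Z i \<omega> * Z j \<omega>)" for \<omega>
    by (simp add: power2_eq_square sum_product)
  show ?int unfolding sum using ij by (intro Bochner_Integration.integrable_sum)
  have "expectation (\<lambda>\<omega>. (\<Sum>i<n. Z i \<omega>)\<^sup>2) = (\<Sum>i<n. \<Sum>j<n. expectation (\<lambda>\<omega>. Z i \<omega> * Z j \<omega>))"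
    unfolding sum using ij(1) by (simp add: Bochner_Integration.integral_sum)
  also have "\<dots> = real n * s" by (simp add: ij)
  finally show ?eq .
qed

text \<open>Truncation, because only a first moment is available: the law will be applied to
  products of four coordinates, whose variance may be infinite.\<close>

lemma (in prob_space) weak_law_of_large_numbers:
  fixes Z :: "nat \<Rightarrow> 'a \<Rightarrow> real"
  assumes indep: "indep_vars (\<lambda>_. borel) Z UNIV"
    and distr: "\<And>i. distr M borel (Z i) = D"
    and int: "integrable D (\<lambda>x. x)"
  shows "((\<lambda>z. (\<Sum>i<fst z. Z i (snd z)) / real (fst z)) \<longlongrightarrow> (\<integral>x. x \<partial>D)) (whp M)"
proof -
  define m where "m = (\<integral>x. x \<partial>D)"
  have rv [measurable]: "random_variable borel (Z i)" for i
    using indep by (auto simp: indep_vars_def)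
  have D: "prob_space D" "sets D = sets borel"
    using prob_space_distr[OF rv[of 0]] by (auto simp flip: distr[of 0])
  then interpret D: prob_space D by simp
  note D(2)[measurable_cong]
  have tr_int: "integrable M (\<lambda>\<omega>. f (Z i \<omega>))" "expectation (\<lambda>\<omega>. f (Z i \<omega>)) = (\<integral>x. f x \<partial>D)"
    if "integrable D f" for f :: "real \<Rightarrow> real" and i
  proof -
    have [measurable]: "f \<in> borel_measurable borel"
      using that D(2) by (metis borel_measurable_integrable measurable_cong_sets)
    show "integrable M (\<lambda>\<omega>. f (Z i \<omega>))" "expectation (\<lambda>\<omega>. f (Z i \<omega>)) = (\<integral>x. f x \<partial>D)"
      using that by (auto simp: integrable_distr_eq integral_distr simp flip: distr[of i])
  qed
  \<comment> \<open>Clipping to [-k, k]: the result is bounded, hence square integrable, and at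
    distance at most \<open>\<bar>x\<bar>\<close> from \<open>x\<close>, which gives the dominating
    function below.\<close>
  define \<tau> where "\<tau> k x = max (- real k) (min (real k) x)" for k and x :: real
  have \<tau>_meas [measurable]: "\<tau> k \<in> borel_measurable borel" for k
    unfolding \<tau>_def by measurable
  have \<tau>_bound: "\<bar>\<tau> k x\<bar> \<le> real k" for k x
    by (auto simp: \<tau>_def)
  have \<tau>_int: "integrable D (\<tau> k)" for k
    by (rule D.integrable_const_bound[of _ "real k"]) (use \<tau>_bound in auto)
  have \<tau>_lim: "(\<lambda>k. \<integral>x. \<bar>x - \<tau> k x\<bar> \<partial>D) \<longlonglongrightarrow> (\<integral>x. 0 \<partial>D)"
  proof (rule integral_dominated_convergence[where w="\<lambda>x. \<bar>x\<bar>"])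
    show "AE x in D. (\<lambda>k. \<bar>x - \<tau> k x\<bar>) \<longlonglongrightarrow> 0"
    proof (rule AE_I2)
      fix x :: real
      obtain N :: nat where N: "\<bar>x\<bar> \<le> real N" using real_arch_simple by blast
      have "\<bar>x - \<tau> k x\<bar> = 0" if "k \<ge> N" for k
        using N that by (auto simp: \<tau>_def)
      then show "(\<lambda>k. \<bar>x - \<tau> k x\<bar>) \<longlonglongrightarrow> 0"
        by (intro tendsto_eventually) (auto simp: eventually_sequentially)
    qed
    have "\<bar>x - \<tau> k x\<bar> \<le> \<bar>x\<bar>" for k and x :: real
      using of_nat_0_le_iff[of k, where 'a=real] unfolding \<tau>_def max_def min_def
      by (cases "real k \<le> x"; cases "- real k \<le> x") simp_all
    then show "AE x in D. norm \<bar>x - \<tau> k x\<bar> \<le> \<bar>x\<bar>" for k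
      by simp
    show "integrable D (\<lambda>x. \<bar>x\<bar>)" by (rule integrable_abs[OF int])
    show "(\<lambda>x. \<bar>x - \<tau> k x\<bar>) \<in> borel_measurable D" for k
      by measurable
    show "(\<lambda>x. 0) \<in> borel_measurable D" by (rule borel_measurable_const)
  qed
  have "((\<lambda>z. (\<Sum>i<fst z. Z i (snd z)) / real (fst z) - m) \<longlongrightarrow> 0) (whp M)"
  proof (rule tendsto_whp_if_L1)
    show "integrable M (\<lambda>\<omega>. (\<Sum>i<fst (n, \<omega>). Z i (snd (n, \<omega>))) / real (fst (n, \<omega>)) - m)" for n
      using tr_int(1)[OF int] by simp
  next
    fix e :: real assume e: "e > 0"
    \<comment> \<open>Four errors of size \<delta> are added: the clipped-off part, the shift of the
      mean, and two from the bound on the centred clipped average.\<close>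
    define \<delta> where "\<delta> = e / 4"
    have \<delta>: "\<delta> > 0" using e by (simp add: \<delta>_def)
    obtain k where k: "(\<integral>x. \<bar>x - \<tau> k x\<bar> \<partial>D) \<le> \<delta>"
      using order_tendstoD(2)[OF \<tau>_lim, of \<delta>] \<delta> by (auto simp: eventually_sequentially intro: less_imp_le)
    define c where "c = (\<integral>x. \<tau> k x \<partial>D)"
    have "\<bar>m - c\<bar> = \<bar>\<integral>x. x - \<tau> k x \<partial>D\<bar>"
      using int \<tau>_int by (simp add: m_def c_def)
    also have "\<dots> \<le> (\<integral>x. \<bar>x - \<tau> k x\<bar> \<partial>D)" by (rule integral_abs_bound)
    finally have mc: "\<bar>m - c\<bar> \<le> \<delta>" using k by simp
    define U where "U i \<omega> = \<tau> k (Z i \<omega>) - c" for i \<omega>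
    define s where "s = (\<integral>x. (\<tau> k x - c)\<^sup>2 \<partial>D)"
    have U_sq_int: "integrable D (\<lambda>x. (\<tau> k x - c)\<^sup>2)"
    proof (rule D.integrable_const_bound[of _ "(real k + \<bar>c\<bar>)\<^sup>2"])
      have "(\<tau> k x - c)\<^sup>2 \<le> (real k + \<bar>c\<bar>)\<^sup>2" for x
        using \<tau>_bound[of k x] by (intro abs_le_square_iff[THEN iffD1]) auto
      then show "AE x in D. norm ((\<tau> k x - c)\<^sup>2) \<le> (real k + \<bar>c\<bar>)\<^sup>2" by simp
    qed simp
    have U: "indep_vars (\<lambda>_. borel) U UNIV"
      using indep_vars_compose2[OF indep, of "\<lambda>i x. \<tau> k x - c" "\<lambda>_. borel"] by (simp add: U_def[abs_def])
    have U_mean: "expectation (U i) = 0" for i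
      unfolding U_def using tr_int[OF \<tau>_int[of k], of i] by (simp add: c_def prob_space)
    have U_sq: "integrable M (\<lambda>\<omega>. (U i \<omega>)\<^sup>2)" "expectation (\<lambda>\<omega>. (U i \<omega>)\<^sup>2) = s" for i
      unfolding U_def s_def by (rule tr_int[OF U_sq_int])+
    note U_sum = expectation_sum_squared[OF U U_sq(1) U_mean U_sq(2)]
    have s: "s \<ge> 0" unfolding s_def by simp
    have bound: "expectation (\<lambda>\<omega>. \<bar>(\<Sum>i<n. Z i \<omega>) / real n - m\<bar>) \<le> e"
      if n: "n \<ge> 1" "real n \<ge> s / \<delta>\<^sup>2" for n
    proof -
      have n0: "real n > 0" using n by simp
      have pt: "\<bar>(\<Sum>i<n. Z i \<omega>) / real n - m\<bar> \<le>
          (\<Sum>i<n. \<bar>Z i \<omega> - \<tau> k (Z i \<omega>)\<bar>) / real n + ((\<Sum>i<n. U i \<omega>)\<^sup>2 / ((real n)\<^sup>2 * \<delta>) + \<delta>) + \<delta>" for \<omega>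
      proof -
        define a where "a = (\<Sum>i<n. U i \<omega>) / real n"
        have "(\<Sum>i<n. Z i \<omega>) / real n - m = (\<Sum>i<n. Z i \<omega> - \<tau> k (Z i \<omega>)) / real n + a + (c - m)"
          using n0 unfolding a_def U_def by (simp add: sum_subtractf field_simps)
        moreover have "\<bar>(\<Sum>i<n. Z i \<omega> - \<tau> k (Z i \<omega>)) / real n\<bar> \<le> (\<Sum>i<n. \<bar>Z i \<omega> - \<tau> k (Z i \<omega>)\<bar>) / real n"
          using n0 by (simp add: abs_divide divide_right_mono sum_abs)
        \<comment> \<open>This inequality lets the variance of the clipped average control its first
          absolute moment; the bound \<open>s / \<delta>\<^sup>2\<close> on \<open>n\<close> makes
          the mean of the quadratic term at most \<delta>.\<close>
        moreover have "\<bar>a\<bar> \<le> a\<^sup>2 / \<delta> + \<delta>"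
        proof -
          have "0 \<le> (\<bar>a\<bar> - \<delta>)\<^sup>2 + \<bar>a\<bar> * \<delta>" using \<delta> by simp
          then have "\<bar>a\<bar> * \<delta> \<le> a\<^sup>2 + \<delta> * \<delta>" by (simp add: power2_eq_square algebra_simps)
          then show ?thesis using \<delta> by (simp add: field_simps)
        qed
        moreover have "a\<^sup>2 / \<delta> = (\<Sum>i<n. U i \<omega>)\<^sup>2 / ((real n)\<^sup>2 * \<delta>)"
          by (simp add: a_def power_divide)
        ultimately show ?thesis using mc by linarith
      qed
      have i1: "integrable M (\<lambda>\<omega>. \<bar>Z i \<omega> - \<tau> k (Z i \<omega>)\<bar>)"
          "expectation (\<lambda>\<omega>. \<bar>Z i \<omega> - \<tau> k (Z i \<omega>)\<bar>) = (\<integral>x. \<bar>x - \<tau> k x\<bar> \<partial>D)" for i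
        using tr_int[of "\<lambda>x. \<bar>x - \<tau> k x\<bar>" i] int \<tau>_int by auto
      have "expectation (\<lambda>\<omega>. \<bar>(\<Sum>i<n. Z i \<omega>) / real n - m\<bar>) \<le>
        expectation (\<lambda>\<omega>. (\<Sum>i<n. \<bar>Z i \<omega> - \<tau> k (Z i \<omega>)\<bar>) / real n +
          ((\<Sum>i<n. U i \<omega>)\<^sup>2 / ((real n)\<^sup>2 * \<delta>) + \<delta>) + \<delta>)"
        using pt i1 U_sum(1) tr_int(1)[OF int] by (intro integral_mono) auto
      also have "\<dots> = (\<integral>x. \<bar>x - \<tau> k x\<bar> \<partial>D) + real n * s / ((real n)\<^sup>2 * \<delta>) + \<delta> + \<delta>"
        using i1 U_sum n0 by (simp add: prob_space Bochner_Integration.integral_sum)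
      also have "real n * s / ((real n)\<^sup>2 * \<delta>) \<le> \<delta>"
        using n(2) n0 \<delta> by (simp add: power2_eq_square field_simps)
      finally show ?thesis using k by (simp add: \<delta>_def)
    qed
    show "\<forall>\<^sub>F n in sequentially. expectation (\<lambda>\<omega>. \<bar>(\<Sum>i<fst (n, \<omega>). Z i (snd (n, \<omega>))) / real (fst (n, \<omega>)) - m\<bar>) \<le> e"
      using eventually_ge_at_top[of "max 1 (nat \<lceil>s / \<delta>\<^sup>2\<rceil>)"]
    proof eventually_elim
      case (elim n)
      then have "real n \<ge> s / \<delta>\<^sup>2" by (meson max.bounded_iff nat_ceiling_le_eq)
      then show ?case using bound[of n] elim by simp
    qed
  qed
  from tendsto_add[OF this tendsto_const[of m]] show ?thesis by (simp add: m_def)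
qed

section \<open>Inverse and positive definite matrices\<close>

lemma invertible_mat_iff_det:
  fixes A :: "real Matrix.mat"
  assumes A: "A \<in> carrier_mat n n"
  shows "invertible_mat A \<longleftrightarrow> Determinant.det A \<noteq> 0"
proof
  assume "invertible_mat A"
  then obtain B where B: "A * B = 1\<^sub>m n" "B * A = 1\<^sub>m (dim_row B)"
    using A by (auto simp: invertible_mat_def inverts_mat_def)
  \<comment> \<open>Invertibility leaves the size of \<open>B\<close> open; comparing dimensions in
    the two identities fixes it.\<close>
  have "dim_col (B * A) = dim_col (1\<^sub>m (dim_row B) :: real Matrix.mat)"
    "dim_col (A * B) = dim_col (1\<^sub>m n :: real Matrix.mat)"
    using B by (simp_all only:)
  then have "B \<in> carrier_mat n n"
    using A by (intro carrier_matI) simp_all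
  then show "Determinant.det A \<noteq> 0"
    using det_mult[OF A, of B] B by auto
next
  assume d: "Determinant.det A \<noteq> 0"
  let ?B = "(1 / Determinant.det A) \<cdot>\<^sub>m adj_mat A"
  have "A * ?B = 1\<^sub>m n" "?B * A = 1\<^sub>m n"
    using adj_mat[OF A] A d by (auto simp: mult_smult_distrib mult_smult_assoc_mat)
  moreover have "dim_row ?B = n" "dim_row A = n" "dim_col A = n" using adj_mat(1)[OF A] A by auto
  ultimately show "invertible_mat A"
    unfolding invertible_mat_def inverts_mat_def square_mat.simps by metis
qed

lemma inv_mat_unique:
  assumes A: "A \<in> carrier_mat n n" and B: "B \<in> carrier_mat n n" and AB: "A * B = 1\<^sub>m n"
  shows "inv_mat A = B"
proof -
  have BA: "B * A = 1\<^sub>m n" by (rule mat_mult_left_right_inverse[OF A B AB])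
  show ?thesis
  proof (cases "mat_inverse A")
    case None
    from mat_inverse(1)[OF A this, of undefined] AB BA A B
    show ?thesis by (auto simp: Units_def ring_mat_def)
  next
    case (Some B')
    from mat_inverse(2)[OF A this] have B': "A * B' = 1\<^sub>m n" "B' * A = 1\<^sub>m n" "B' \<in> carrier_mat n n"
      by auto
    have "B' = B' * (A * B)" using B' AB by simp
    also have "\<dots> = B' * A * B" by (rule assoc_mult_mat[symmetric]) (use A B B' in auto)
    also have "\<dots> = B" using B' B by simp
    finally show ?thesis using Some by (simp add: inv_mat_def)
  qed
qed

text \<open>Cramer's rule without a case distinction: for a singular matrix, division by zero yields
  the zero matrix, which is also the default value of \<open>inv_mat\<close>. Entries of the inverse
  are thus rational functions of the entries everywhere, which is how measurability of the
  estimators is obtained.\<close>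

lemma inv_mat_eq:
  assumes A: "A \<in> carrier_mat n n"
  shows "inv_mat A = (1 / Determinant.det A) \<cdot>\<^sub>m adj_mat A"
proof (cases "Determinant.det A = 0")
  case True
  have "mat_inverse A = None"
  proof (rule ccontr)
    assume "mat_inverse A \<noteq> None"
    then obtain B where "mat_inverse A = Some B" by auto
    from mat_inverse(2)[OF A this] have "A * B = 1\<^sub>m n" "B \<in> carrier_mat n n" by auto
    then have "Determinant.det A * Determinant.det B = 1" using det_mult[OF A, of B] by simp
    then show False using True by simp
  qed
  then show ?thesis using True A adj_mat(1)[OF A] by (intro eq_matI) (auto simp: inv_mat_def)
next
  case False
  show ?thesis
  proof (rule inv_mat_unique[OF A])
    show "(1 / Determinant.det A) \<cdot>\<^sub>m adj_mat A \<in> carrier_mat n n"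
      using adj_mat(1)[OF A] by simp
    show "A * ((1 / Determinant.det A) \<cdot>\<^sub>m adj_mat A) = 1\<^sub>m n"
      using adj_mat[OF A] A False by (auto simp: mult_smult_distrib)
  qed
qed

lemma inv_mat_carrier:
  assumes A: "A \<in> carrier_mat n n" shows "inv_mat A \<in> carrier_mat n n"
proof -
  show ?thesis unfolding inv_mat_eq[OF A] by (rule smult_carrier_mat[OF adj_mat(1)[OF A]])
qed

lemma inv_mat_inverse:
  assumes A: "A \<in> carrier_mat n n" and d: "Determinant.det A \<noteq> 0"
  shows "A * inv_mat A = 1\<^sub>m n" "inv_mat A * A = 1\<^sub>m n"
proof -
  show "A * inv_mat A = 1\<^sub>m n"
    unfolding inv_mat_eq[OF A] mult_smult_distrib[OF A adj_mat(1)[OF A]] adj_mat(2)[OF A]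
    using d by auto
  show "inv_mat A * A = 1\<^sub>m n"
    unfolding inv_mat_eq[OF A] mult_smult_assoc_mat[OF adj_mat(1)[OF A] A] adj_mat(3)[OF A]
    using d by auto
qed

lemma inv_mat_index:
  assumes A: "A \<in> carrier_mat n n" and "i < n" "j < n"
  shows "inv_mat A $$ (i, j) = cofactor A j i / Determinant.det A"
proof -
  have "dim_row A = n" "dim_col A = n" using A by auto
  then show ?thesis using assms(2,3) unfolding inv_mat_eq[OF A] by (simp add: adj_mat_def)
qed

lemma mult_mat_vec_index:
  assumes "A \<in> carrier_mat n m" "x \<in> carrier_vec m" "i < n"
  shows "(A *\<^sub>v x) $v i = (\<Sum>j<m. A $$ (i, j) * x $v j)"
proof -
  have "(A *\<^sub>v x) $v i = scalar_prod (Matrix.row A i) x" using assms by simp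
  also have "\<dots> = (\<Sum>j<m. A $$ (i, j) * x $v j)"
    unfolding scalar_prod_def using assms by (intro sum.cong) auto
  finally show ?thesis .
qed

lemma mult_mat_index:
  assumes "A \<in> carrier_mat n m" "B \<in> carrier_mat m k" "i < n" "j < k"
  shows "(A * B) $$ (i, j) = (\<Sum>l<m. A $$ (i, l) * B $$ (l, j))"
proof -
  have "(A * B) $$ (i, j) = scalar_prod (Matrix.row A i) (col B j)" using assms by simp
  also have "\<dots> = (\<Sum>l<m. A $$ (i, l) * B $$ (l, j))"
    unfolding scalar_prod_def using assms by (intro sum.cong) auto
  finally show ?thesis .
qed

lemma quad_form_sum:
  assumes A: "A \<in> carrier_mat n n" and x: "x \<in> carrier_vec n"
  shows "quad_form A x = (\<Sum>i<n. \<Sum>j<n. x $v i * x $v j * A $$ (i, j))"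
proof -
  have "quad_form A x = (\<Sum>i<n. x $v i * (A *\<^sub>v x) $v i)"
    unfolding quad_form_def scalar_prod_def using A by (intro sum.cong) auto
  also have "\<dots> = (\<Sum>i<n. \<Sum>j<n. x $v i * x $v j * A $$ (i, j))"
    by (intro sum.cong refl, subst mult_mat_vec_index[OF A x])
      (simp_all add: sum_distrib_left mult.assoc mult.left_commute mult.commute)
  finally show ?thesis .
qed

section \<open>Positive definiteness, whitening and row rank\<close>

definition positive_definite :: "nat \<Rightarrow> real Matrix.mat \<Rightarrow> bool" where
  "positive_definite n S \<longleftrightarrow> S \<in> carrier_mat n n \<and> transpose_mat S = S \<and>
     (\<forall>x\<in>carrier_vec n. x \<noteq> 0\<^sub>v n \<longrightarrow> quad_form S x > 0)"

lemma positive_definite_det: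
  assumes "positive_definite n S" shows "Determinant.det S \<noteq> 0"
proof
  assume "Determinant.det S = 0"
  moreover have S: "S \<in> carrier_mat n n" using assms by (simp add: positive_definite_def)
  ultimately obtain x where x: "x \<in> carrier_vec n" "x \<noteq> 0\<^sub>v n" "S *\<^sub>v x = 0\<^sub>v n"
    using det_0_iff_vec_prod_zero[OF S] by blast
  then have "quad_form S x = 0" by (simp add: quad_form_def)
  with assms x show False by (auto simp: positive_definite_def)
qed

text \<open>Gram-Schmidt for the inner product given by \<open>S\<close>, with the next vector found
  as a kernel vector instead of a projection.\<close>

lemma positive_definite_orthonormal:
  assumes S: "positive_definite n S" and "m \<le> n"
  shows "\<exists>f. (\<forall>i<m. f i \<in> carrier_vec n) \<and>
    (\<forall>i<m. \<forall>j<m. scalar_prod (f i) (S *\<^sub>v f j) = (if i = j then 1 else (0::real)))"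
  using \<open>m \<le> n\<close>
proof (induction m)
  case 0
  then show ?case by auto
next
  case (Suc m)
  then obtain f where f: "\<And>i. i < m \<Longrightarrow> f i \<in> carrier_vec n"
    "\<And>i j. i < m \<Longrightarrow> j < m \<Longrightarrow> scalar_prod (f i) (S *\<^sub>v f j) = (if i = j then 1 else 0)"
    by auto
  have Sc: "S \<in> carrier_mat n n" "transpose_mat S = S" using S by (auto simp: positive_definite_def)
  have sym: "scalar_prod x (S *\<^sub>v y) = scalar_prod y (S *\<^sub>v x)"
    if "x \<in> carrier_vec n" "y \<in> carrier_vec n" for x y
    using transpose_vec_mult_scalar[OF Sc(1) that(2,1)] that Sc
    by (metis comm_scalar_prod mult_mat_vec_carrier)
  \<comment> \<open>A square matrix whose first \<open>m\<close> rows are the vectors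
    \<open>S *\<^sub>v f i\<close> and whose remaining rows vanish; a vector in its kernel is
    \<open>S\<close>-orthogonal to all \<open>f i\<close>.\<close>
  define N where "N = Matrix.mat n n (\<lambda>(i, j). if i < m then (S *\<^sub>v f i) $v j else 0)"
  have N: "N \<in> carrier_mat n n" by (simp add: N_def)
  \<comment> \<open>Row \<open>m\<close> is zero and \<open>m < n\<close>, so \<open>N\<close> is
    singular and a nonzero kernel vector exists.\<close>
  have "transpose_mat N *\<^sub>v unit_vec n m = 0\<^sub>v n"
    using Suc.prems by (intro eq_vecI) (auto simp: N_def scalar_prod_def unit_vec_def intro!: sum.neutral)
  moreover have "unit_vec n m \<noteq> (0\<^sub>v n :: real Matrix.vec)"
    using Suc.prems by (metis Suc_le_eq index_unit_vec(1) index_zero_vec(1) zero_neq_one)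
  ultimately have "Determinant.det (transpose_mat N) = 0"
    using det_0_iff_vec_prod_zero[of "transpose_mat N" n] N by (metis transpose_carrier_mat unit_vec_carrier)
  then have "Determinant.det N = 0" using det_transpose[OF N] by simp
  then obtain w where w: "w \<in> carrier_vec n" "w \<noteq> 0\<^sub>v n" "N *\<^sub>v w = 0\<^sub>v n"
    using det_0_iff_vec_prod_zero[OF N] by blast
  have orth: "scalar_prod w (S *\<^sub>v f i) = 0" if "i < m" for i
  proof -
    have "Matrix.row N i = S *\<^sub>v f i"
      using that Suc.prems Sc by (intro eq_vecI) (auto simp: N_def)
    then have "(N *\<^sub>v w) $v i = scalar_prod (S *\<^sub>v f i) w"
      using that Suc.prems N by simp
    then show ?thesis using w that Suc.prems f[OF that] Sc
      by (metis Suc_leD comm_scalar_prod index_zero_vec(1) less_le_trans mult_mat_vec_carrier)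
  qed
  define q where "q = quad_form S w"
  have q: "q > 0" using S w by (auto simp: positive_definite_def q_def)
  define g where "g = f(m := (1 / sqrt q) \<cdot>\<^sub>v w)"
  have g: "g i \<in> carrier_vec n" if "i < Suc m" for i
    using that f w by (auto simp: g_def less_Suc_eq)
  have "scalar_prod (g i) (S *\<^sub>v g j) = (if i = j then 1 else 0)" if ij: "i < Suc m" "j < Suc m" for i j
  proof -
    have mm: "scalar_prod (g m) (S *\<^sub>v g m) = 1"
      using w Sc q by (simp add: g_def mult_mat_vec q_def quad_form_def flip: power2_eq_square)
    have mi: "scalar_prod (g m) (S *\<^sub>v g i) = 0" if "i < m" for i
      using w Sc f[OF that] orth[OF that] that by (simp add: g_def)
    have im: "scalar_prod (g i) (S *\<^sub>v g m) = 0" if "i < m" for i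
      using mi[OF that] sym[OF g g] that by simp
    show ?thesis
      using ij mm mi im f(2) by (auto simp: less_Suc_eq g_def)
  qed
  with g show ?case by (intro exI[of _ g]) auto
qed

text \<open>The rows of \<open>B\<close> are \<open>S\<close>-orthonormal. A right inverse of a
  square matrix is a left inverse, so the inverse of \<open>S\<close> factors through
  \<open>B\<close>; this turns the Wald form into a plain sum of squares.\<close>

lemma positive_definite_whitening:
  assumes S: "positive_definite n S"
  obtains B where "B \<in> carrier_mat n n" "B * S * transpose_mat B = 1\<^sub>m n"
    "inv_mat S = transpose_mat B * B"
proof -
  obtain f where f: "\<And>i. i < n \<Longrightarrow> f i \<in> carrier_vec n"
    "\<And>i j. i < n \<Longrightarrow> j < n \<Longrightarrow> scalar_prod (f i) (S *\<^sub>v f j) = (if i = j then 1 else 0)"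
    using positive_definite_orthonormal[OF S, of n] by auto
  have Sc: "S \<in> carrier_mat n n" using S by (auto simp: positive_definite_def)
  define B where "B = mat_of_rows n (map f [0..<n])"
  have B: "B \<in> carrier_mat n n" by (simp add: B_def mat_of_rows_def)
  have rB: "Matrix.row B i = f i" if "i < n" for i
    using that f(1)[OF that] by (simp add: B_def)
  have BSB: "B * (S * transpose_mat B) = 1\<^sub>m n"
  proof (rule eq_matI)
    fix i j assume "i < dim_row (1\<^sub>m n :: real Matrix.mat)" "j < dim_col (1\<^sub>m n :: real Matrix.mat)"
    then have ij: "i < n" "j < n" by auto
    have "(B * (S * transpose_mat B)) $$ (i, j) = scalar_prod (Matrix.row B i) (col (S * transpose_mat B) j)"
      using ij B Sc by simp
    also have "col (S * transpose_mat B) j = S *\<^sub>v f j"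
      by (subst col_mult2[of S n n _ n]) (use ij B Sc f rB in auto)
    finally show "(B * (S * transpose_mat B)) $$ (i, j) = 1\<^sub>m n $$ (i, j)"
      using ij rB f by simp
  qed (use B Sc in auto)
  have BT: "transpose_mat B \<in> carrier_mat n n" "S * transpose_mat B \<in> carrier_mat n n" using B Sc by auto
  have "S * transpose_mat B * B = 1\<^sub>m n"
    by (rule mat_mult_left_right_inverse[OF B _ BSB]) (use B Sc in auto)
  then have "S * (transpose_mat B * B) = 1\<^sub>m n"
    using assoc_mult_mat[OF Sc BT(1) B] by simp
  then have "inv_mat S = transpose_mat B * B"
    by (intro inv_mat_unique[OF Sc]) (use B BT in auto)
  moreover have "B * S * transpose_mat B = 1\<^sub>m n"
    using BSB assoc_mult_mat[OF B Sc BT(1)] by simp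
  ultimately show thesis using that B by blast
qed

text \<open>Rank \<open>r\<close> yields \<open>r\<close> independent columns of \<open>C\<close>,
  hence an invertible square submatrix \<open>A\<close>. A vector killed by the transpose of
  \<open>C\<close> is orthogonal to these columns, so it is killed by the transpose of
  \<open>A\<close>.\<close>

lemma full_row_rank_transpose_injective:
  fixes C :: "real Matrix.mat"
  assumes C: "C \<in> carrier_mat r k" and rank: "vec_space.rank r C = r"
    and x: "x \<in> carrier_vec r" and zero: "transpose_mat C *\<^sub>v x = 0\<^sub>v k"
  shows "x = 0\<^sub>v r"
proof -
  interpret vec_space "TYPE(real)" r .
  obtain S where S: "maximal S (\<lambda>T. T \<subseteq> set (cols C) \<and> lin_indpt T)" "finite S"
    using maximal_exists_superset[of "set (cols C)" "\<lambda>T. T \<subseteq> set (cols C) \<and> lin_indpt T" "{}"]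
      finite_lin_indpt2 by (auto simp: lin_dep_def)
  have card: "card S = r" using rank_card_indpt[OF C S(1)] rank by simp
  have Ssub: "S \<subseteq> set (cols C)" "lin_indpt S" using S(1) by (auto simp: maximal_def)
  then have Sc: "S \<subseteq> carrier_vec r" using cols_dim[of C] C by auto
  obtain cs where cs: "set cs = S" "distinct cs" using S(2) finite_distinct_list by blast
  define A where "A = mat_of_cols r cs"
  have A: "A \<in> carrier_mat r r" using card cs distinct_card[of cs] by (auto simp: A_def)
  have cA: "cols A = cs" using cs Sc by (simp add: A_def)
  have "rank A = r" using lin_indpt_full_rank[OF A] cA cs Ssub by simp
  then have "Determinant.det A \<noteq> 0" using det_rank_iff[OF A] by simp
  then have dT: "Determinant.det (transpose_mat A) \<noteq> 0" using det_transpose[OF A] by simp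
  have "transpose_mat A *\<^sub>v x = 0\<^sub>v r"
  proof (rule eq_vecI)
    fix i assume "i < dim_vec (0\<^sub>v r :: real Matrix.vec)"
    then have i: "i < r" by simp
    have "col A i \<in> set (cols C)"
      using Ssub(1) cs cA i A by (metis carrier_matD(2) cols_length cols_nth nth_mem subsetD)
    then obtain l where l: "l < k" "col A i = col C l"
      using C by (metis carrier_matD(2) cols_length cols_nth in_set_conv_nth)
    have "(transpose_mat A *\<^sub>v x) $v i = scalar_prod (col C l) x"
      using i A l by simp
    also have "\<dots> = (transpose_mat C *\<^sub>v x) $v l" using l C by simp
    finally show "(transpose_mat A *\<^sub>v x) $v i = 0\<^sub>v r $v i" using zero l i by simp
  qed (use A in auto)
  then show ?thesis
    using det_0_iff_vec_prod_zero[of "transpose_mat A" r] dT A x by (metis transpose_carrier_mat)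
qed

section \<open>Null sets along paths that are differentiable in quadratic mean\<close>

lemma sets_measure_sum [simp]: "sets (measure_sum M N) = sets M"
  and space_measure_sum [simp]: "space (measure_sum M N) = space M"
  by (auto simp: measure_sum_def)

lemma emeasure_measure_sum:
  assumes "sets N = sets M" "A \<in> sets M"
  shows "emeasure (measure_sum M N) A = emeasure M A + emeasure N A"
proof (rule emeasure_measure_of[OF measure_sum_def])
  show "countably_additive (sets (measure_sum M N)) (\<lambda>A. emeasure M A + emeasure N A)"
  proof (rule countably_additiveI)
    fix F :: "nat \<Rightarrow> _" assume F: "range F \<subseteq> sets (measure_sum M N)" "disjoint_family F"
    then have "(\<Sum>i. emeasure M (F i)) = emeasure M (\<Union> (range F))"
      "(\<Sum>i. emeasure N (F i)) = emeasure N (\<Union> (range F))"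
      using assms by (auto intro!: suminf_emeasure)
    then show "(\<Sum>i. emeasure M (F i) + emeasure N (F i)) = emeasure M (\<Union> (range F)) + emeasure N (\<Union> (range F))"
      by (simp add: suminf_add[symmetric])
  qed
qed (use assms sets.space_closed in \<open>auto simp: positive_def\<close>)

text \<open>On a \<open>P\<^sub>0\<close>-null set the density of \<open>P\<^sub>0\<close> vanishes
  almost everywhere with respect to the sum, so both subtracted terms disappear and the remainder
  integrand is the density of \<open>P\<close> divided by \<gamma>^2. Its integral over
  \<open>N\<close> alone is the left-hand side.\<close>

lemma emeasure_le_dqm_remainder:
  assumes P\<^sub>0: "prob_space P\<^sub>0" and P: "prob_space P" and sets: "sets P = sets P\<^sub>0"
    and N: "N \<in> sets P\<^sub>0" "emeasure P\<^sub>0 N = 0"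
    and S: "S \<in> borel_measurable P\<^sub>0" and "\<gamma> \<noteq> 0"
  shows "emeasure P N / ennreal (\<gamma>\<^sup>2) \<le> dqm_remainder P\<^sub>0 P S \<gamma>"
proof -
  interpret P0: prob_space P\<^sub>0 by fact
  interpret P: prob_space P by fact
  define \<nu> where "\<nu> = measure_sum P\<^sub>0 P"
  have sets\<nu>: "sets \<nu> = sets P\<^sub>0" by (simp add: \<nu>_def)
  note sets\<nu>[measurable_cong] sets[measurable_cong]
  have em: "emeasure \<nu> A = emeasure P\<^sub>0 A + emeasure P A" if "A \<in> sets P\<^sub>0" for A
    unfolding \<nu>_def by (rule emeasure_measure_sum[OF sets that])
  have "finite_measure \<nu>"
  proof
    have "space P\<^sub>0 = space P" using sets by (rule sets_eq_imp_space_eq[symmetric])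
    then show "emeasure \<nu> (space \<nu>) \<noteq> \<infinity>"
      using em[OF sets.top] P.emeasure_space_1 P0.emeasure_space_1 by (simp add: \<nu>_def)
  qed
  then interpret \<nu>: finite_measure \<nu> .
  have ac0: "absolutely_continuous \<nu> P\<^sub>0" and ac: "absolutely_continuous \<nu> P"
    by (auto simp: absolutely_continuous_def null_sets_def sets\<nu> sets em)
  define p0 where "p0 x = sqrt (enn2real (RN_deriv \<nu> P\<^sub>0 x))" for x
  define p where "p x = sqrt (enn2real (RN_deriv \<nu> P x))" for x
  have [measurable]: "RN_deriv \<nu> P\<^sub>0 \<in> borel_measurable P\<^sub>0" "RN_deriv \<nu> P \<in> borel_measurable P\<^sub>0"
    using borel_measurable_RN_deriv[of \<nu>] by (auto simp: measurable_cong_sets[OF sets\<nu> refl])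
  have [measurable]: "p \<in> borel_measurable P\<^sub>0" "p0 \<in> borel_measurable P\<^sub>0" "S \<in> borel_measurable P\<^sub>0" "N \<in> sets P\<^sub>0"
    using S N unfolding p_def p0_def by measurable
  have fin: "AE x in \<nu>. RN_deriv \<nu> P x \<noteq> \<infinity>"
    by (rule \<nu>.RN_deriv_finite[OF _ ac]) (auto simp: sets sets\<nu> P.sigma_finite_measure_axioms)
  have "emeasure P\<^sub>0 N = (\<integral>\<^sup>+x. RN_deriv \<nu> P\<^sub>0 x * indicator N x \<partial>\<nu>)"
    using \<nu>.RN_deriv_nn_integral[OF ac0, of "indicator N"] N sets\<nu> by simp
  then have "(\<integral>\<^sup>+x. RN_deriv \<nu> P\<^sub>0 x * indicator N x \<partial>\<nu>) = 0" using N by simp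
  then have zero: "AE x in \<nu>. RN_deriv \<nu> P\<^sub>0 x * indicator N x = 0"
    by (subst (asm) nn_integral_0_iff_AE) auto
  have "emeasure P N = (\<integral>\<^sup>+x. RN_deriv \<nu> P x * indicator N x \<partial>\<nu>)"
    using \<nu>.RN_deriv_nn_integral[OF ac, of "indicator N"] N sets sets\<nu> by simp
  also have "\<dots> = (\<integral>\<^sup>+x. ennreal ((p x)\<^sup>2) * indicator N x \<partial>\<nu>)"
    using fin by (intro nn_integral_cong_AE) (auto simp: p_def less_top)
  finally have "emeasure P N / ennreal (\<gamma>\<^sup>2) = (\<integral>\<^sup>+x. ennreal ((p x)\<^sup>2) * indicator N x / ennreal (\<gamma>\<^sup>2) \<partial>\<nu>)"
    by (simp add: nn_integral_divide)
  also have "\<dots> \<le> (\<integral>\<^sup>+x. ennreal (((p x - p0 x) / \<gamma> - S x * p0 x / 2)\<^sup>2) \<partial>\<nu>)"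
    using zero
  proof (intro nn_integral_mono_AE, eventually_elim)
    case (elim x)
    show ?case
    proof (cases "x \<in> N")
      case True
      then have "p0 x = 0" using elim by (simp add: p0_def)
      then have "((p x - p0 x) / \<gamma> - S x * p0 x / 2)\<^sup>2 = (p x)\<^sup>2 / \<gamma>\<^sup>2" by (simp add: power_divide)
      then show ?thesis using True \<open>\<gamma> \<noteq> 0\<close> by (simp add: divide_ennreal)
    qed simp
  qed
  also have "\<dots> = dqm_remainder P\<^sub>0 P S \<gamma>"
    by (simp add: dqm_remainder_def \<nu>_def p_def p0_def Let_def)
  finally show ?thesis .
qed

lemma dqm_const:
  assumes "prob_space Q" shows "dqm (\<lambda>\<gamma>. Q)"
  unfolding dqm_def dqm_remainder_def Let_def
  by (rule bexI[of _ "\<lambda>_. 0"]) auto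

lemma dqm_null_set:
  assumes dqm: "dqm P" and prob: "\<And>\<gamma>. prob_space (P \<gamma>)" and sets: "\<And>\<gamma>. sets (P \<gamma>) = sets (P 0)"
    and N: "N \<in> sets (P 0)" "measure (P 0) N = 0"
  shows "((\<lambda>\<gamma>. measure (P \<gamma>) N / \<gamma>\<^sup>2) \<longlongrightarrow> 0) (at 0)"
proof -
  obtain S where S: "S \<in> borel_measurable (P 0)"
    "((\<lambda>\<gamma>. dqm_remainder (P 0) (P \<gamma>) S \<gamma>) \<longlongrightarrow> 0) (at 0)"
    using dqm by (auto simp: dqm_def)
  have fin: "finite_measure (P \<gamma>)" for \<gamma> using prob[of \<gamma>] by (simp add: prob_space.finite_measure)
  have le: "ennreal (measure (P \<gamma>) N / \<gamma>\<^sup>2) \<le> dqm_remainder (P 0) (P \<gamma>) S \<gamma>" if "\<gamma> \<noteq> 0" for \<gamma>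
    using emeasure_le_dqm_remainder[OF prob prob sets N(1) _ S(1) that] N(2) that
    by (simp add: finite_measure.emeasure_eq_measure[OF fin] divide_ennreal)
  have "((\<lambda>\<gamma>. ennreal (measure (P \<gamma>) N / \<gamma>\<^sup>2)) \<longlongrightarrow> 0) (at 0)"
    by (rule tendsto_sandwich[OF _ _ tendsto_const S(2)])
      (auto simp: eventually_at_filter le intro!: always_eventually)
  then show ?thesis
    by (simp add: tendsto_ennreal_iff[where x=0, simplified] flip: ennreal_0)
qed

section \<open>Consistent estimation\<close>

text \<open>Measurability for each fixed \<open>n\<close> travels with the limit, so that one set of
  closure rules shows at the same time that the estimators are random variables and that they
  converge.\<close>

definition consistent :: "'a measure \<Rightarrow> (nat \<times> 'a \<Rightarrow> real) \<Rightarrow> real \<Rightarrow> bool" where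
  "consistent M T c \<longleftrightarrow> (\<forall>n. (\<lambda>\<omega>. T (n, \<omega>)) \<in> borel_measurable M) \<and> (T \<longlongrightarrow> c) (whp M)"

lemma consistent_const: "consistent M (\<lambda>z. c) c"
  by (simp add: consistent_def)

lemma consistent_add: "consistent M S a \<Longrightarrow> consistent M T b \<Longrightarrow> consistent M (\<lambda>z. S z + T z) (a + b)"
  unfolding consistent_def
  by (auto intro!: tendsto_intros borel_measurable_add borel_measurable_diff borel_measurable_times
    borel_measurable_divide)

lemma consistent_diff: "consistent M S a \<Longrightarrow> consistent M T b \<Longrightarrow> consistent M (\<lambda>z. S z - T z) (a - b)"
  unfolding consistent_def
  by (auto intro!: tendsto_intros borel_measurable_add borel_measurable_diff borel_measurable_times
    borel_measurable_divide)

lemma consistent_mult: "consistent M S a \<Longrightarrow> consistent M T b \<Longrightarrow> consistent M (\<lambda>z. S z * T z) (a * b)"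
  unfolding consistent_def
  by (auto intro!: tendsto_intros borel_measurable_add borel_measurable_diff borel_measurable_times
    borel_measurable_divide)

text \<open>Totality of division gives measurability on all samples, including those where the
  denominator vanishes; \<open>b \<noteq> 0\<close> concerns the limit.\<close>

lemma consistent_divide:
  "consistent M S a \<Longrightarrow> consistent M T b \<Longrightarrow> b \<noteq> 0 \<Longrightarrow> consistent M (\<lambda>z. S z / T z) (a / b)"
  unfolding consistent_def
  by (auto intro!: tendsto_intros borel_measurable_add borel_measurable_diff borel_measurable_times
    borel_measurable_divide)

lemma consistent_sum:
  "(\<And>i. i \<in> I \<Longrightarrow> consistent M (T i) (c i)) \<Longrightarrow> consistent M (\<lambda>z. \<Sum>i\<in>I. T i z) (\<Sum>i\<in>I. c i)"
  by (induction I rule: infinite_finite_induct) (auto intro: consistent_const consistent_add)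

lemma consistent_prod:
  "(\<And>i. i \<in> I \<Longrightarrow> consistent M (T i) (c i)) \<Longrightarrow> consistent M (\<lambda>z. \<Prod>i\<in>I. T i z) (\<Prod>i\<in>I. c i)"
  by (induction I rule: infinite_finite_induct) (auto intro: consistent_const consistent_mult)

definition mat_consistent :: "'a measure \<Rightarrow> nat \<Rightarrow> nat \<Rightarrow> (nat \<times> 'a \<Rightarrow> real Matrix.mat) \<Rightarrow> real Matrix.mat \<Rightarrow> bool" where
  "mat_consistent M nr nc A A\<^sub>0 \<longleftrightarrow> (\<forall>z. A z \<in> carrier_mat nr nc) \<and> A\<^sub>0 \<in> carrier_mat nr nc \<and>
     (\<forall>i<nr. \<forall>j<nc. consistent M (\<lambda>z. A z $$ (i, j)) (A\<^sub>0 $$ (i, j)))"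

lemma mat_consistentI:
  assumes "\<And>z. A z \<in> carrier_mat nr nc" "A\<^sub>0 \<in> carrier_mat nr nc"
    "\<And>i j. i < nr \<Longrightarrow> j < nc \<Longrightarrow> consistent M (\<lambda>z. A z $$ (i, j)) (A\<^sub>0 $$ (i, j))"
  shows "mat_consistent M nr nc A A\<^sub>0"
  unfolding mat_consistent_def using assms by blast

lemma mat_consistentD:
  assumes "mat_consistent M nr nc A A\<^sub>0"
  shows "A z \<in> carrier_mat nr nc" "A\<^sub>0 \<in> carrier_mat nr nc"
    "i < nr \<Longrightarrow> j < nc \<Longrightarrow> consistent M (\<lambda>z. A z $$ (i, j)) (A\<^sub>0 $$ (i, j))"
  using assms unfolding mat_consistent_def by blast+

lemma mat_consistent_const: "A \<in> carrier_mat nr nc \<Longrightarrow> mat_consistent M nr nc (\<lambda>z. A) A"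
  by (intro mat_consistentI consistent_const)

lemma mat_consistent_transpose:
  assumes "mat_consistent M nr nc A A\<^sub>0"
  shows "mat_consistent M nc nr (\<lambda>z. transpose_mat (A z)) (transpose_mat A\<^sub>0)"
proof (rule mat_consistentI)
  note A = mat_consistentD[OF assms]
  have dims: "dim_row (A z) = nr" "dim_col (A z) = nc" "dim_row A\<^sub>0 = nr" "dim_col A\<^sub>0 = nc" for z
    using A(1)[of z] A(2) by auto
  fix i j assume "i < nc" "j < nr"
  then show "consistent M (\<lambda>z. transpose_mat (A z) $$ (i, j)) (transpose_mat A\<^sub>0 $$ (i, j))"
    using A(3) dims by simp
qed (simp_all add: mat_consistentD[OF assms])

lemma mat_consistent_mult:
  assumes A: "mat_consistent M nr n A A\<^sub>0" and B: "mat_consistent M n nc B B\<^sub>0"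
  shows "mat_consistent M nr nc (\<lambda>z. A z * B z) (A\<^sub>0 * B\<^sub>0)"
proof (rule mat_consistentI)
  note A = mat_consistentD[OF A] and B = mat_consistentD[OF B]
  fix i j assume ij: "i < nr" "j < nc"
  have "consistent M (\<lambda>z. \<Sum>l<n. A z $$ (i, l) * B z $$ (l, j)) (\<Sum>l<n. A\<^sub>0 $$ (i, l) * B\<^sub>0 $$ (l, j))"
    using A B ij by (intro consistent_sum consistent_mult) auto
  then show "consistent M (\<lambda>z. (A z * B z) $$ (i, j)) ((A\<^sub>0 * B\<^sub>0) $$ (i, j))"
    unfolding mult_mat_index[OF A(1) B(1) ij] mult_mat_index[OF A(2) B(2) ij] .
next
  show "A z * B z \<in> carrier_mat nr nc" "A\<^sub>0 * B\<^sub>0 \<in> carrier_mat nr nc" for z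
    by (rule mult_carrier_mat[OF mat_consistentD(1)[OF A] mat_consistentD(1)[OF B]],
        rule mult_carrier_mat[OF mat_consistentD(2)[OF A] mat_consistentD(2)[OF B]])
qed

text \<open>The Leibniz formula makes the determinant a polynomial in the entries.\<close>

lemma consistent_det:
  assumes "mat_consistent M n n A A\<^sub>0"
  shows "consistent M (\<lambda>z. Determinant.det (A z)) (Determinant.det A\<^sub>0)"
proof -
  note A = mat_consistentD[OF assms]
  have *: "consistent M (\<lambda>z. \<Sum>p | p permutes {0..<n}. of_int (sign p) * (\<Prod>i = 0..<n. A z $$ (i, p i)))
    (\<Sum>p | p permutes {0..<n}. of_int (sign p) * (\<Prod>i = 0..<n. A\<^sub>0 $$ (i, p i)))"
    using A by (intro consistent_sum consistent_mult consistent_const consistent_prod)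
      (auto simp: permutes_in_image)
  have det: "Determinant.det B = (\<Sum>p | p permutes {0..<n}. of_int (sign p) * (\<Prod>i = 0..<n. B $$ (i, p i)))"
    if "B \<in> carrier_mat n n" for B :: "real Matrix.mat"
    using that by (auto simp: Determinant.det_def)
  show ?thesis using * unfolding det[OF A(1)] det[OF A(2)] .
qed

text \<open>Cramer's rule writes each entry as a cofactor over the determinant, also for singular
  samples, so no exceptional event has to be split off.\<close>

lemma mat_consistent_inv:
  assumes A: "mat_consistent M n n A A\<^sub>0" and det: "Determinant.det A\<^sub>0 \<noteq> 0"
  shows "mat_consistent M n n (\<lambda>z. inv_mat (A z)) (inv_mat A\<^sub>0)"
proof (rule mat_consistentI)
  note A' = mat_consistentD[OF A]
  show "inv_mat (A z) \<in> carrier_mat n n" "inv_mat A\<^sub>0 \<in> carrier_mat n n" for z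
    by (rule inv_mat_carrier[OF A'(1)], rule inv_mat_carrier[OF A'(2)])
  fix i j assume ij: "i < n" "j < n"
  have dims: "dim_row (A z) = n" "dim_col (A z) = n" "dim_row A\<^sub>0 = n" "dim_col A\<^sub>0 = n" for z
    using A'(1)[of z] A'(2) by auto
  have "mat_consistent M (n - 1) (n - 1) (\<lambda>z. mat_delete (A z) j i) (mat_delete A\<^sub>0 j i)"
  proof (rule mat_consistentI)
    show "mat_delete (A z) j i \<in> carrier_mat (n - 1) (n - 1)" "mat_delete A\<^sub>0 j i \<in> carrier_mat (n - 1) (n - 1)" for z
      by (rule mat_delete_carrier[OF A'(1)], rule mat_delete_carrier[OF A'(2)])
    fix a b assume "a < n - 1" "b < n - 1"
    then show "consistent M (\<lambda>z. mat_delete (A z) j i $$ (a, b)) (mat_delete A\<^sub>0 j i $$ (a, b))"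
      unfolding mat_delete_def dims using A'(3) by simp
  qed
  then have "consistent M (\<lambda>z. cofactor (A z) j i) (cofactor A\<^sub>0 j i)"
    unfolding cofactor_def by (intro consistent_mult consistent_const consistent_det)
  then show "consistent M (\<lambda>z. inv_mat (A z) $$ (i, j)) (inv_mat A\<^sub>0 $$ (i, j))"
    unfolding inv_mat_index[OF A'(1) ij] inv_mat_index[OF A'(2) ij]
    by (rule consistent_divide[OF _ consistent_det[OF A] det])
qed

lemma consistent_mat_vec:
  assumes A: "mat_consistent M n m A A\<^sub>0"
    and x: "\<And>z. x z \<in> carrier_vec m" "x\<^sub>0 \<in> carrier_vec m" "\<And>j. j < m \<Longrightarrow> consistent M (\<lambda>z. x z $v j) (x\<^sub>0 $v j)"
    and i: "i < n"
  shows "consistent M (\<lambda>z. (A z *\<^sub>v x z) $v i) ((A\<^sub>0 *\<^sub>v x\<^sub>0) $v i)"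
proof -
  note A = mat_consistentD[OF A]
  have "consistent M (\<lambda>z. \<Sum>j<m. A z $$ (i, j) * x z $v j) (\<Sum>j<m. A\<^sub>0 $$ (i, j) * x\<^sub>0 $v j)"
    using A x i by (intro consistent_sum consistent_mult) auto
  then show ?thesis
    unfolding mult_mat_vec_index[OF A(1) x(1) i] mult_mat_vec_index[OF A(2) x(2) i] .
qed

section \<open>Empirical moments of functions with estimated coefficients\<close>

text \<open>\<open>F z\<close> is \<open>f\<close> with its coefficients in the basis \<open>g\<close> replaced by consistent estimates.\<close>

definition span_consistent ::
    "'a measure \<Rightarrow> ('i::finite \<Rightarrow> 'x \<Rightarrow> real) \<Rightarrow> (nat \<times> 'a \<Rightarrow> 'x \<Rightarrow> real) \<Rightarrow> ('x \<Rightarrow> real) \<Rightarrow> bool" where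
  "span_consistent M g F f \<longleftrightarrow> (\<exists>C c. (\<forall>z x. F z x = (\<Sum>a\<in>UNIV. C a z * g a x)) \<and>
     (\<forall>x. f x = (\<Sum>a\<in>UNIV. c a * g a x)) \<and> (\<forall>a. consistent M (C a) (c a)))"

lemma span_consistent_basis: "span_consistent M g (\<lambda>z. g a) (g a)"
  unfolding span_consistent_def
  by (intro exI[of _ "\<lambda>b z. if b = a then 1 else 0"] exI[of _ "\<lambda>b. if b = a then 1 else 0"])
    (auto intro: consistent_const simp: if_distrib[where f="\<lambda>u. u * _"] cong: if_cong)

lemma span_consistent_scale:
  assumes "consistent M T c" "span_consistent M g F f"
  shows "span_consistent M g (\<lambda>z x. T z * F z x) (\<lambda>x. c * f x)"
proof -
  obtain D d where D: "\<And>z x. F z x = (\<Sum>a\<in>UNIV. D a z * g a x)" "\<And>x. f x = (\<Sum>a\<in>UNIV. d a * g a x)"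
    "\<And>a. consistent M (D a) (d a)"
    using assms(2) unfolding span_consistent_def by blast
  show ?thesis
    unfolding span_consistent_def
    by (intro exI[of _ "\<lambda>a z. T z * D a z"] exI[of _ "\<lambda>a. c * d a"])
      (auto intro!: consistent_mult assms(1) D(3) simp: D(1,2) sum_distrib_left mult.assoc)
qed

lemma span_consistent_add:
  assumes "span_consistent M g F f" "span_consistent M g F' f'"
  shows "span_consistent M g (\<lambda>z x. F z x + F' z x) (\<lambda>x. f x + f' x)"
proof -
  obtain D d where D: "\<And>z x. F z x = (\<Sum>a\<in>UNIV. D a z * g a x)" "\<And>x. f x = (\<Sum>a\<in>UNIV. d a * g a x)"
    "\<And>a. consistent M (D a) (d a)"
    using assms(1) unfolding span_consistent_def by blast
  obtain E e where E: "\<And>z x. F' z x = (\<Sum>a\<in>UNIV. E a z * g a x)" "\<And>x. f' x = (\<Sum>a\<in>UNIV. e a * g a x)"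
    "\<And>a. consistent M (E a) (e a)"
    using assms(2) unfolding span_consistent_def by blast
  show ?thesis
    unfolding span_consistent_def
    by (intro exI[of _ "\<lambda>a z. D a z + E a z"] exI[of _ "\<lambda>a. d a + e a"])
      (auto intro!: consistent_add D(3) E(3) simp: D(1,2) E(1,2) sum.distrib algebra_simps)
qed

lemma span_consistent_zero: "span_consistent M g (\<lambda>z x. 0) (\<lambda>x. 0)"
  unfolding span_consistent_def
  by (intro exI[of _ "\<lambda>a z. 0"] exI[of _ "\<lambda>a. 0"]) (auto intro: consistent_const)

lemma span_consistent_sum:
  "(\<And>i. i \<in> I \<Longrightarrow> span_consistent M g (F i) (f i)) \<Longrightarrow>
    span_consistent M g (\<lambda>z x. \<Sum>i\<in>I. F i z x) (\<lambda>x. \<Sum>i\<in>I. f i x)"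
  by (induction I rule: infinite_finite_induct) (auto intro: span_consistent_zero span_consistent_add)

lemma span_consistent_diff:
  assumes "span_consistent M g F f" "span_consistent M g F' f'"
  shows "span_consistent M g (\<lambda>z x. F z x - F' z x) (\<lambda>x. f x - f' x)"
  using span_consistent_add[OF assms(1) span_consistent_scale[OF consistent_const[of M "-1"] assms(2)]]
  by simp

text \<open>The basis of the products is indexed by pairs. Starting from monomials of degree at most
  one, two applications reach degree four, the highest degree that the moment assumption
  integrates.\<close>

lemma span_consistent_mult:
  assumes "span_consistent M g F f" "span_consistent M h F' f'"
  shows "span_consistent M (\<lambda>(a, b) x. g a x * h b x) (\<lambda>z x. F z x * F' z x) (\<lambda>x. f x * f' x)"
proof -
  obtain D d where D: "\<And>z x. F z x = (\<Sum>a\<in>UNIV. D a z * g a x)" "\<And>x. f x = (\<Sum>a\<in>UNIV. d a * g a x)"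
    "\<And>a. consistent M (D a) (d a)"
    using assms(1) unfolding span_consistent_def by blast
  obtain E e where E: "\<And>z x. F' z x = (\<Sum>a\<in>UNIV. E a z * h a x)" "\<And>x. f' x = (\<Sum>a\<in>UNIV. e a * h a x)"
    "\<And>a. consistent M (E a) (e a)"
    using assms(2) unfolding span_consistent_def by blast
  show ?thesis
    unfolding span_consistent_def
    by (intro exI[of _ "\<lambda>(a, b) z. D a z * E b z"] exI[of _ "\<lambda>(a, b). d a * e b"])
      (auto intro!: consistent_mult D(3) E(3) sum.cong
        simp: D(1,2) E(1,2) sum_product sum.cartesian_product mult.assoc mult.left_commute simp flip: UNIV_Times_UNIV)
qed

section \<open>Averages over an i.i.d. sample\<close>

lemma iid_sample_prob_space: "iid_sample M X P \<Longrightarrow> prob_space M"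
  by (simp add: iid_sample_def)

lemma iid_sample_measurable: "iid_sample M X P \<Longrightarrow> X i \<in> borel_measurable M"
  by (auto simp: iid_sample_def prob_space.indep_vars_def)

lemma iid_sample_sets: "iid_sample M X P \<Longrightarrow> sets P = sets borel"
  unfolding iid_sample_def by (metis sets_distr)

lemma iid_sample_compose:
  fixes f :: "real ^ 'v::finite \<Rightarrow> real"
  assumes iid: "iid_sample M X P" and f: "f \<in> borel_measurable borel"
  shows "prob_space.indep_vars M (\<lambda>_. borel) (\<lambda>i \<omega>. f (X i \<omega>)) UNIV"
    and "distr M borel (\<lambda>\<omega>. f (X i \<omega>)) = distr P borel f"
    and "integrable P f \<Longrightarrow> integrable M (\<lambda>\<omega>. f (X i \<omega>))"
    and "(\<integral>\<omega>. f (X i \<omega>) \<partial>M) = (\<integral>x. f x \<partial>P)"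
proof -
  interpret prob_space M using iid by (rule iid_sample_prob_space)
  have P: "distr M borel (X i) = P" and X [measurable]: "X i \<in> borel_measurable M" for i
    using iid iid_sample_measurable by (auto simp: iid_sample_def)
  note f[measurable]
  show "indep_vars (\<lambda>_. borel) (\<lambda>i \<omega>. f (X i \<omega>)) UNIV"
    using iid f by (intro indep_vars_compose2[where Y="\<lambda>_. f" and M'="\<lambda>_. borel"]) (auto simp: iid_sample_def)
  show "distr M borel (\<lambda>\<omega>. f (X i \<omega>)) = distr P borel f"
    unfolding P[of i, symmetric] by (subst distr_distr) (auto simp: comp_def)
  show "integrable P f \<Longrightarrow> integrable M (\<lambda>\<omega>. f (X i \<omega>))"
    unfolding P[of i, symmetric] by (simp add: integrable_distr_eq)
  show "(\<integral>\<omega>. f (X i \<omega>) \<partial>M) = (\<integral>x. f x \<partial>P)"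
    unfolding P[of i, symmetric] by (simp add: integral_distr)
qed

lemma consistent_empirical:
  assumes iid: "iid_sample M X P" and f: "integrable P f"
  shows "consistent M (\<lambda>z. empirical (fst z) (\<lambda>i. X i (snd z)) f) (\<integral>x. f x \<partial>P)"
proof -
  interpret prob_space M using iid by (rule iid_sample_prob_space)
  have fb [measurable]: "f \<in> borel_measurable borel"
    using f iid_sample_sets[OF iid] by (metis borel_measurable_integrable measurable_cong_sets)
  have [measurable]: "X i \<in> borel_measurable M" for i
    by (rule iid_sample_measurable[OF iid])
  have [measurable_cong]: "sets P = sets borel" by (rule iid_sample_sets[OF iid])
  have "((\<lambda>z. (\<Sum>i<fst z. f (X i (snd z))) / real (fst z)) \<longlongrightarrow> (\<integral>x. x \<partial>distr P borel f)) (whp M)"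
    by (rule weak_law_of_large_numbers[where D="distr P borel f"])
      (use iid_sample_compose[OF iid fb] f in \<open>auto simp: integrable_distr_eq\<close>)
  also have "(\<integral>x. x \<partial>distr P borel f) = (\<integral>x. f x \<partial>P)"
    by (simp add: integral_distr)
  finally show ?thesis
    unfolding consistent_def empirical_def by simp
qed

text \<open>The second moment of the normalised sum equals that of \<open>f\<close> for every
  positive \<open>n\<close>.\<close>

lemma bounded_in_prob_empirical:
  assumes iid: "iid_sample M X P" and f: "f \<in> borel_measurable borel" "integrable P (\<lambda>x. (f x)\<^sup>2)"
    and mean: "(\<integral>x. f x \<partial>P) = 0"
  shows "bounded_in_prob M (\<lambda>z. sqrt (real (fst z)) * empirical (fst z) (\<lambda>i. X i (snd z)) f)"
proof -
  interpret prob_space M using iid by (rule iid_sample_prob_space)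
  note f(1)[measurable]
  have [measurable]: "X i \<in> borel_measurable M" for i
    by (rule iid_sample_measurable[OF iid])
  have sq: "integrable M (\<lambda>\<omega>. (f (X i \<omega>))\<^sup>2)" "expectation (\<lambda>\<omega>. (f (X i \<omega>))\<^sup>2) = (\<integral>x. (f x)\<^sup>2 \<partial>P)" for i
    using iid_sample_compose(3,4)[OF iid, of "\<lambda>x. (f x)\<^sup>2" i] f by auto
  have m: "expectation (\<lambda>\<omega>. f (X i \<omega>)) = 0" for i
    using iid_sample_compose(4)[OF iid f(1)] mean by simp
  note S = expectation_sum_squared[OF iid_sample_compose(1)[OF iid f(1)] sq(1) m sq(2)]
  \<comment> \<open>True for \<open>n = 0\<close> as well, where both sides are zero.\<close>
  have eq: "(sqrt (real n) * ((\<Sum>i<n. f (X i \<omega>)) / real n))\<^sup>2 = (\<Sum>i<n. f (X i \<omega>))\<^sup>2 / real n" for n \<omega>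
    unfolding power_mult_distrib power_divide by (cases "n = 0") (simp_all add: power2_eq_square)
  show ?thesis
  proof (rule bounded_in_prob_if_L2[where C="\<integral>x. (f x)\<^sup>2 \<partial>P"])
    fix n
    show "integrable M (\<lambda>\<omega>. (sqrt (real (fst (n, \<omega>))) * empirical (fst (n, \<omega>)) (\<lambda>i. X i (snd (n, \<omega>))) f)\<^sup>2)"
      unfolding empirical_def fst_conv snd_conv eq using S(1) by simp
    have "0 \<le> (\<integral>x. (f x)\<^sup>2 \<partial>P)" by simp
    then show "expectation (\<lambda>\<omega>. (sqrt (real (fst (n, \<omega>))) * empirical (fst (n, \<omega>)) (\<lambda>i. X i (snd (n, \<omega>))) f)\<^sup>2)
        \<le> (\<integral>x. (f x)\<^sup>2 \<partial>P)"
      using S(2)[of n] by (cases "n = 0") (simp_all only: empirical_def fst_conv snd_conv eq, simp_all)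
  qed (simp add: empirical_def)
qed

lemma empirical_sum: "empirical n xs (\<lambda>x. \<Sum>a\<in>A. c a * g a x) = (\<Sum>a\<in>A. c a * empirical n xs (g a))"
proof -
  have "(\<Sum>i<n. \<Sum>a\<in>A. c a * g a (xs i)) = (\<Sum>a\<in>A. \<Sum>i<n. c a * g a (xs i))"
    by (rule sum.swap)
  then show ?thesis by (simp add: empirical_def sum_distrib_left sum_divide_distrib)
qed

text \<open>The coefficients depend on the sample but not on the summation index, so they leave the
  empirical mean by linearity; the law of large numbers is applied to finitely many fixed functions
  only.\<close>

lemma consistent_empirical_span:
  assumes iid: "iid_sample M X P" and F: "span_consistent M g F f" and g: "\<And>a. integrable P (g a)"
  shows "consistent M (\<lambda>z. empirical (fst z) (\<lambda>i. X i (snd z)) (F z)) (\<integral>x. f x \<partial>P)"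
    and "integrable P f"
proof -
  obtain C c where C: "\<And>z. F z = (\<lambda>x. \<Sum>a\<in>UNIV. C a z * g a x)" "f = (\<lambda>x. \<Sum>a\<in>UNIV. c a * g a x)"
    "\<And>a. consistent M (C a) (c a)"
    using F unfolding span_consistent_def by (auto simp: fun_eq_iff)
  show "integrable P f" unfolding C(2) using g by simp
  have "(\<integral>x. f x \<partial>P) = (\<Sum>a\<in>UNIV. c a * (\<integral>x. g a x \<partial>P))"
    unfolding C(2) using g by (simp add: Bochner_Integration.integral_sum)
  then show "consistent M (\<lambda>z. empirical (fst z) (\<lambda>i. X i (snd z)) (F z)) (\<integral>x. f x \<partial>P)"
    unfolding C(1) empirical_sum
    by (auto intro!: consistent_sum consistent_mult C(3) consistent_empirical[OF iid g])
qed

section \<open>Solutions of the structural equations\<close>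

lemma sum_nth_elem: "(\<Sum>j<card A. f (nth_elem A j)) = (\<Sum>a\<in>A. f a)"
proof -
  have l: "set (listing A) = A \<and> distinct (listing A)"
    unfolding listing_def by (rule someI_ex) (metis finite_distinct_list finite)
  then have "length (listing A) = card A" by (metis distinct_card)
  then have "bij_betw (nth_elem A) {..<card A} A"
    using l by (intro bij_betw_nth) auto
  then show ?thesis by (rule sum.reindex_bij_betw)
qed

definition solution :: "real ^ 'v ^ 'v \<Rightarrow> real ^ 'v \<Rightarrow> real ^ 'v::finite" where
  "solution \<beta> e = matrix_inv (transpose (Finite_Cartesian_Product.mat 1 - \<beta>)) *v e"

lemma model_law_solution: "model_law \<beta> Q = distr Q borel (solution \<beta>)"
  unfolding model_law_def solution_def[abs_def] ..

lemma solution_measurable [measurable]: "solution \<beta> \<in> borel_measurable borel"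
  unfolding solution_def
  by (intro borel_measurable_continuous_onI linear_continuous_on linear_linear[THEN iffD2]
    matrix_vector_mul_linear)

lemma transpose_mult_index:
  fixes \<beta> :: "real ^ 'v ^ 'v::finite"
  shows "(transpose (Finite_Cartesian_Product.mat 1 - \<beta>) *v x) $ v = x $ v - (\<Sum>w\<in>UNIV. \<beta> $ w $ v * x $ w)"
proof -
  have "(\<Sum>w\<in>UNIV. Finite_Cartesian_Product.mat 1 $ w $ v * x $ w) = x $ v"
    by (simp add: Finite_Cartesian_Product.mat_def if_distrib[where f="\<lambda>u. u * _"] cong: if_cong)
  moreover have "(transpose (Finite_Cartesian_Product.mat 1 - \<beta>) *v x) $ v =
      (\<Sum>w\<in>UNIV. (Finite_Cartesian_Product.mat 1 - \<beta>) $ w $ v * x $ w)"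
    by (simp add: matrix_vector_mult_def Finite_Cartesian_Product.transpose_def)
  ultimately show ?thesis by (simp add: left_diff_distrib sum_subtractf)
qed

lemma coefficients_invertible:
  assumes "\<beta> \<in> coefficients G"
  shows "invertible (transpose (Finite_Cartesian_Product.mat 1 - \<beta>))"
  using assms by (simp add: coefficients_def invertible_det_nz)

lemma matrix_inv_inverse:
  assumes "invertible A"
  shows "A ** matrix_inv A = Finite_Cartesian_Product.mat 1" "matrix_inv A ** A = Finite_Cartesian_Product.mat 1"
proof -
  have "A ** matrix_inv A = Finite_Cartesian_Product.mat 1 \<and> matrix_inv A ** A = Finite_Cartesian_Product.mat 1"
    unfolding matrix_inv_def by (rule someI_ex) (use assms in \<open>simp add: invertible_def\<close>)
  then show "A ** matrix_inv A = Finite_Cartesian_Product.mat 1" "matrix_inv A ** A = Finite_Cartesian_Product.mat 1"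
    by auto
qed

lemma solution_equation:
  assumes "\<beta> \<in> coefficients G"
  shows "transpose (Finite_Cartesian_Product.mat 1 - \<beta>) *v solution \<beta> e = e"
  unfolding solution_def matrix_vector_mul_assoc matrix_inv_inverse(1)[OF coefficients_invertible[OF assms]]
  by simp

lemma solution_unique:
  assumes "\<beta> \<in> coefficients G" and "transpose (Finite_Cartesian_Product.mat 1 - \<beta>) *v x = e"
  shows "solution \<beta> e = x"
  unfolding solution_def assms(2)[symmetric] matrix_vector_mul_assoc
    matrix_inv_inverse(2)[OF coefficients_invertible[OF assms(1)]] by simp

text \<open>The factor \<open>solution \<beta> (axis w 1) $ y\<close> is the total effect of the
  error at \<open>w\<close> on \<open>y\<close>, an entry of the inverse matrix.\<close>

lemma solution_sum: "solution \<beta> e $ y = (\<Sum>w\<in>UNIV. solution \<beta> (axis w 1) $ y * e $ w)"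
  unfolding solution_def by (simp add: matrix_vector_mult_basis column_def) (simp add: matrix_vector_mult_def)

lemma resid_coef:
  assumes "\<beta> \<in> coefficients G"
  shows "resid G (coef G \<beta>) v x = x $ v - (\<Sum>w\<in>UNIV. \<beta> $ w $ v * x $ w)"
proof -
  have "(\<Sum>j<card (pa G v). coef G \<beta> v $v j * x $ nth_elem (pa G v) j) =
      (\<Sum>j<card (pa G v). (\<lambda>w. \<beta> $ w $ v * x $ w) (nth_elem (pa G v) j))"
    by (intro sum.cong) (auto simp: coef_def)
  also have "\<dots> = (\<Sum>w\<in>pa G v. \<beta> $ w $ v * x $ w)" by (rule sum_nth_elem)
  also have "\<dots> = (\<Sum>w\<in>UNIV. \<beta> $ w $ v * x $ w)"
    using assms by (intro sum.mono_neutral_left) (auto simp: coefficients_def pa_def)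
  finally show ?thesis by (simp add: resid_def)
qed

lemma resid_solution:
  "\<beta> \<in> coefficients G \<Longrightarrow> resid G (coef G \<beta>) v (solution \<beta> e) = e $ v"
  using solution_equation[of \<beta> G e] transpose_mult_index[of \<beta> "solution \<beta> e" v]
  by (simp add: resid_coef)

section \<open>Reachability and half-treks\<close>

lemma directed_walk_if_reachable:
  assumes "(w, y) \<in> (dir G)\<^sup>*"
  shows "\<exists>vs. directed_walk G vs \<and> hd vs = w \<and> last vs = y"
  using assms
proof (induction rule: rtrancl_induct)
  case base
  show ?case by (intro exI[of _ "[w]"]) (simp add: directed_walk_def)
next
  case (step y z)
  then obtain vs where "directed_walk G vs" "hd vs = w" "last vs = y" by blast
  then show ?case
    using step by (intro exI[of _ "vs @ [z]"]) (auto simp: directed_walk_def successively_append_iff)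
qed

text \<open>A directed walk from \<open>u\<close> is itself a half-trek, and one from a sibling
  \<open>w\<close> becomes one after prefixing \<open>u\<close> with the edge between
  \<open>u\<close> and \<open>w\<close>. Used contrapositively: a vertex that is neither
  \<open>u\<close>, nor a sibling, nor in \<open>htr G u\<close> receives no effect from
  \<open>u\<close> or its siblings.\<close>

lemma htr_if_reachable:
  assumes "w = u \<or> w \<in> sib G u" and "(w, y) \<in> (dir G)\<^sup>*" and "y \<notin> {u} \<union> sib G u"
  shows "y \<in> htr G u"
proof -
  obtain vs where vs: "directed_walk G vs" "hd vs = w" "last vs = y"
    using directed_walk_if_reachable[OF assms(2)] by blast
  show ?thesis
  proof (cases "w = u")
    case True
    then have "half_trek G vs" using vs by (simp add: half_trek_def)
    then show ?thesis using vs True assms(3) unfolding htr_def by blast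
  next
    case False
    then have "{u, w} \<in> bid G" using assms(1) by (auto simp: sib_def insert_commute)
    then have "half_trek G (u # vs)" using vs by (simp add: half_trek_def)
    moreover have "last (u # vs) = y" using vs by (auto simp: directed_walk_def)
    ultimately show ?thesis using assms(3) unfolding htr_def by (auto intro!: exI[of _ "u # vs"])
  qed
qed

text \<open>The vectors supported on the set reachable from \<open>w\<close> form a subspace that the injective map
  \<open>(I - \<beta>)\<^sup>T\<close> maps into itself, hence onto itself; this replaces the nilpotency argument, which needs acyclicity.\<close>

lemma solution_axis_unreachable:
  fixes \<beta> :: "real ^ 'v ^ 'v::finite"
  assumes \<beta>: "\<beta> \<in> coefficients G" and unreachable: "(w, y) \<notin> (dir G)\<^sup>*"
  shows "solution \<beta> (axis w 1) $ y = 0"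
proof -
  define T where "T = (\<lambda>x. transpose (Finite_Cartesian_Product.mat 1 - \<beta>) *v x)"
  define S where "S = {x :: real ^ 'v. \<forall>a. (w, a) \<notin> (dir G)\<^sup>* \<longrightarrow> x $ a = 0}"
  have lin: "linear T" unfolding T_def by (rule matrix_vector_mul_linear)
  have inj: "inj T"
    unfolding T_def by (rule injI) (metis solution_unique[OF \<beta>])
  have S: "Real_Vector_Spaces.subspace S" by (auto simp: S_def real_vector.subspace_def)
  have TS: "T ` S \<subseteq> S"
  proof clarify
    fix x assume x: "x \<in> S"
    show "T x \<in> S"
      unfolding S_def
    proof (intro CollectI allI impI)
      fix a assume a: "(w, a) \<notin> (dir G)\<^sup>*"
      have "\<beta> $ q $ a * x $ q = 0" for q
      proof (cases "(w, q) \<in> (dir G)\<^sup>*")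
        case True
        then have "(q, a) \<notin> dir G" using a by (meson rtrancl.rtrancl_into_rtrancl)
        then show ?thesis using \<beta> by (simp add: coefficients_def)
      next
        case False
        then show ?thesis using x by (simp add: S_def)
      qed
      then show "T x $ a = 0"
        unfolding T_def transpose_mult_index using x a by (simp add: S_def)
    qed
  qed
  have "dim (T ` S) = dim S"
    by (rule dim_image_eq[OF lin]) (use inj in \<open>auto intro: inj_on_subset\<close>)
  then have "T ` S = S"
    by (intro subspace_dim_equal linear_subspace_image[OF lin] S TS) auto
  moreover have "axis w 1 \<in> S" by (auto simp: S_def axis_def)
  ultimately obtain x where x: "x \<in> S" "T x = axis w 1" by (metis imageE)
  then have "solution \<beta> (axis w 1) = x"
    by (intro solution_unique[OF \<beta>]) (simp add: T_def)
  then show ?thesis using x unreachable by (simp add: S_def)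
qed

section \<open>Moments of the errors and of the observed variables\<close>

text \<open>Over a finite measure this class is closed under linear combinations, and products of up
  to four members are integrable; it replaces a calculus of mixed moments.\<close>

definition fourth_moment :: "'x measure \<Rightarrow> ('x \<Rightarrow> real) \<Rightarrow> bool" where
  "fourth_moment P f \<longleftrightarrow> f \<in> borel_measurable P \<and> integrable P (\<lambda>x. (f x) ^ 4)"

lemma fourth_moment_add:
  assumes "fourth_moment P f" "fourth_moment P g"
  shows "fourth_moment P (\<lambda>x. f x + g x)"
proof -
  have [measurable]: "f \<in> borel_measurable P" "g \<in> borel_measurable P"
    using assms by (auto simp: fourth_moment_def)
  \<comment> \<open>Twice the inequality
    \<open>(s + t)\<^sup>2 \<le> 2 * (s\<^sup>2 + t\<^sup>2)\<close>, which accounts for the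
    constant 8.\<close>
  have bound: "(s + t) ^ 4 \<le> 8 * (s ^ 4 + t ^ 4)" for s t :: real
  proof -
    have "(s + t)\<^sup>2 \<le> 2 * (s\<^sup>2 + t\<^sup>2)" using sum_squares_bound[of s t] by (simp add: power2_sum)
    then have "((s + t)\<^sup>2)\<^sup>2 \<le> (2 * (s\<^sup>2 + t\<^sup>2))\<^sup>2" by (intro power_mono) auto
    also have "\<dots> = 4 * (s\<^sup>2 + t\<^sup>2)\<^sup>2" unfolding power_mult_distrib by simp
    also have "(s\<^sup>2 + t\<^sup>2)\<^sup>2 \<le> 2 * ((s\<^sup>2)\<^sup>2 + (t\<^sup>2)\<^sup>2)"
      using sum_squares_bound[of "s\<^sup>2" "t\<^sup>2"] by (simp add: power2_sum)
    finally show ?thesis by simp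
  qed
  have "integrable P (\<lambda>x. (f x + g x) ^ 4)"
  proof (rule Bochner_Integration.integrable_bound)
    show "integrable P (\<lambda>x. 8 * ((f x) ^ 4 + (g x) ^ 4))"
      using assms by (auto simp: fourth_moment_def)
    show "AE x in P. norm ((f x + g x) ^ 4) \<le> norm (8 * ((f x) ^ 4 + (g x) ^ 4))"
      using bound by simp
  qed measurable
  then show ?thesis by (simp add: fourth_moment_def)
qed

lemma fourth_moment_scale: "fourth_moment P f \<Longrightarrow> fourth_moment P (\<lambda>x. c * f x)"
  by (auto simp: fourth_moment_def power_mult_distrib)

lemma (in finite_measure) fourth_moment_const: "fourth_moment M (\<lambda>x. c)"
  by (simp add: fourth_moment_def)

lemma (in finite_measure) fourth_moment_sum:
  "(\<And>i. i \<in> I \<Longrightarrow> fourth_moment M (f i)) \<Longrightarrow> fourth_moment M (\<lambda>x. \<Sum>i\<in>I. f i x)"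
  by (induction I rule: infinite_finite_induct) (auto intro: fourth_moment_add fourth_moment_const)

text \<open>The arithmetic-geometric mean inequality, once for the two pairs and once inside each
  pair.\<close>

lemma integrable_mult4:
  assumes "fourth_moment P f" "fourth_moment P g" "fourth_moment P h" "fourth_moment P k"
  shows "integrable P (\<lambda>x. (f x * g x) * (h x * k x))"
proof (rule Bochner_Integration.integrable_bound)
  show "integrable P (\<lambda>x. (f x) ^ 4 + (g x) ^ 4 + (h x) ^ 4 + (k x) ^ 4)"
    using assms by (auto simp: fourth_moment_def)
  have amgm: "\<bar>s * t\<bar> \<le> s\<^sup>2 + t\<^sup>2" for s t :: real
    using sum_squares_bound[of "\<bar>s\<bar>" "\<bar>t\<bar>"] abs_ge_zero[of "s * t"] unfolding abs_mult power2_abs by linarith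
  have "\<bar>(a * b) * (c * d)\<bar> \<le> a ^ 4 + b ^ 4 + c ^ 4 + d ^ 4" for a b c d :: real
  proof -
    have sq: "(s * t)\<^sup>2 \<le> (s ^ 4 + t ^ 4) " for s t :: real
      using amgm[of "s\<^sup>2" "t\<^sup>2"] by (simp add: power_mult_distrib)
    have "\<bar>(a * b) * (c * d)\<bar> \<le> (a * b)\<^sup>2 + (c * d)\<^sup>2" by (rule amgm)
    also have "\<dots> \<le> (a ^ 4 + b ^ 4) + (c ^ 4 + d ^ 4)" by (intro add_mono sq)
    finally show ?thesis by simp
  qed
  then show "AE x in P. norm ((f x * g x) * (h x * k x)) \<le> norm ((f x) ^ 4 + (g x) ^ 4 + (h x) ^ 4 + (k x) ^ 4)"
    by (auto intro: order_trans[OF _ abs_ge_self])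
  have [measurable]: "f \<in> borel_measurable P" "g \<in> borel_measurable P" "h \<in> borel_measurable P" "k \<in> borel_measurable P"
    using assms by (auto simp: fourth_moment_def)
  show "(\<lambda>x. (f x * g x) * (h x * k x)) \<in> borel_measurable P" by measurable
qed

lemma (in finite_measure) integrable_mult2:
  assumes "fourth_moment M f" "fourth_moment M g"
  shows "integrable M (\<lambda>x. f x * g x)"
  using integrable_mult4[OF assms fourth_moment_const[of 1] fourth_moment_const[of 1]] by simp

lemma (in finite_measure) integrable_fourth_moment: "fourth_moment M f \<Longrightarrow> integrable M f"
  using integrable_mult2[OF _ fourth_moment_const[of 1]] by simp

lemma fourth_moment_distr:
  assumes "T \<in> measurable Q N" "f \<in> borel_measurable N"
  shows "fourth_moment (distr Q N T) f \<longleftrightarrow> fourth_moment Q (\<lambda>x. f (T x))"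
  using assms by (auto simp: fourth_moment_def integrable_distr_eq)

lemma error_laws_prob_space: "Q \<in> error_laws G \<Longrightarrow> prob_space Q"
  by (simp add: error_laws_def)

lemma error_laws_sets: "Q \<in> error_laws G \<Longrightarrow> sets Q = sets borel"
  by (simp add: error_laws_def)

lemma fourth_moment_error:
  fixes G :: "'v::finite mgraph"
  assumes "Q \<in> error_laws G" shows "fourth_moment Q (\<lambda>e. e $ v)"
proof -
  have "(\<lambda>e. e $ v) \<in> borel_measurable Q"
    unfolding measurable_cong_sets[OF error_laws_sets[OF assms] refl] by simp
  then show ?thesis using assms by (simp add: fourth_moment_def error_laws_def)
qed

lemma fourth_moment_solution:
  fixes G :: "'v::finite mgraph"
  assumes Q: "Q \<in> error_laws G" shows "fourth_moment Q (\<lambda>e. solution \<beta> e $ v)"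
proof -
  interpret prob_space Q by (rule error_laws_prob_space[OF Q])
  show ?thesis
    by (subst solution_sum) (intro fourth_moment_sum fourth_moment_scale fourth_moment_error[OF Q])
qed

text \<open>Independence is used for the singleton \<open>{u}\<close>, which is trivially connected
  by bidirected edges; every \<open>w\<close> outside \<open>{u} \<union> sib G u\<close> lies in
  the complementary block.\<close>

lemma errors_uncorrelated:
  fixes G :: "'v::finite mgraph"
  assumes Q: "Q \<in> error_laws G" and w: "w \<notin> {u} \<union> sib G u"
  shows "(\<integral>e. e $ w * e $ u \<partial>Q) = 0"
proof -
  interpret prob_space Q by (rule error_laws_prob_space[OF Q])
  let ?V = "- ({u} \<union> sib_set G {u})"
  have "bid_connected G {u}" by (simp add: bid_connected_def)
  moreover have "\<forall>U. bid_connected G U \<longrightarrow> indep_var (PiM U (\<lambda>_. borel)) (subvector U)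
      (PiM (- (U \<union> sib_set G U)) (\<lambda>_. borel)) (subvector (- (U \<union> sib_set G U)))"
    using Q unfolding error_laws_def by blast
  ultimately have "indep_var (PiM {u} (\<lambda>_. borel)) (subvector {u}) (PiM ?V (\<lambda>_. borel)) (subvector ?V)"
    by blast
  moreover have wV: "w \<in> ?V" using w by (auto simp: sib_set_def sib_def)
  ultimately have "indep_var borel ((\<lambda>f. f u) \<circ> subvector {u}) borel ((\<lambda>f. f w) \<circ> subvector ?V)"
    by (intro indep_var_compose) (auto intro!: measurable_component_singleton)
  moreover have "(\<lambda>f. f u) \<circ> subvector {u} = (\<lambda>e. e $ u)" "(\<lambda>f. f w) \<circ> subvector ?V = (\<lambda>e. e $ w)"
    using wV by (auto simp: subvector_def fun_eq_iff)
  ultimately have "indep_var borel (\<lambda>e. e $ u) borel (\<lambda>e. e $ w)" by simp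
  from indep_var_lebesgue_integral[OF this]
  have "(\<integral>e. e $ u * e $ w \<partial>Q) = (\<integral>e. e $ u \<partial>Q) * (\<integral>e. e $ w \<partial>Q)"
    using integrable_fourth_moment fourth_moment_error[OF Q] by blast
  then show ?thesis using Q by (simp add: error_laws_def mult.commute)
qed

text \<open>Expand the solution into total effects. An error at \<open>u\<close> or at a sibling of
  \<open>u\<close> cannot reach \<open>y\<close>, since a half-trek would put \<open>y\<close> into
  \<open>htr G u\<close>; every other error is uncorrelated with the one at
  \<open>u\<close>.\<close>

lemma solution_error_uncorrelated:
  fixes G :: "'v::finite mgraph"
  assumes \<beta>: "\<beta> \<in> coefficients G" and Q: "Q \<in> error_laws G"
    and y: "y \<notin> {u} \<union> sib G u" "y \<notin> htr G u"
  shows "(\<integral>e. solution \<beta> e $ y * e $ u \<partial>Q) = 0"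
proof -
  interpret prob_space Q by (rule error_laws_prob_space[OF Q])
  have int: "integrable Q (\<lambda>e. e $ w * e $ u)" for w
    by (intro integrable_mult2 fourth_moment_error[OF Q])
  have "(\<integral>e. solution \<beta> e $ y * e $ u \<partial>Q) = (\<integral>e. (\<Sum>w\<in>UNIV. solution \<beta> (axis w 1) $ y * (e $ w * e $ u)) \<partial>Q)"
    by (subst (1) solution_sum) (simp only: sum_distrib_right mult.assoc)
  also have "\<dots> = (\<Sum>w\<in>UNIV. solution \<beta> (axis w 1) $ y * (\<integral>e. e $ w * e $ u \<partial>Q))"
    using int by (simp add: Bochner_Integration.integral_sum)
  also have "\<dots> = 0"
  proof (rule sum.neutral, rule ballI)
    fix w
    show "solution \<beta> (axis w 1) $ y * (\<integral>e. e $ w * e $ u \<partial>Q) = 0"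
    proof (cases "w \<in> {u} \<union> sib G u")
      case True
      then have "(w, y) \<notin> (dir G)\<^sup>*" using htr_if_reachable[of w u G y] y by auto
      then show ?thesis using solution_axis_unreachable[OF \<beta>] by simp
    next
      case False
      then show ?thesis using errors_uncorrelated[OF Q] by simp
    qed
  qed
  finally show ?thesis .
qed

section \<open>Convergence of quadratic forms in distribution\<close>

abbreviation gaussian_vector :: "nat \<Rightarrow> (nat \<Rightarrow> real) measure" where
  "gaussian_vector r \<equiv> PiM {..<r} (\<lambda>_. std_normal_distribution)"

lemma prob_space_std_normal: "prob_space std_normal_distribution"
  using real_dist_normal_dist by (simp add: real_distribution_def)

lemma product_prob_space_std_normal: "product_prob_space (\<lambda>_::nat. std_normal_distribution)"
proof -
  interpret prob_space std_normal_distribution by (rule prob_space_std_normal)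
  show ?thesis by unfold_locales
qed

lemma prob_space_gaussian_vector: "prob_space (gaussian_vector r)"
  by (rule prob_space_PiM) (rule prob_space_std_normal)

lemma gaussian_component_measurable [measurable (raw)]:
  "i < r \<Longrightarrow> (\<lambda>z. z i) \<in> borel_measurable (gaussian_vector r)"
  using measurable_component_singleton[of i "{..<r}" "\<lambda>_. std_normal_distribution"]
  by (simp add: measurable_cong_sets[OF refl, of std_normal_distribution borel])

lemma gaussian_vector_char:
  "(\<integral>z. iexp (\<Sum>i<r. t i * z i) \<partial>gaussian_vector r) = of_real (exp (- (\<Sum>i<r. (t i)\<^sup>2) / 2))"
proof -
  interpret product_prob_space "\<lambda>_::nat. std_normal_distribution" by (rule product_prob_space_std_normal)
  have "(\<integral>z. iexp (\<Sum>i<r. t i * z i) \<partial>gaussian_vector r) =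
      (\<integral>z. (\<Prod>i<r. iexp (t i * z i)) \<partial>gaussian_vector r)"
    by (simp add: sum_distrib_left exp_sum)
  also have "\<dots> = (\<Prod>i<r. \<integral>y. iexp (t i * y) \<partial>std_normal_distribution)"
    by (rule product_integral_prod) (auto intro!: prob_space.integrable_iexp[OF prob_space_std_normal])
  also have "\<dots> = (\<Prod>i<r. of_real (exp (- (t i)\<^sup>2 / 2)))"
  proof (intro prod.cong refl)
    fix i
    have "(\<integral>y. iexp (t i * y) \<partial>std_normal_distribution) = char std_normal_distribution (t i)"
      by (simp only: char_def)
    then show "(\<integral>y. iexp (t i * y) \<partial>std_normal_distribution) = of_real (exp (- (t i)\<^sup>2 / 2))"
      by (simp only: char_std_normal_distribution)
  qed
  also have "\<dots> = of_real (\<Prod>i<r. exp (- (t i)\<^sup>2 / 2))" by simp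
  also have "(\<Prod>i<r. exp (- (t i)\<^sup>2 / 2)) = exp (- (\<Sum>i<r. (t i)\<^sup>2) / 2)"
    by (simp add: exp_sum[symmetric] sum_negf sum_divide_distrib)
  finally show ?thesis .
qed

text \<open>The Gaussian kernel is the characteristic function of a Gaussian vector, so convergence of the
  characteristic functions of \<open>T\<close> gives convergence of the Laplace transforms of the squared norms.\<close>

lemma (in prob_space) laplace_transform_tendsto:
  fixes T :: "nat \<Rightarrow> 'a \<Rightarrow> nat \<Rightarrow> real"
  assumes T [measurable]: "\<And>n i. i < r \<Longrightarrow> (\<lambda>\<omega>. T n \<omega> i) \<in> borel_measurable M"
    and char: "\<And>u. (\<lambda>n. \<integral>\<omega>. iexp (\<Sum>i<r. u i * T n \<omega> i) \<partial>M) \<longlonglongrightarrow> of_real (exp (- (\<Sum>i<r. (u i)\<^sup>2) / 2))"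
    and s: "s \<ge> 0"
  shows "(\<lambda>n. \<integral>\<omega>. exp (- (s * (\<Sum>i<r. (T n \<omega> i)\<^sup>2)) / 2) \<partial>M) \<longlonglongrightarrow>
    (\<integral>z. exp (- (s * (\<Sum>i<r. (z i)\<^sup>2)) / 2) \<partial>gaussian_vector r)"
proof -
  have total: "measure M (space M) = 1" by (rule prob_space)
  interpret Z: prob_space "gaussian_vector r" by (rule prob_space_gaussian_vector)
  interpret pair_prob_space M "gaussian_vector r" ..
  have swap: "complex_of_real (\<integral>\<omega>. exp (- (s * (\<Sum>i<r. (T n \<omega> i)\<^sup>2)) / 2) \<partial>M) =
      (\<integral>z. (\<integral>\<omega>. iexp (\<Sum>i<r. sqrt s * z i * T n \<omega> i) \<partial>M) \<partial>gaussian_vector r)" for n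
  proof -
    have meas: "(\<lambda>(\<omega>, z). iexp (\<Sum>i<r. sqrt s * z i * T n \<omega> i)) \<in> borel_measurable (M \<Otimes>\<^sub>M gaussian_vector r)"
      by measurable
    have "integrable (M \<Otimes>\<^sub>M gaussian_vector r) (\<lambda>(\<omega>, z). iexp (\<Sum>i<r. sqrt s * z i * T n \<omega> i))"
      by (rule P.integrable_const_bound[of _ 1]) (use meas in \<open>auto simp: case_prod_beta\<close>)
    note fubini = Fubini_integral[OF this]
    have "complex_of_real (\<integral>\<omega>. exp (- (s * (\<Sum>i<r. (T n \<omega> i)\<^sup>2)) / 2) \<partial>M) =
        (\<integral>\<omega>. complex_of_real (exp (- (s * (\<Sum>i<r. (T n \<omega> i)\<^sup>2)) / 2)) \<partial>M)"
      by (rule integral_complex_of_real[symmetric])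
    also have "\<dots> = (\<integral>\<omega>. (\<integral>z. iexp (\<Sum>i<r. sqrt s * z i * T n \<omega> i) \<partial>gaussian_vector r) \<partial>M)"
    proof (rule Bochner_Integration.integral_cong[OF refl])
      fix \<omega>
      have "(\<integral>z. iexp (\<Sum>i<r. sqrt s * z i * T n \<omega> i) \<partial>gaussian_vector r) =
          (\<integral>z. iexp (\<Sum>i<r. (sqrt s * T n \<omega> i) * z i) \<partial>gaussian_vector r)"
        by (simp only: mult.commute mult.left_commute)
      also have "\<dots> = of_real (exp (- (\<Sum>i<r. (sqrt s * T n \<omega> i)\<^sup>2) / 2))"
        by (rule gaussian_vector_char)
      also have "(\<Sum>i<r. (sqrt s * T n \<omega> i)\<^sup>2) = s * (\<Sum>i<r. (T n \<omega> i)\<^sup>2)"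
        using s by (simp add: power_mult_distrib sum_distrib_left)
      finally show "complex_of_real (exp (- (s * (\<Sum>i<r. (T n \<omega> i)\<^sup>2)) / 2)) =
          (\<integral>z. iexp (\<Sum>i<r. sqrt s * z i * T n \<omega> i) \<partial>gaussian_vector r)" by simp
    qed
    finally show ?thesis using fubini by simp
  qed
  have "(\<lambda>n. (\<integral>z. (\<integral>\<omega>. iexp (\<Sum>i<r. sqrt s * z i * T n \<omega> i) \<partial>M) \<partial>gaussian_vector r)) \<longlonglongrightarrow>
      (\<integral>z. complex_of_real (exp (- (\<Sum>i<r. (sqrt s * z i)\<^sup>2) / 2)) \<partial>gaussian_vector r)"
  proof (rule integral_dominated_convergence[where w="\<lambda>_. 1"])
    show "AE z in gaussian_vector r. (\<lambda>n. \<integral>\<omega>. iexp (\<Sum>i<r. sqrt s * z i * T n \<omega> i) \<partial>M)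
        \<longlonglongrightarrow> complex_of_real (exp (- (\<Sum>i<r. (sqrt s * z i)\<^sup>2) / 2))"
      by (rule AE_I2) (rule char)
    have "norm (\<integral>\<omega>. iexp (\<Sum>i<r. sqrt s * z i * T n \<omega> i) \<partial>M) \<le> 1" for z n
    proof -
      have "norm (\<integral>\<omega>. iexp (\<Sum>i<r. sqrt s * z i * T n \<omega> i) \<partial>M) \<le>
          (\<integral>\<omega>. norm (iexp (\<Sum>i<r. sqrt s * z i * T n \<omega> i)) \<partial>M)"
        by (rule integral_norm_bound)
      also have "\<dots> = 1" by (simp add: total)
      finally show ?thesis .
    qed
    then show "AE z in gaussian_vector r. norm (\<integral>\<omega>. iexp (\<Sum>i<r. sqrt s * z i * T n \<omega> i) \<partial>M) \<le> 1" for n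
      by simp
    show "(\<lambda>z. \<integral>\<omega>. iexp (\<Sum>i<r. sqrt s * z i * T n \<omega> i) \<partial>M) \<in> borel_measurable (gaussian_vector r)" for n
      by measurable
    show "(\<lambda>z. complex_of_real (exp (- (\<Sum>i<r. (sqrt s * z i)\<^sup>2) / 2))) \<in> borel_measurable (gaussian_vector r)"
      by measurable
  qed simp
  also have "(\<integral>z. complex_of_real (exp (- (\<Sum>i<r. (sqrt s * z i)\<^sup>2) / 2)) \<partial>gaussian_vector r) =
      complex_of_real (\<integral>z. exp (- (s * (\<Sum>i<r. (z i)\<^sup>2)) / 2) \<partial>gaussian_vector r)"
    unfolding integral_complex_of_real using s by (simp add: power_mult_distrib sum_distrib_left)
  finally show ?thesis
    unfolding swap[symmetric] by (simp only: tendsto_of_real_iff)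
qed

section \<open>From Laplace transforms to weak convergence\<close>

lemma expectation_tendsto_if_laplace:
  fixes Y :: "nat \<Rightarrow> 'a \<Rightarrow> real" and Z :: "'b \<Rightarrow> real" and g :: "real \<Rightarrow> real"
  assumes M: "prob_space M" and N: "prob_space N"
    and Y [measurable]: "\<And>n. Y n \<in> borel_measurable M" and Z [measurable]: "Z \<in> borel_measurable N"
    and Y0: "\<And>n \<omega>. Y n \<omega> \<ge> 0" and Z0: "\<And>z. Z z \<ge> 0"
    and laplace: "\<And>m::nat. (\<lambda>n. \<integral>\<omega>. exp (- (real m * Y n \<omega>) / 2) \<partial>M) \<longlonglongrightarrow> (\<integral>z. exp (- (real m * Z z) / 2) \<partial>N)"
    and g: "continuous_on UNIV g"
  shows "(\<lambda>n. \<integral>\<omega>. g (exp (- Y n \<omega> / 2)) \<partial>M) \<longlonglongrightarrow> (\<integral>z. g (exp (- Z z / 2)) \<partial>N)"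
proof (rule LIMSEQ_I)
  interpret M: prob_space M by fact
  interpret N: prob_space N by fact
  fix e :: real assume e: "e > 0"
  have [measurable]: "g \<in> borel_measurable borel"
    using g by (rule borel_measurable_continuous_onI)
  \<comment> \<open>As \<open>Y\<close> is nonnegative, \<open>exp (- Y / 2)\<close> lies in the
    unit interval and its moments are the Laplace transforms at integers; compactness of the
    interval stands in for a tightness argument.\<close>
  obtain p where p: "real_polynomial_function p" "\<And>u. u \<in> {0..1} \<Longrightarrow> \<bar>g u - p u\<bar> < e / 3"
    using Stone_Weierstrass_real_polynomial_function[of "{0..1::real}" g "e / 3"] e
      continuous_on_subset[OF g] by auto
  obtain a d where ad: "p = (\<lambda>u. \<Sum>i\<le>d. a i * u ^ i)"
    using p(1) real_polynomial_function_iff_sum by blast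
  have pw: "exp (- y / 2) ^ i = exp (- (real i * y) / 2)" for y :: real and i
    by (simp flip: exp_of_nat_mult)
  have unit: "exp (- y / 2) \<in> {0..1}" if "y \<ge> 0" for y :: real
    using that by simp
  have exp_bound: "\<bar>exp (- (real i * y) / 2)\<bar> \<le> 1" if "y \<ge> 0" for y i
    using that by simp
  have intM: "integrable M (\<lambda>\<omega>. exp (- (real i * Y n \<omega>) / 2))" for n i
    by (rule M.integrable_const_bound[of _ 1]) (use Y0 in auto)
  have intN: "integrable N (\<lambda>z. exp (- (real i * Z z) / 2))" for i
    by (rule N.integrable_const_bound[of _ 1]) (use Z0 in auto)
  have "(\<lambda>n. \<Sum>i\<le>d. a i * (\<integral>\<omega>. exp (- (real i * Y n \<omega>) / 2) \<partial>M)) \<longlonglongrightarrow>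
      (\<Sum>i\<le>d. a i * (\<integral>z. exp (- (real i * Z z) / 2) \<partial>N))"
    by (intro tendsto_sum tendsto_mult_left laplace)
  then have lim: "(\<lambda>n. \<integral>\<omega>. p (exp (- Y n \<omega> / 2)) \<partial>M) \<longlonglongrightarrow> (\<integral>z. p (exp (- Z z / 2)) \<partial>N)"
    unfolding ad pw using intM intN by (simp add: Bochner_Integration.integral_sum)
  have pM: "integrable M (\<lambda>\<omega>. p (exp (- Y n \<omega> / 2)))" for n
    unfolding ad pw using intM by simp
  have pN: "integrable N (\<lambda>z. p (exp (- Z z / 2)))"
    unfolding ad pw using intN by simp
  have "bounded (g ` {0..1})"
    by (intro compact_imp_bounded compact_continuous_image continuous_on_subset[OF g]) auto
  then obtain K where "\<forall>y\<in>g ` {0..1}. norm y \<le> K"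
    unfolding bounded_iff by blast
  then have K: "\<bar>g u\<bar> \<le> K" if "u \<in> {0..1}" for u
    using that by auto
  have gM: "integrable M (\<lambda>\<omega>. g (exp (- Y n \<omega> / 2)))" for n
    by (rule M.integrable_const_bound[of _ K]) (use K unit Y0 in auto)
  have gN: "integrable N (\<lambda>z. g (exp (- Z z / 2)))"
    by (rule N.integrable_const_bound[of _ K]) (use K unit Z0 in auto)
  have dM: "\<bar>(\<integral>\<omega>. g (exp (- Y n \<omega> / 2)) \<partial>M) - (\<integral>\<omega>. p (exp (- Y n \<omega> / 2)) \<partial>M)\<bar> \<le> e / 3" for n
  proof -
    have "\<bar>\<integral>\<omega>. g (exp (- Y n \<omega> / 2)) - p (exp (- Y n \<omega> / 2)) \<partial>M\<bar> \<le>
        (\<integral>\<omega>. \<bar>g (exp (- Y n \<omega> / 2)) - p (exp (- Y n \<omega> / 2))\<bar> \<partial>M)"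
      by (rule integral_abs_bound)
    also have "\<dots> \<le> (\<integral>\<omega>. e / 3 \<partial>M)"
      using gM pM p(2)[OF unit[OF Y0]] by (intro integral_mono) (auto intro: less_imp_le)
    also have "\<dots> = e / 3" by (simp add: M.prob_space)
    finally show ?thesis using gM pM by simp
  qed
  have dN: "\<bar>(\<integral>z. g (exp (- Z z / 2)) \<partial>N) - (\<integral>z. p (exp (- Z z / 2)) \<partial>N)\<bar> \<le> e / 3"
  proof -
    have "\<bar>\<integral>z. g (exp (- Z z / 2)) - p (exp (- Z z / 2)) \<partial>N\<bar> \<le>
        (\<integral>z. \<bar>g (exp (- Z z / 2)) - p (exp (- Z z / 2))\<bar> \<partial>N)"
      by (rule integral_abs_bound)
    also have "\<dots> \<le> (\<integral>z. e / 3 \<partial>N)"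
      using gN pN p(2)[OF unit[OF Z0]] by (intro integral_mono) (auto intro: less_imp_le)
    also have "\<dots> = e / 3" by (simp add: N.prob_space)
    finally show ?thesis using gN pN by simp
  qed
  obtain n0 where n0: "\<And>n. n \<ge> n0 \<Longrightarrow>
      \<bar>(\<integral>\<omega>. p (exp (- Y n \<omega> / 2)) \<partial>M) - (\<integral>z. p (exp (- Z z / 2)) \<partial>N)\<bar> < e / 3"
    using LIMSEQ_D[OF lim, of "e / 3"] e by auto
  show "\<exists>n0. \<forall>n\<ge>n0. norm ((\<integral>\<omega>. g (exp (- Y n \<omega> / 2)) \<partial>M) - (\<integral>z. g (exp (- Z z / 2)) \<partial>N)) < e"
  proof (intro exI[of _ n0] allI impI)
    fix n assume "n \<ge> n0"
    from n0[OF this] dM[of n] dN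
    show "norm ((\<integral>\<omega>. g (exp (- Y n \<omega> / 2)) \<partial>M) - (\<integral>z. g (exp (- Z z / 2)) \<partial>N)) < e"
      unfolding real_norm_def by linarith
  qed
qed

text \<open>Clipping to the unit interval does not increase distances. The estimate carries
  expectations of step functions from \<open>Y\<close> to any \<open>W\<close> that differs from it
  by o_P(1).\<close>

lemma cts_step_lipschitz:
  assumes "a < b" shows "\<bar>cts_step a b x - cts_step a b y\<bar> \<le> \<bar>x - y\<bar> / (b - a)"
proof -
  have eq: "cts_step a b x = min 1 (max 0 ((b - x) / (b - a)))" for x
    using assms by (auto simp: cts_step_def field_simps min_def max_def)
  have "\<bar>min 1 (max 0 s) - min 1 (max 0 t)\<bar> \<le> \<bar>s - t\<bar>" for s t :: real
    by (auto simp: min_def max_def)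
  from this[of "(b - x) / (b - a)" "(b - y) / (b - a)"]
  have "\<bar>cts_step a b x - cts_step a b y\<bar> \<le> \<bar>(b - x) / (b - a) - (b - y) / (b - a)\<bar>"
    unfolding eq .
  also have "(b - x) / (b - a) - (b - y) / (b - a) = (y - x) / (b - a)"
    by (simp add: diff_divide_distrib)
  finally show ?thesis using assms by (simp add: abs_divide abs_minus_commute)
qed

lemma continuous_cts_step: "a < b \<Longrightarrow> continuous_on UNIV (cts_step a b)"
  by (rule uniformly_continuous_imp_continuous, rule cts_step_uniformly_continuous)

text \<open>The Laplace transforms determine the limit of \<open>g (exp (- Y / 2))\<close> for polynomials, and hence for
  continuous \<open>g\<close>; a step function of \<open>Y\<close> is of this form.\<close>

lemma weak_conv_if_laplace:
  fixes Y :: "nat \<times> 'a \<Rightarrow> real" and W :: "nat \<times> 'a \<Rightarrow> real" and Z :: "'b \<Rightarrow> real"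
  assumes M: "prob_space M" and N: "prob_space N"
    and Y [measurable]: "\<And>n. (\<lambda>\<omega>. Y (n, \<omega>)) \<in> borel_measurable M"
    and W [measurable]: "\<And>n. (\<lambda>\<omega>. W (n, \<omega>)) \<in> borel_measurable M"
    and Z [measurable]: "Z \<in> borel_measurable N"
    and Y0: "\<And>z. Y z \<ge> 0" and Z0: "\<And>z. Z z \<ge> 0"
    and laplace: "\<And>m::nat. (\<lambda>n. \<integral>\<omega>. exp (- (real m * Y (n, \<omega>)) / 2) \<partial>M) \<longlonglongrightarrow> (\<integral>z. exp (- (real m * Z z) / 2) \<partial>N)"
    and WY: "((\<lambda>z. W z - Y z) \<longlongrightarrow> 0) (whp M)"
  shows "weak_conv_m (\<lambda>n. distr M borel (\<lambda>\<omega>. W (n, \<omega>))) (distr N borel Z)"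
proof (rule integral_cts_step_conv_imp_weak_conv)
  interpret M: prob_space M by fact
  interpret N: prob_space N by fact
  show "real_distribution (distr M borel (\<lambda>\<omega>. W (n, \<omega>)))" for n by (rule M.real_distribution_distr) simp
  show "real_distribution (distr N borel Z)" by (rule N.real_distribution_distr) simp
  fix a b :: real assume ab: "a < b"
  note cont = continuous_cts_step[OF ab]
  have [measurable]: "cts_step a b \<in> borel_measurable borel"
    using cont by (rule borel_measurable_continuous_onI)
  have bound: "\<bar>cts_step a b x\<bar> \<le> 1" for x
    using ab by (auto simp: cts_step_def field_simps)
  \<comment> \<open>Below this cut-off the logarithm is replaced by a constant, which keeps
    \<open>g\<close> continuous at 0. Nothing is lost: there the argument of the step function is at
    least \<open>b\<close>, where it has already dropped to 0.\<close>
  define c where "c = exp (- \<bar>b\<bar> / 2)"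
  define g where "g u = cts_step a b (- 2 * ln (max u c))" for u
  have c: "c > 0" by (simp add: c_def)
  have g_cont: "continuous_on UNIV g"
  proof -
    have "max u c \<noteq> 0" for u using c by (auto simp: max_def)
    then have "continuous_on UNIV (\<lambda>u. - 2 * ln (max u c))" by (intro continuous_intros) auto
    then show ?thesis unfolding g_def by (rule continuous_on_compose2[OF cont]) auto
  qed
  have g_eq: "g (exp (- y / 2)) = cts_step a b y" for y
  proof (cases "exp (- y / 2) \<ge> c")
    case True
    then show ?thesis by (simp add: g_def max_def)
  next
    case False
    then have "y > \<bar>b\<bar>" by (simp add: c_def)
    then show ?thesis using False ab abs_ge_self[of b] by (simp add: g_def max_def c_def cts_step_def)
  qed
  have 1: "(\<lambda>n. \<integral>\<omega>. cts_step a b (Y (n, \<omega>)) \<partial>M) \<longlonglongrightarrow> (\<integral>z. cts_step a b (Z z) \<partial>N)"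
    using expectation_tendsto_if_laplace[OF M N, of "\<lambda>n \<omega>. Y (n, \<omega>)" Z g, unfolded g_eq, OF Y Z Y0 Z0 laplace g_cont]
    by simp
  have "((\<lambda>z. cts_step a b (W z) - cts_step a b (Y z)) \<longlongrightarrow> 0) (whp M)"
  proof (rule Lim_null_comparison)
    show "\<forall>\<^sub>F z in whp M. norm (cts_step a b (W z) - cts_step a b (Y z)) \<le> \<bar>W z - Y z\<bar> / (b - a)"
      using cts_step_lipschitz[OF ab] by simp
    show "((\<lambda>z. \<bar>W z - Y z\<bar> / (b - a)) \<longlongrightarrow> 0) (whp M)"
      using tendsto_divide[OF tendsto_rabs_zero[OF WY] tendsto_const, of "b - a"] ab by simp
  qed
  then have "(\<lambda>n. \<integral>\<omega>. cts_step a b (W (n, \<omega>)) - cts_step a b (Y (n, \<omega>)) \<partial>M) \<longlonglongrightarrow> 0"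
  proof (rule M.expectation_tendsto_whp[rotated 2])
    show "\<bar>cts_step a b (W z) - cts_step a b (Y z)\<bar> \<le> 2" for z
      using bound[of "W z"] bound[of "Y z"] by linarith
  qed measurable
  moreover have "integrable M (\<lambda>\<omega>. cts_step a b (W (n, \<omega>)))" "integrable M (\<lambda>\<omega>. cts_step a b (Y (n, \<omega>)))" for n
    by (rule M.integrable_const_bound[of _ 1]; use bound in simp)+
  ultimately have "(\<lambda>n. (\<integral>\<omega>. cts_step a b (W (n, \<omega>)) \<partial>M) - (\<integral>\<omega>. cts_step a b (Y (n, \<omega>)) \<partial>M)) \<longlonglongrightarrow> 0"
    by simp
  from tendsto_add[OF this 1]
  show "(\<lambda>n. integral\<^sup>L (distr M borel (\<lambda>\<omega>. W (n, \<omega>))) (cts_step a b)) \<longlonglongrightarrow> integral\<^sup>L (distr N borel Z) (cts_step a b)"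
    by (simp add: integral_distr)
qed

section \<open>The chi-squared distribution and quantiles\<close>

lemma real_distribution_chi_squared: "real_distribution (chi_squared r)"
  unfolding chi_squared_def
  by (rule prob_space.real_distribution_distr[OF prob_space_gaussian_vector]) measurable

text \<open>Given the first coordinates, the last one is confined to at most two points, a null set
  of the normal law. For \<open>r = 0\<close> the law is the unit mass at 0.\<close>

lemma chi_squared_no_atom:
  assumes "r \<noteq> 0" shows "measure (chi_squared r) {x} = 0"
proof -
  interpret product_prob_space "\<lambda>_::nat. std_normal_distribution" by (rule product_prob_space_std_normal)
  obtain m where m: "r = Suc m" using assms by (cases r) auto
  have [measurable]: "(\<lambda>z. \<Sum>i<r. (z i)\<^sup>2) \<in> borel_measurable (gaussian_vector r)" by measurable
  have finite_null: "emeasure std_normal_distribution {y. y\<^sup>2 = c} = 0" for c :: real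
  proof -
    have "{y. y\<^sup>2 = c} \<subseteq> {sqrt c, - sqrt c}"
      by (auto simp: real_sqrt_abs)
    then have "finite {y::real. y\<^sup>2 = c}" by (rule finite_subset) simp
    then have "{y. y\<^sup>2 = c} \<in> null_sets lborel"
      by (rule finite_imp_null_set_lborel)
    moreover have "absolutely_continuous lborel std_normal_distribution"
      by (rule absolutely_continuousI_density) simp
    ultimately show ?thesis by (auto simp: absolutely_continuous_def)
  qed
  have "emeasure (chi_squared r) {x} =
      emeasure (gaussian_vector r) {z \<in> space (gaussian_vector r). (\<Sum>i<r. (z i)\<^sup>2) = x}"
    unfolding chi_squared_def by (subst emeasure_distr) (auto intro!: arg_cong[where f="emeasure _"])
  also have "\<dots> = (\<integral>\<^sup>+z. indicator {x} (\<Sum>i<r. (z i)\<^sup>2) \<partial>gaussian_vector r)"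
  proof -
    have "(\<integral>\<^sup>+z. indicator {x} (\<Sum>i<r. (z i)\<^sup>2) \<partial>gaussian_vector r) =
        (\<integral>\<^sup>+z. indicator {z \<in> space (gaussian_vector r). (\<Sum>i<r. (z i)\<^sup>2) = x} z \<partial>gaussian_vector r)"
      by (rule nn_integral_cong) (auto simp: indicator_def)
    then show ?thesis by simp
  qed
  also have "\<dots> = (\<integral>\<^sup>+z. (\<integral>\<^sup>+y. indicator {x} (\<Sum>i<r. ((z(m := y)) i)\<^sup>2) \<partial>std_normal_distribution) \<partial>gaussian_vector m)"
    unfolding m lessThan_Suc
    by (rule product_nn_integral_insert) (auto simp flip: lessThan_Suc m)
  also have "\<dots> = (\<integral>\<^sup>+z. 0 \<partial>gaussian_vector m)"
  proof (rule nn_integral_cong)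
    fix z :: "nat \<Rightarrow> real"
    have "(\<Sum>i<r. ((z(m := y)) i)\<^sup>2) = (\<Sum>i<m. (z i)\<^sup>2) + y\<^sup>2" for y
      unfolding m by simp
    then have "(\<integral>\<^sup>+y. indicator {x} (\<Sum>i<r. ((z(m := y)) i)\<^sup>2) \<partial>std_normal_distribution) =
        (\<integral>\<^sup>+y. indicator {y. y\<^sup>2 = x - (\<Sum>i<m. (z i)\<^sup>2)} y \<partial>std_normal_distribution)"
      by (intro nn_integral_cong) (auto simp: indicator_def algebra_simps)
    also have "\<dots> = 0" by (subst nn_integral_indicator) (auto simp: finite_null)
    finally show "(\<integral>\<^sup>+y. indicator {x} (\<Sum>i<r. ((z(m := y)) i)\<^sup>2) \<partial>std_normal_distribution) = 0" .
  qed
  finally show ?thesis by (simp add: measure_def)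
qed

lemma isCont_cdf_chi_squared:
  assumes "r \<noteq> 0" shows "isCont (cdf (chi_squared r)) x"
proof -
  interpret real_distribution "chi_squared r" by (rule real_distribution_chi_squared)
  show ?thesis using chi_squared_no_atom[OF assms] by (simp add: isCont_cdf)
qed

text \<open>Continuity makes the superlevel set closed, so its infimum belongs to it; the
  intermediate value theorem supplies a point with value exactly \<open>p\<close>, which bounds the
  infimum from above.\<close>

lemma cdf_quantile:
  assumes \<mu>: "real_distribution \<mu>" and cont: "\<And>x. isCont (cdf \<mu>) x" and p: "0 < p" "p < 1"
  shows "cdf \<mu> (quantile \<mu> p) = p"
proof -
  interpret real_distribution \<mu> by fact
  define S where "S = {x. p \<le> cdf \<mu> x}"
  obtain lo where lo: "cdf \<mu> lo < p"
    using order_tendstoD(2)[OF cdf_lim_at_bot p(1)] by (auto simp: eventually_at_bot_linorder)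
  obtain hi where hi: "p < cdf \<mu> hi"
    using order_tendstoD(1)[OF cdf_lim_at_top_prob p(2)] by (auto simp: eventually_at_top_linorder)
  have "closed S"
    unfolding S_def using cont by (intro closed_Collect_le) (auto intro: continuous_at_imp_continuous_on)
  moreover have bdd: "bdd_below S"
  proof (rule bdd_belowI[of _ lo])
    fix x assume "x \<in> S"
    then have "cdf \<mu> lo < cdf \<mu> x" using lo by (simp add: S_def)
    then show "lo \<le> x" using cdf_nondecreasing[of x lo] by linarith
  qed
  moreover have "S \<noteq> {}" using hi by (auto simp: S_def intro: less_imp_le)
  ultimately have ge: "p \<le> cdf \<mu> (Inf S)"
    using closed_contains_Inf[of S] by (simp add: S_def)
  have "lo \<le> hi" using lo hi cdf_nondecreasing[of hi lo] by linarith
  then obtain x where x: "cdf \<mu> x = p"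
    using IVT[of "cdf \<mu>" lo p hi] lo hi cont by auto
  then have "Inf S \<le> x" using bdd by (intro cInf_lower) (auto simp: S_def)
  then have "cdf \<mu> (Inf S) \<le> p" using cdf_nondecreasing[of "Inf S" x] x by simp
  with ge show ?thesis by (simp add: quantile_def S_def)
qed

lemma isCont_cdf_std_normal: "isCont (cdf std_normal_distribution) x"
proof -
  interpret real_distribution std_normal_distribution by (rule real_dist_normal_dist)
  have "absolutely_continuous lborel std_normal_distribution"
    by (rule absolutely_continuousI_density) simp
  moreover have "{x} \<in> null_sets lborel" by (rule finite_imp_null_set_lborel) simp
  ultimately have "emeasure std_normal_distribution {x} = 0"
    by (auto simp: absolutely_continuous_def)
  then show ?thesis by (simp add: isCont_cdf measure_def)
qed

lemma std_normal_symmetric: "distr std_normal_distribution borel uminus = std_normal_distribution"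
proof (rule Levy_uniqueness)
  interpret real_distribution std_normal_distribution by (rule real_dist_normal_dist)
  show "real_distribution (distr std_normal_distribution borel uminus)"
    by (rule real_distribution_distr) simp
  show "char (distr std_normal_distribution borel uminus) = char std_normal_distribution"
  proof
    fix t
    have "char (distr std_normal_distribution borel uminus) t = char std_normal_distribution (- t)"
      unfolding char_def by (subst integral_distr) auto
    then show "char (distr std_normal_distribution borel uminus) t = char std_normal_distribution t"
      by (simp add: char_std_normal_distribution)
  qed
qed (rule real_dist_normal_dist)

text \<open>With \<open>z\<close> the lower quantile the event is the interval from \<open>z\<close>
  to \<open>- z\<close>, whose complement consists of two tails of mass \<open>\<alpha> / 2\<close>
  each.\<close>

lemma cdf_chi_squared_1:
  assumes \<alpha>: "0 < \<alpha>" "\<alpha> < 1"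
  defines "z \<equiv> quantile std_normal_distribution (\<alpha> / 2)"
  shows "cdf (chi_squared 1) (z\<^sup>2) = 1 - \<alpha>"
proof -
  interpret N: real_distribution std_normal_distribution by (rule real_dist_normal_dist)
  interpret product_prob_space "\<lambda>_::nat. std_normal_distribution" by (rule product_prob_space_std_normal)
  let ?N = std_normal_distribution
  have z: "cdf ?N z = \<alpha> / 2"
    unfolding z_def by (rule cdf_quantile[OF real_dist_normal_dist isCont_cdf_std_normal]) (use \<alpha> in auto)
  have atom: "measure ?N {x} = 0" for x
    using isCont_cdf_std_normal[of x] by (simp add: N.isCont_cdf)
  have sym: "measure ?N {x..} = cdf ?N (- x)" for x
  proof -
    have "measure ?N {..- x} = measure (distr ?N borel uminus) {..- x}"
      by (simp only: std_normal_symmetric)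
    also have "\<dots> = measure ?N {x..}"
      by (subst measure_distr) (auto intro!: arg_cong[where f="measure ?N"])
    finally show ?thesis by (simp add: cdf_def)
  qed
  have lt: "measure ?N {..<x} = cdf ?N x" for x
  proof -
    have "measure ?N {..x} = measure ?N ({..<x} \<union> {x})" by (rule arg_cong[where f="measure ?N"]) auto
    also have "\<dots> = measure ?N {..<x} + measure ?N {x}"
      by (rule N.finite_measure_Union) auto
    finally show ?thesis using atom by (simp add: cdf_def)
  qed
  have compl: "cdf ?N (- x) = 1 - cdf ?N x" for x
  proof -
    have "measure ?N {x..} = measure ?N (space ?N - {..<x})" by (rule arg_cong[where f="measure ?N"]) auto
    also have "\<dots> = 1 - measure ?N {..<x}" by (rule N.prob_compl) simp
    finally show ?thesis using sym lt by simp
  qed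
  \<comment> \<open>Otherwise symmetry would give
    \<open>1 - \<alpha> / 2 \<le> \<alpha> / 2\<close>.\<close>
  have z0: "z \<le> 0"
  proof (rule ccontr)
    assume "\<not> z \<le> 0"
    then have "cdf ?N (- z) \<le> cdf ?N z" by (intro N.cdf_nondecreasing) simp
    then show False using compl[of z] z \<alpha> by simp
  qed
  have "measure (chi_squared 1) {..z\<^sup>2} = measure (gaussian_vector 1) {x \<in> space (gaussian_vector 1). (x 0)\<^sup>2 \<le> z\<^sup>2}"
    unfolding chi_squared_def by (subst measure_distr) (auto intro!: arg_cong[where f="measure _"])
  also have "\<dots> = measure (distr (gaussian_vector 1) ?N (\<lambda>x. x 0)) {y. y\<^sup>2 \<le> z\<^sup>2}"
    by (subst measure_distr) (auto intro!: arg_cong[where f="measure _"])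
  also have "distr (gaussian_vector 1) ?N (\<lambda>x. x 0) = ?N"
    by (rule distr_PiM_component) (auto intro: prob_space_std_normal)
  also have "{y. y\<^sup>2 \<le> z\<^sup>2} = {..- z} - {..<z}"
    using z0 by (auto simp: abs_le_square_iff[symmetric])
  also have "measure ?N ({..- z} - {..<z}) = measure ?N {..- z} - measure ?N {..<z}"
    by (rule N.finite_measure_Diff) (use z0 in auto)
  also have "\<dots> = 1 - \<alpha>"
    using compl[of z] z lt[of z] by (simp add: cdf_def)
  finally show ?thesis by (simp add: cdf_def)
qed

section \<open>A sample from a regular parameter\<close>

text \<open>\<open>None\<close> stands for the constant 1, so that pairs of indices describe all
  monomials of degree at most two, lower degrees included.\<close>

definition monomial :: "'v option \<Rightarrow> real ^ 'v \<Rightarrow> real" where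
  "monomial a x = (case a of None \<Rightarrow> 1 | Some v \<Rightarrow> x $ v)"

abbreviation monomial2 :: "'v option \<times> 'v option \<Rightarrow> real ^ 'v \<Rightarrow> real" where
  "monomial2 \<equiv> \<lambda>(a, b) x. monomial a x * monomial b x"

lemma monomial_measurable [measurable]: "monomial a \<in> borel_measurable (borel :: (real ^ 'v::finite) measure)"
  unfolding monomial_def by (cases a) auto

lemma fourth_moment_monomial:
  fixes G :: "'v::finite mgraph"
  assumes Q: "Q \<in> error_laws G" shows "fourth_moment (model_law \<beta> Q) (monomial a)"
proof -
  interpret prob_space Q by (rule error_laws_prob_space[OF Q])
  have "solution \<beta> \<in> measurable Q borel"
    unfolding measurable_cong_sets[OF error_laws_sets[OF Q] refl] by measurable
  moreover have "fourth_moment Q (\<lambda>e. monomial a (solution \<beta> e))"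
    by (cases a) (simp_all add: monomial_def fourth_moment_solution[OF Q] fourth_moment_const)
  ultimately show ?thesis
    unfolding model_law_solution by (subst fourth_moment_distr) auto
qed

text \<open>A variable \<open>z = (n, \<omega>)\<close> is a sample size with a sample point, and a
  trailing \<open>h\<close> marks an estimate. The locale is opened twice at the end: at the given
  parameter and at an arbitrary regular one.\<close>

locale htc_sample =
  fixes G :: "'v::finite mgraph" and W :: "'v set" and Y :: "'v \<Rightarrow> 'v set"
    and prec :: "('v \<times> 'v) set" and \<beta> :: "real ^ 'v ^ 'v" and Q :: "(real ^ 'v) measure"
    and M :: "'a measure" and X :: "nat \<Rightarrow> 'a \<Rightarrow> real ^ 'v"
  assumes ident: "HTC_identified G W Y prec" and regular: "regular_parameter G W Y \<beta> Q"
    and iid: "iid_sample M X (model_law \<beta> Q)"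
begin

abbreviation P where "P \<equiv> model_law \<beta> Q"
abbreviation E where "E \<equiv> expect_under P"
abbreviation b where "b \<equiv> coef G \<beta>"
abbreviation \<phi> where "\<phi> \<equiv> influence G Y prec E b"
abbreviation R where "R \<equiv> row_contrib G Y E b \<phi>"
abbreviation A where "A \<equiv> Amat G Y E b"
abbreviation emp where "emp z \<equiv> empirical (fst z) (\<lambda>i. X i (snd z))"
abbreviation bh where "bh z \<equiv> beta_hat G Y prec (fst z) (\<lambda>i. X i (snd z))"
abbreviation \<phi>h where "\<phi>h z \<equiv> influence G Y prec (emp z) (bh z)"
abbreviation Rh where "Rh z \<equiv> row_contrib G Y (emp z) (bh z) (\<phi>h z)"
abbreviation Ah where "Ah z \<equiv> Amat G Y (emp z) (bh z)"

lemma coef: "\<beta> \<in> coefficients G" and errors: "Q \<in> error_laws G"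
  and A_invertible: "u \<in> W \<Longrightarrow> invertible_mat (A u)"
  using regular by (auto simp: regular_parameter_def)

lemma Q_prob_space: "prob_space Q" and Q_sets: "sets Q = sets borel"
  using errors by (auto simp: error_laws_def)

lemma solution_measurable_Q: "solution \<gamma> \<in> measurable Q borel"
  unfolding measurable_cong_sets[OF Q_sets refl] by measurable

lemma P_sets: "sets P = sets borel"
  by (simp add: model_law_solution)

lemma P_prob_space: "prob_space P"
  unfolding model_law_solution by (rule prob_space.prob_space_distr[OF Q_prob_space solution_measurable_Q])

lemma integral_P:
  fixes f :: "real ^ 'v \<Rightarrow> real"
  shows "f \<in> borel_measurable borel \<Longrightarrow> (\<integral>x. f x \<partial>model_law \<gamma> Q) = (\<integral>e. f (solution \<gamma> e) \<partial>Q)"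
  unfolding model_law_solution by (rule integral_distr[OF solution_measurable_Q])

lemma monomial4_integrable: "integrable P ((\<lambda>(a, b) x. monomial2 a x * monomial2 b x) c)"
proof -
  obtain a b c' d where "c = ((a, b), (c', d))" by (metis surj_pair)
  then show ?thesis
    using integrable_mult4[of P "monomial a" "monomial b" "monomial c'" "monomial d"]
    by (simp add: fourth_moment_monomial[OF errors])
qed

lemma monomial2_integrable: "integrable P (monomial2 c)"
proof -
  interpret prob_space P by (rule P_prob_space)
  show ?thesis
    by (cases c) (simp add: integrable_mult2 fourth_moment_monomial[OF errors])
qed

lemma Y_htr: "u \<in> W \<Longrightarrow> y \<in> Y u \<Longrightarrow> y \<in> htr G u \<Longrightarrow> (y, u) \<in> prec \<and> y \<in> W"
  and Y_sib: "u \<in> W \<Longrightarrow> y \<in> Y u \<Longrightarrow> y \<notin> {u} \<union> sib G u"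
  and card_Y: "u \<in> W \<Longrightarrow> card (Y u) = card (pa G u)"
  using ident by (auto simp: HTC_identified_def satisfies_HTC_def)

lemma A_carrier: "u \<in> W \<Longrightarrow> Amat G Y E' b' u \<in> carrier_mat (card (pa G u)) (card (pa G u))"
  using card_Y by (simp add: Amat_def)

lemma bvec_carrier: "u \<in> W \<Longrightarrow> bvec G Y E' b' u \<in> carrier_vec (card (pa G u))"
  using card_Y by (simp add: bvec_def)

lemma row_carrier: "u \<in> W \<Longrightarrow> row_contrib G Y E' b' \<phi>' u x \<in> carrier_vec (card (pa G u))"
  using card_Y by (simp add: row_contrib_def)

lemma coef_carrier: "b u \<in> carrier_vec (card (pa G u))"
  by (simp add: coef_def)

lemma A_det: "u \<in> W \<Longrightarrow> Determinant.det (A u) \<noteq> 0"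
  using A_invertible A_carrier invertible_mat_iff_det by blast

lemma beta_hat_rec:
  "u \<in> W \<Longrightarrow> bh z u = inv_mat (Ah z u) *\<^sub>v bvec G Y (emp z) (bh z) u"
  unfolding beta_hat_def by (rule HTC_coefs_rec[OF ident])

lemma beta_hat_carrier: "u \<in> W \<Longrightarrow> bh z u \<in> carrier_vec (card (pa G u))"
  unfolding beta_hat_rec by (rule mult_mat_vec_carrier[OF inv_mat_carrier[OF A_carrier] bvec_carrier])

lemma influence_index:
  assumes "u \<in> W" "j < card (pa G u)"
  shows "influence G Y prec E' b' u x $v j =
    (\<Sum>i<card (pa G u). inv_mat (Amat G Y E' b' u) $$ (j, i) * row_contrib G Y E' b' (influence G Y prec E' b') u x $v i)"
  unfolding influence_rec[OF ident assms(1)]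
  by (rule mult_mat_vec_index[OF inv_mat_carrier[OF A_carrier] row_carrier]) (use assms in auto)

lemma resid_measurable [measurable]: "resid G b' u \<in> borel_measurable borel"
  unfolding resid_def by measurable

lemma instr_measurable [measurable]: "instr G b' u y \<in> borel_measurable borel"
  unfolding instr_def by measurable

text \<open>The moment condition behind the estimator. A residual instrument is the error at
  \<open>y\<close>, and \<open>y\<close> is neither \<open>u\<close> nor a sibling of
  \<open>u\<close>; a raw instrument lies outside \<open>htr G u\<close>.\<close>

lemma instr_uncorrelated:
  assumes u: "u \<in> W" and y: "y \<in> Y u"
  shows "(\<integral>x. instr G b u y x * resid G b u x \<partial>P) = 0"
proof (subst integral_P)
  show "(\<integral>e. instr G b u y (solution \<beta> e) * resid G b u (solution \<beta> e) \<partial>Q) = 0"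
  proof (cases "y \<in> htr G u")
    case True
    then show ?thesis
      using errors_uncorrelated[OF errors Y_sib[OF u y]] by (simp add: instr_def resid_solution[OF coef])
  next
    case False
    then show ?thesis
      using solution_error_uncorrelated[OF coef errors Y_sib[OF u y]]
      by (simp add: instr_def resid_solution[OF coef])
  qed
qed measurable

section \<open>Consistency of the estimators\<close>

abbreviation affine where "affine \<equiv> span_consistent M monomial"
abbreviation quadratic where "quadratic \<equiv> span_consistent M monomial2"

lemma affine_coordinate: "affine (\<lambda>z x. x $ v) (\<lambda>x. x $ v)"
proof -
  have "monomial (Some v) = (\<lambda>x. x $ v)" by (simp add: monomial_def fun_eq_iff)
  then show ?thesis using span_consistent_basis[of M monomial "Some v"] by simp
qed

lemma consistent_emp_affine:
  assumes "affine F f" "affine F' f'"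
  shows "consistent M (\<lambda>z. emp z (\<lambda>x. F z x * F' z x)) (E (\<lambda>x. f x * f' x))"
    and "integrable P (\<lambda>x. f x * f' x)"
  unfolding expect_under_def
  by (rule consistent_empirical_span[OF iid span_consistent_mult[OF assms] monomial2_integrable])+

lemma consistent_emp_quadratic:
  assumes "quadratic F f" "quadratic F' f'"
  shows "consistent M (\<lambda>z. emp z (\<lambda>x. F z x * F' z x)) (E (\<lambda>x. f x * f' x))"
    and "integrable P (\<lambda>x. f x * f' x)"
  unfolding expect_under_def
  by (rule consistent_empirical_span[OF iid span_consistent_mult[OF assms] monomial4_integrable])+

text \<open>Takes consistency of the coefficients as a hypothesis so that it can serve inside the
  induction that proves it.\<close>

lemma affine_resid_if:
  assumes "\<And>j. j < card (pa G u) \<Longrightarrow> consistent M (\<lambda>z. bh z u $v j) (b u $v j)"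
  shows "affine (\<lambda>z. resid G (bh z) u) (resid G b u)"
proof -
  have "affine (\<lambda>z x. x $ u - (\<Sum>j<card (pa G u). bh z u $v j * x $ nth_elem (pa G u) j))
     (\<lambda>x. x $ u - (\<Sum>j<card (pa G u). b u $v j * x $ nth_elem (pa G u) j))"
    by (intro span_consistent_diff affine_coordinate span_consistent_sum span_consistent_scale assms) auto
  then show ?thesis by (simp add: resid_def[abs_def])
qed

text \<open>Instruments at \<open>u\<close> contain only coefficients of predecessors of
  \<open>u\<close>, so consistency of the moment matrix comes first, and consistency of the
  coefficients follows from it by continuity of the inverse.\<close>

lemma consistent_beta_hat: "u \<in> W \<Longrightarrow> j < card (pa G u) \<Longrightarrow> consistent M (\<lambda>z. bh z u $v j) (b u $v j)"
  and Amat_consistent: "u \<in> W \<Longrightarrow> mat_consistent M (card (pa G u)) (card (pa G u)) (\<lambda>z. Ah z u) (A u)"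
proof -
  have *: "(\<forall>j<card (pa G u). consistent M (\<lambda>z. bh z u $v j) (b u $v j)) \<and>
      mat_consistent M (card (pa G u)) (card (pa G u)) (\<lambda>z. Ah z u) (A u)" if "u \<in> W" for u
    using HTC_identified_wf[OF ident] that
  proof (induction u rule: wf_induct_rule)
    case (less u)
    let ?k = "card (pa G u)"
    note u = \<open>u \<in> W\<close>
    have instr: "affine (\<lambda>z. instr G (bh z) u y) (instr G b u y)" if y: "y \<in> Y u" for y
    proof (cases "y \<in> htr G u")
      case True
      then have "affine (\<lambda>z. resid G (bh z) y) (resid G b y)"
        using less.IH[of y] Y_htr[OF u y] by (intro affine_resid_if) auto
      then show ?thesis using True by (simp add: instr_def[abs_def])
    next
      case False
      then show ?thesis using affine_coordinate[of y] by (simp add: instr_def[abs_def])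
    qed
    have nth: "nth_elem (Y u) i \<in> Y u" if "i < ?k" for i
      using that card_Y[OF u] by (intro nth_elem_in) simp
    have Acons: "mat_consistent M ?k ?k (\<lambda>z. Ah z u) (A u)"
    proof (rule mat_consistentI)
      fix i j assume ij: "i < ?k" "j < ?k"
      have "consistent M (\<lambda>z. emp z (\<lambda>x. instr G (bh z) u (nth_elem (Y u) i) x * x $ nth_elem (pa G u) j))
         (E (\<lambda>x. instr G b u (nth_elem (Y u) i) x * x $ nth_elem (pa G u) j))"
        by (intro consistent_emp_affine(1) instr nth affine_coordinate ij)
      then show "consistent M (\<lambda>z. Ah z u $$ (i, j)) (A u $$ (i, j))"
        using ij card_Y[OF u] by (simp add: Amat_def)
    qed (intro A_carrier u)+
    have bcons: "consistent M (\<lambda>z. bvec G Y (emp z) (bh z) u $v i) (bvec G Y E b u $v i)" if i: "i < ?k" for i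
    proof -
      have "consistent M (\<lambda>z. emp z (\<lambda>x. instr G (bh z) u (nth_elem (Y u) i) x * x $ u))
         (E (\<lambda>x. instr G b u (nth_elem (Y u) i) x * x $ u))"
        by (intro consistent_emp_affine(1) instr nth affine_coordinate i)
      then show ?thesis using i card_Y[OF u] by (simp add: bvec_def)
    qed
    \<comment> \<open>Expanding the residual in \<open>instr_uncorrelated\<close> gives the normal
      equations: the population moments, inverted, return the true coefficients.\<close>
    have normal: "A u *\<^sub>v b u = bvec G Y E b u"
    proof (rule eq_vecI)
      fix i assume "i < dim_vec (bvec G Y E b u)"
      then have i: "i < ?k" "i < card (Y u)" using card_Y[OF u] by (auto simp: bvec_def)
      let ?Z = "instr G b u (nth_elem (Y u) i)"
      have int: "integrable P (\<lambda>x. ?Z x * x $ p)" for p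
        using consistent_emp_affine(2)[OF instr[OF nth[OF i(1)]] affine_coordinate[of p]] .
      have "0 = (\<integral>x. ?Z x * resid G b u x \<partial>P)"
        using instr_uncorrelated[OF u nth[OF i(1)]] by simp
      also have "\<dots> = (\<integral>x. ?Z x * x $ u - (\<Sum>j<?k. b u $v j * (?Z x * x $ nth_elem (pa G u) j)) \<partial>P)"
        by (simp add: resid_def right_diff_distrib sum_distrib_left mult.left_commute)
      also have "\<dots> = (\<integral>x. ?Z x * x $ u \<partial>P) - (\<Sum>j<?k. b u $v j * (\<integral>x. ?Z x * x $ nth_elem (pa G u) j \<partial>P))"
        using int by (simp add: Bochner_Integration.integral_sum)
      finally have "(\<Sum>j<?k. (\<integral>x. ?Z x * x $ nth_elem (pa G u) j \<partial>P) * b u $v j) = (\<integral>x. ?Z x * x $ u \<partial>P)"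
        by (simp add: mult.commute)
      moreover have "(A u *\<^sub>v b u) $v i = (\<Sum>j<?k. A u $$ (i, j) * b u $v j)"
        by (rule mult_mat_vec_index[OF A_carrier[OF u] coef_carrier i(1)])
      ultimately show "(A u *\<^sub>v b u) $v i = bvec G Y E b u $v i"
        using i by (simp add: Amat_def bvec_def expect_under_def)
    qed (use card_Y[OF u] in \<open>simp add: Amat_def bvec_def\<close>)
    have pop: "inv_mat (A u) *\<^sub>v bvec G Y E b u = b u"
      unfolding normal[symmetric]
      using assoc_mult_mat_vec[OF inv_mat_carrier[OF A_carrier[OF u]] A_carrier[OF u] coef_carrier]
        inv_mat_inverse(2)[OF A_carrier[OF u] A_det[OF u]] coef_carrier[of u]
      by (metis one_mult_mat_vec)
    have "consistent M (\<lambda>z. bh z u $v j) (b u $v j)" if j: "j < ?k" for j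
      unfolding beta_hat_rec[OF u]
      using consistent_mat_vec[OF mat_consistent_inv[OF Acons A_det[OF u]] bvec_carrier[OF u] bvec_carrier[OF u] bcons j]
      unfolding pop .
    then show ?case using Acons by blast
  qed
  show "u \<in> W \<Longrightarrow> j < card (pa G u) \<Longrightarrow> consistent M (\<lambda>z. bh z u $v j) (b u $v j)"
    "u \<in> W \<Longrightarrow> mat_consistent M (card (pa G u)) (card (pa G u)) (\<lambda>z. Ah z u) (A u)"
    using *[of u] by blast+
qed

lemma affine_resid: "u \<in> W \<Longrightarrow> affine (\<lambda>z. resid G (bh z) u) (resid G b u)"
  by (intro affine_resid_if consistent_beta_hat)

lemma nth_Y: "u \<in> W \<Longrightarrow> i < card (pa G u) \<Longrightarrow> nth_elem (Y u) i \<in> Y u"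
  using card_Y by (intro nth_elem_in) simp

lemma row_index:
  assumes "u \<in> W" "i < card (pa G u)"
  shows "row_contrib G Y E' b' \<phi>' u x $v i =
     (if nth_elem (Y u) i \<in> htr G u
     then resid G b' (nth_elem (Y u) i) x * resid G b' u x -
          (\<Sum>j<card (pa G (nth_elem (Y u) i)).
            E' (\<lambda>x'. x' $ nth_elem (pa G (nth_elem (Y u) i)) j * resid G b' u x') * \<phi>' (nth_elem (Y u) i) x $v j)
     else x $ nth_elem (Y u) i * resid G b' u x)"
  using assms card_Y by (simp add: row_contrib_def Let_def)

text \<open>The correction terms multiply earlier influence functions by consistent empirical means,
  and inversion of the moment matrix adds consistent factors, so along the ordering degree two in
  the observations is never exceeded.\<close>

lemma quadratic_influence:
    "u \<in> W \<Longrightarrow> j < card (pa G u) \<Longrightarrow> quadratic (\<lambda>z x. \<phi>h z u x $v j) (\<lambda>x. \<phi> u x $v j)"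
  and quadratic_row: "u \<in> W \<Longrightarrow> i < card (pa G u) \<Longrightarrow> quadratic (\<lambda>z x. Rh z u x $v i) (\<lambda>x. R u x $v i)"
proof -
  have *: "(\<forall>j<card (pa G u). quadratic (\<lambda>z x. \<phi>h z u x $v j) (\<lambda>x. \<phi> u x $v j)) \<and>
      (\<forall>i<card (pa G u). quadratic (\<lambda>z x. Rh z u x $v i) (\<lambda>x. R u x $v i))" if "u \<in> W" for u
    using HTC_identified_wf[OF ident] that
  proof (induction u rule: wf_induct_rule)
    case (less u)
    let ?k = "card (pa G u)"
    note u = \<open>u \<in> W\<close>
    have row: "quadratic (\<lambda>z x. Rh z u x $v i) (\<lambda>x. R u x $v i)" if i: "i < ?k" for i
    proof (cases "nth_elem (Y u) i \<in> htr G u")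
      case True
      let ?y = "nth_elem (Y u) i"
      have y: "(?y, u) \<in> prec" "?y \<in> W" using Y_htr[OF u nth_Y[OF u i] True] by auto
      have "quadratic (\<lambda>z x. resid G (bh z) ?y x * resid G (bh z) u x -
          (\<Sum>j<card (pa G ?y). emp z (\<lambda>x'. x' $ nth_elem (pa G ?y) j * resid G (bh z) u x') * \<phi>h z ?y x $v j))
        (\<lambda>x. resid G b ?y x * resid G b u x -
          (\<Sum>j<card (pa G ?y). E (\<lambda>x'. x' $ nth_elem (pa G ?y) j * resid G b u x') * \<phi> ?y x $v j))"
        using less.IH[OF y]
        by (intro span_consistent_diff span_consistent_mult affine_resid y u span_consistent_sum span_consistent_scale
            consistent_emp_affine(1) affine_coordinate) auto
      then show ?thesis using True by (simp add: row_index[OF u i])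
    next
      case False
      then show ?thesis
        using span_consistent_mult[OF affine_coordinate[of "nth_elem (Y u) i"] affine_resid[OF u]]
        by (simp add: row_index[OF u i])
    qed
    have "quadratic (\<lambda>z x. \<phi>h z u x $v j) (\<lambda>x. \<phi> u x $v j)" if j: "j < ?k" for j
      unfolding influence_index[OF u j]
      by (intro span_consistent_sum span_consistent_scale row
          mat_consistentD(3)[OF mat_consistent_inv[OF Amat_consistent[OF u] A_det[OF u]]] j) auto
    then show ?case using row by blast
  qed
  show "u \<in> W \<Longrightarrow> j < card (pa G u) \<Longrightarrow> quadratic (\<lambda>z x. \<phi>h z u x $v j) (\<lambda>x. \<phi> u x $v j)"
    "u \<in> W \<Longrightarrow> i < card (pa G u) \<Longrightarrow> quadratic (\<lambda>z x. Rh z u x $v i) (\<lambda>x. R u x $v i)"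
    using *[of u] by blast+
qed

lemma V_hat_consistent:
  assumes u: "u \<in> W"
  shows "mat_consistent M (card (pa G u)) (card (pa G u))
    (\<lambda>z. V_hat G Y prec (fst z) (\<lambda>i. X i (snd z)) u) (V_true G Y prec \<beta> Q u)"
proof -
  let ?k = "card (pa G u)"
  have mid: "mat_consistent M ?k ?k
    (\<lambda>z. Matrix.mat ?k ?k (\<lambda>(i, j). emp z (\<lambda>x. Rh z u x $v i * Rh z u x $v j)))
    (Matrix.mat ?k ?k (\<lambda>(i, j). E (\<lambda>x. R u x $v i * R u x $v j)))"
    by (rule mat_consistentI) (auto intro!: consistent_emp_quadratic(1) quadratic_row u)
  note inv = mat_consistent_inv[OF Amat_consistent[OF u] A_det[OF u]]
  show ?thesis
    unfolding V_hat_def V_true_def asym_var_def Let_def card_Y[OF u]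
    by (rule mat_consistent_mult[OF mat_consistent_mult[OF inv mid] mat_consistent_transpose[OF inv]])
qed

end

section \<open>Centred row contributions and influence functions\<close>

lemma empirical_diff: "empirical n xs (\<lambda>x. f x - g x) = empirical n xs f - empirical n xs g"
  by (simp add: empirical_def sum_subtractf diff_divide_distrib)

lemma scale_diff_sum:
  fixes r :: real
  shows "r * (a - (\<Sum>j\<in>I. d j * e j)) = r * a - (\<Sum>j\<in>I. r * d j * e j)"
  by (simp add: right_diff_distrib sum_distrib_left mult.assoc)

lemma span_consistent_measurable:
  assumes "span_consistent M g F f" and "\<And>a. g a \<in> borel_measurable N"
  shows "f \<in> borel_measurable N"
proof -
  obtain c where c: "f = (\<lambda>x. \<Sum>a\<in>UNIV. c a * g a x)"
    using assms(1) unfolding span_consistent_def by (auto simp: fun_eq_iff)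
  show ?thesis unfolding c using assms(2) by measurable
qed

context htc_sample begin

lemma quadratic_measurable: "quadratic F f \<Longrightarrow> f \<in> borel_measurable borel"
  by (erule span_consistent_measurable) (auto simp: case_prod_beta)

lemma quadratic_integrable: "quadratic F f \<Longrightarrow> integrable P f"
  by (rule consistent_empirical_span(2)[OF iid _ monomial2_integrable])

text \<open>A correction term is a combination of earlier influence functions, centred by induction;
  what remains is \<open>instr_uncorrelated\<close>.\<close>

lemma row_mean_zero: "u \<in> W \<Longrightarrow> i < card (pa G u) \<Longrightarrow> (\<integral>x. R u x $v i \<partial>P) = 0"
  and influence_mean_zero: "u \<in> W \<Longrightarrow> j < card (pa G u) \<Longrightarrow> (\<integral>x. \<phi> u x $v j \<partial>P) = 0"
proof -
  have *: "(\<forall>i<card (pa G u). (\<integral>x. R u x $v i \<partial>P) = 0) \<and> (\<forall>j<card (pa G u). (\<integral>x. \<phi> u x $v j \<partial>P) = 0)"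
    if "u \<in> W" for u
    using HTC_identified_wf[OF ident] that
  proof (induction u rule: wf_induct_rule)
    case (less u)
    note u = \<open>u \<in> W\<close>
    have row: "(\<integral>x. R u x $v i \<partial>P) = 0" if i: "i < card (pa G u)" for i
    proof (cases "nth_elem (Y u) i \<in> htr G u")
      case True
      let ?y = "nth_elem (Y u) i"
      have y: "(?y, u) \<in> prec" "?y \<in> W" using Y_htr[OF u nth_Y[OF u i] True] by auto
      have int: "integrable P (\<lambda>x. resid G b ?y x * resid G b u x)"
        by (rule consistent_emp_affine(2)[OF affine_resid[OF y(2)] affine_resid[OF u]])
      have "(\<integral>x. resid G b ?y x * resid G b u x \<partial>P) = 0"
        using instr_uncorrelated[OF u nth_Y[OF u i]] True by (simp add: instr_def)
      moreover have \<phi>_int: "integrable P (\<lambda>x. \<phi> ?y x $v j)" if "j < card (pa G ?y)" for j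
        by (rule quadratic_integrable[OF quadratic_influence[OF y(2) that]])
      moreover have "(\<integral>x. (\<Sum>j<card (pa G ?y). c j * \<phi> ?y x $v j) \<partial>P) = 0" for c
      proof -
        have "(\<integral>x. (\<Sum>j<card (pa G ?y). c j * \<phi> ?y x $v j) \<partial>P) =
            (\<Sum>j<card (pa G ?y). c j * (\<integral>x. \<phi> ?y x $v j \<partial>P))"
          using \<phi>_int by (subst Bochner_Integration.integral_sum) auto
        then show ?thesis using less.IH[OF y] by simp
      qed
      moreover have "integrable P (\<lambda>x. \<Sum>j<card (pa G ?y). c j * \<phi> ?y x $v j)" for c
        using \<phi>_int by (intro Bochner_Integration.integrable_sum integrable_mult_right) auto
      ultimately show ?thesis
        using True int by (simp only: row_index[OF u i] if_True Bochner_Integration.integral_diff)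
    next
      case False
      then show ?thesis
        using instr_uncorrelated[OF u nth_Y[OF u i]] by (simp add: row_index[OF u i] instr_def)
    qed
    have "(\<integral>x. \<phi> u x $v j \<partial>P) = 0" if j: "j < card (pa G u)" for j
      using row quadratic_integrable[OF quadratic_row[OF u]]
      by (simp add: influence_index[OF u j] Bochner_Integration.integral_sum)
    then show ?case using row by blast
  qed
  show "u \<in> W \<Longrightarrow> i < card (pa G u) \<Longrightarrow> (\<integral>x. R u x $v i \<partial>P) = 0"
    "u \<in> W \<Longrightarrow> j < card (pa G u) \<Longrightarrow> (\<integral>x. \<phi> u x $v j \<partial>P) = 0"
    using *[of u] by blast+
qed

lemma bounded_in_prob_quadratic:
  assumes "quadratic F f" "(\<integral>x. f x \<partial>P) = 0"
  shows "bounded_in_prob M (\<lambda>z. sqrt (real (fst z)) * emp z f)"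
  by (rule bounded_in_prob_empirical[OF iid quadratic_measurable[OF assms(1)] _ assms(2)])
    (use consistent_emp_quadratic(2)[OF assms(1) assms(1)] in \<open>simp add: power2_eq_square\<close>)

section \<open>Asymptotic linearity\<close>

abbreviation scaled_error where
  "scaled_error u j z \<equiv> sqrt (real (fst z)) * (bh z u $v j - b u $v j)"

abbreviation scaled_mean where
  "scaled_mean f z \<equiv> sqrt (real (fst z)) * emp z f"

text \<open>The hypothesis \<open>IH\<close> is asymptotic linearity at the predecessors. The
  residual of \<open>u\<close> is taken at the true coefficients, because
  \<open>beta_hat_error\<close> produces it in this form.\<close>

lemma scaled_instrument_expansion:
  assumes u: "u \<in> W" and i: "i < card (pa G u)"
    and IH: "\<And>y j. (y, u) \<in> prec \<Longrightarrow> y \<in> W \<Longrightarrow> j < card (pa G y) \<Longrightarrow>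
      ((\<lambda>z. scaled_error y j z - scaled_mean (\<lambda>x. \<phi> y x $v j) z) \<longlongrightarrow> 0) (whp M)"
  shows "((\<lambda>z. scaled_mean (\<lambda>x. instr G (bh z) u (nth_elem (Y u) i) x * resid G b u x) z -
     scaled_mean (\<lambda>x. R u x $v i) z) \<longlongrightarrow> 0) (whp M)"
proof (cases "nth_elem (Y u) i \<in> htr G u")
  case False
  then show ?thesis by (simp add: row_index[OF u i] instr_def)
next
  case True
  let ?y = "nth_elem (Y u) i"
  let ?p = "\<lambda>j. nth_elem (pa G ?y) j"
  let ?k = "card (pa G ?y)"
  have y: "(?y, u) \<in> prec" "?y \<in> W" using Y_htr[OF u nth_Y[OF u i] True] by auto
  let ?L = "\<lambda>j. scaled_mean (\<lambda>x. \<phi> ?y x $v j)"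
  let ?e = "\<lambda>j z. emp z (\<lambda>x. x $ ?p j * resid G b u x)"
  let ?E = "\<lambda>j. E (\<lambda>x. x $ ?p j * resid G b u x)"
  \<comment> \<open>Two replacements are measured: the coefficient error by its linear part, at the
    cost of o_P(1) times a convergent mean, and the empirical mean \<open>?e j\<close> by its
    expectation, at the cost of O_P(1) times o_P(1).\<close>
  have eq: "scaled_mean (\<lambda>x. instr G (bh z) u ?y x * resid G b u x) z - scaled_mean (\<lambda>x. R u x $v i) z =
      (\<Sum>j<?k. ?L j z * (?E j - ?e j z) - (scaled_error ?y j z - ?L j z) * ?e j z)" for z
  proof -
    have "(\<lambda>x. instr G (bh z) u ?y x * resid G b u x) = (\<lambda>x. resid G b ?y x * resid G b u x -
        (\<Sum>j<?k. (bh z ?y $v j - b ?y $v j) * (x $ ?p j * resid G b u x)))"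
      using True by (simp add: instr_def resid_def fun_eq_iff left_diff_distrib sum_distrib_right
          sum_subtractf mult.assoc)
    then have "scaled_mean (\<lambda>x. instr G (bh z) u ?y x * resid G b u x) z =
        scaled_mean (\<lambda>x. resid G b ?y x * resid G b u x) z - (\<Sum>j<?k. scaled_error ?y j z * ?e j z)"
      by (simp only: empirical_diff empirical_sum scale_diff_sum)
    moreover have "scaled_mean (\<lambda>x. R u x $v i) z =
        scaled_mean (\<lambda>x. resid G b ?y x * resid G b u x) z - (\<Sum>j<?k. ?E j * ?L j z)"
      using True
      by (simp only: row_index[OF u i] if_True empirical_diff empirical_sum scale_diff_sum)
        (simp only: mult.commute mult.left_commute)
    moreover have "(\<Sum>j<?k. ?L j z * (?E j - ?e j z) - (scaled_error ?y j z - ?L j z) * ?e j z) =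
        (\<Sum>j<?k. ?E j * ?L j z) - (\<Sum>j<?k. scaled_error ?y j z * ?e j z)"
      by (simp add: sum_subtractf[symmetric] algebra_simps)
    ultimately show ?thesis by simp
  qed
  have "((\<lambda>z. \<Sum>j<?k. ?L j z * (?E j - ?e j z) - (scaled_error ?y j z - ?L j z) * ?e j z) \<longlongrightarrow>
      (\<Sum>j<?k. 0 - 0 * ?E j)) (whp M)"
  proof (intro tendsto_sum tendsto_diff tendsto_mult)
    fix j assume "j \<in> {..<?k}"
    then have j: "j < ?k" by simp
    show e: "(?e j \<longlongrightarrow> ?E j) (whp M)"
      using consistent_empirical[OF iid consistent_emp_affine(2)[OF affine_coordinate affine_resid[OF u]]]
      by (simp add: consistent_def expect_under_def)
    have "((\<lambda>z. ?E j - ?e j z) \<longlongrightarrow> 0) (whp M)"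
      using tendsto_diff[OF tendsto_const[of "?E j"] e] by simp
    then show "((\<lambda>z. ?L j z * (?E j - ?e j z)) \<longlongrightarrow> 0) (whp M)"
      by (rule bounded_in_prob_mult_null[OF bounded_in_prob_quadratic[OF quadratic_influence[OF y(2) j] influence_mean_zero[OF y(2) j]]])
    show "((\<lambda>z. scaled_error ?y j z - ?L j z) \<longlongrightarrow> 0) (whp M)"
      by (rule IH[OF y j])
  qed
  then show ?thesis unfolding eq by simp
qed

text \<open>The error is the inverse moment matrix applied to \<open>bvec\<close> minus
  \<open>Ah\<close> times the true coefficients, and that difference averages instrument times true
  residual. For a singular \<open>Ah\<close> this would fail, as \<open>inv_mat\<close> is then
  0.\<close>

lemma beta_hat_error:
  assumes u: "u \<in> W" and det: "Determinant.det (Ah z u) \<noteq> 0" and j: "j < card (pa G u)"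
  shows "bh z u $v j - b u $v j = (\<Sum>i<card (pa G u). inv_mat (Ah z u) $$ (j, i) *
      emp z (\<lambda>x. instr G (bh z) u (nth_elem (Y u) i) x * resid G b u x))"
proof -
  let ?k = "card (pa G u)"
  let ?B = "inv_mat (Ah z u)"
  have B: "?B \<in> carrier_mat ?k ?k" by (rule inv_mat_carrier[OF A_carrier[OF u]])
  have Ab: "Ah z u *\<^sub>v b u \<in> carrier_vec ?k"
    by (rule mult_mat_vec_carrier[OF A_carrier[OF u] coef_carrier])
  have "b u = ?B *\<^sub>v (Ah z u *\<^sub>v b u)"
    using assoc_mult_mat_vec[OF B A_carrier[OF u] coef_carrier]
      inv_mat_inverse(2)[OF A_carrier[OF u] det] coef_carrier[of u] by (metis one_mult_mat_vec)
  then have "bh z u $v j - b u $v j = (?B *\<^sub>v bvec G Y (emp z) (bh z) u) $v j - (?B *\<^sub>v (Ah z u *\<^sub>v b u)) $v j"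
    using beta_hat_rec[OF u] by metis
  also have "\<dots> = (\<Sum>i<?k. ?B $$ (j, i) * (bvec G Y (emp z) (bh z) u $v i - (Ah z u *\<^sub>v b u) $v i))"
    unfolding mult_mat_vec_index[OF B bvec_carrier[OF u] j] mult_mat_vec_index[OF B Ab j]
    by (simp only: sum_subtractf right_diff_distrib)
  also have "\<dots> = (\<Sum>i<?k. ?B $$ (j, i) *
      emp z (\<lambda>x. instr G (bh z) u (nth_elem (Y u) i) x * resid G b u x))"
  proof (rule sum.cong[OF refl])
    fix i assume "i \<in> {..<?k}"
    then have i: "i < ?k" by simp
    let ?Z = "instr G (bh z) u (nth_elem (Y u) i)"
    have "(\<lambda>x. ?Z x * resid G b u x) = (\<lambda>x. ?Z x * x $ u - (\<Sum>l<?k. b u $v l * (?Z x * x $ nth_elem (pa G u) l)))"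
      by (simp add: fun_eq_iff resid_def right_diff_distrib sum_distrib_left mult.left_commute)
    then have "emp z (\<lambda>x. ?Z x * resid G b u x) =
        emp z (\<lambda>x. ?Z x * x $ u) - (\<Sum>l<?k. b u $v l * emp z (\<lambda>x. ?Z x * x $ nth_elem (pa G u) l))"
      by (simp add: empirical_diff empirical_sum)
    moreover have "(Ah z u *\<^sub>v b u) $v i = (\<Sum>l<?k. b u $v l * emp z (\<lambda>x. ?Z x * x $ nth_elem (pa G u) l))"
      unfolding mult_mat_vec_index[OF A_carrier[OF u] coef_carrier i]
      using i card_Y[OF u] by (simp add: Amat_def mult.commute)
    moreover have "bvec G Y (emp z) (bh z) u $v i = emp z (\<lambda>x. ?Z x * x $ u)"
      using i card_Y[OF u] by (simp add: bvec_def)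
    ultimately show "?B $$ (j, i) * (bvec G Y (emp z) (bh z) u $v i - (Ah z u *\<^sub>v b u) $v i) =
        ?B $$ (j, i) * emp z (\<lambda>x. ?Z x * resid G b u x)" by simp
  qed
  finally show ?thesis .
qed

theorem asymptotically_linear:
  assumes "u \<in> W" "j < card (pa G u)"
  shows "((\<lambda>z. scaled_error u j z - scaled_mean (\<lambda>x. \<phi> u x $v j) z) \<longlongrightarrow> 0) (whp M)"
  using HTC_identified_wf[OF ident] assms
proof (induction u arbitrary: j rule: wf_induct_rule)
  case (less u)
  note u = \<open>u \<in> W\<close> and j = \<open>j < card (pa G u)\<close>
  let ?k = "card (pa G u)"
  let ?T = "\<lambda>i z. scaled_mean (\<lambda>x. instr G (bh z) u (nth_elem (Y u) i) x * resid G b u x) z"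
  let ?S = "\<lambda>i. scaled_mean (\<lambda>x. R u x $v i)"
  let ?B = "\<lambda>z. inv_mat (Ah z u)"
  let ?C = "inv_mat (A u)"
  have inv: "((\<lambda>z. ?B z $$ (j, i)) \<longlongrightarrow> ?C $$ (j, i)) (whp M)" if "i < ?k" for i
    using mat_consistentD(3)[OF mat_consistent_inv[OF Amat_consistent[OF u] A_det[OF u]] j that]
    by (simp add: consistent_def)
  \<comment> \<open>Splitting of \<open>?B * ?T - ?C * ?S\<close>: the first product vanishes with
    \<open>?T - ?S\<close>, the second is bounded in probability times the error of the
    inverse.\<close>
  have "((\<lambda>z. \<Sum>i<?k. ?B z $$ (j, i) * (?T i z - ?S i z) + ?S i z * (?B z $$ (j, i) - ?C $$ (j, i))) \<longlongrightarrow>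
      (\<Sum>i<?k. ?C $$ (j, i) * 0 + 0)) (whp M)"
  proof (intro tendsto_sum tendsto_add tendsto_mult)
    fix i assume "i \<in> {..<?k}"
    then have i: "i < ?k" by simp
    show "((\<lambda>z. ?B z $$ (j, i)) \<longlongrightarrow> ?C $$ (j, i)) (whp M)" by (rule inv[OF i])
    show "((\<lambda>z. ?T i z - ?S i z) \<longlongrightarrow> 0) (whp M)"
      by (rule scaled_instrument_expansion[OF u i less.IH])
    have "((\<lambda>z. ?B z $$ (j, i) - ?C $$ (j, i)) \<longlongrightarrow> 0) (whp M)"
      using tendsto_diff[OF inv[OF i] tendsto_const[of "?C $$ (j, i)"]] by simp
    then show "((\<lambda>z. ?S i z * (?B z $$ (j, i) - ?C $$ (j, i))) \<longlongrightarrow> 0) (whp M)"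
      by (rule bounded_in_prob_mult_null[OF bounded_in_prob_quadratic[OF quadratic_row[OF u i] row_mean_zero[OF u i]]])
  qed
  then have lim: "((\<lambda>z. \<Sum>i<?k. ?B z $$ (j, i) * (?T i z - ?S i z) + ?S i z * (?B z $$ (j, i) - ?C $$ (j, i))) \<longlongrightarrow> 0) (whp M)"
    by simp
  \<comment> \<open>The identity \<open>beta_hat_error\<close> is available with probability tending
    to one, which is all that a limit along \<open>whp M\<close> asks for.\<close>
  have "((\<lambda>z. Determinant.det (Ah z u)) \<longlongrightarrow> Determinant.det (A u)) (whp M)"
    using consistent_det[OF Amat_consistent[OF u]] by (simp add: consistent_def)
  then have "\<forall>\<^sub>F z in whp M. Determinant.det (Ah z u) \<noteq> 0"
    by (rule tendsto_imp_eventually_ne[OF _ A_det[OF u]])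
  then have ev: "\<forall>\<^sub>F z in whp M. (\<Sum>i<?k. ?B z $$ (j, i) * (?T i z - ?S i z) + ?S i z * (?B z $$ (j, i) - ?C $$ (j, i))) =
      scaled_error u j z - scaled_mean (\<lambda>x. \<phi> u x $v j) z"
  proof eventually_elim
    case (elim z)
    have "scaled_error u j z = (\<Sum>i<?k. ?B z $$ (j, i) * ?T i z)"
      unfolding beta_hat_error[OF u elim j] by (simp add: sum_distrib_left mult.left_commute)
    moreover have "scaled_mean (\<lambda>x. \<phi> u x $v j) z = (\<Sum>i<?k. ?C $$ (j, i) * ?S i z)"
      unfolding influence_index[OF u j] empirical_sum by (simp add: sum_distrib_left mult.left_commute)
    ultimately show ?case by (simp add: sum_subtractf[symmetric] algebra_simps)
  qed
  show ?case
    by (rule Lim_transform_eventually[OF lim ev])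
qed

end

section \<open>Perturbing the coefficient matrix\<close>

lemma fourth_moment_abs: "fourth_moment P f \<Longrightarrow> fourth_moment P (\<lambda>x. \<bar>f x\<bar>)"
  by (auto simp: fourth_moment_def power_even_abs)

lemma nth_elem_eq_iff:
  assumes "i < card A" "j < card A" shows "nth_elem A i = nth_elem A j \<longleftrightarrow> i = j"
proof -
  have l: "set (listing A) = A \<and> distinct (listing A)"
    unfolding listing_def by (rule someI_ex) (metis finite_distinct_list finite)
  then have "length (listing A) = card A" by (metis distinct_card)
  then show ?thesis using l assms by (simp add: nth_eq_iff_index_eq)
qed

text \<open>The perturbed solution satisfies the fixed point equation
  \<open>x = solution \<beta> e + \<gamma> *\<^sub>R K x\<close>. For
  \<open>\<bar>\<gamma>\<bar> < 1 / (2 * C)\<close> the last term is at most half of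
  \<open>x\<close> in norm; this one estimate gives invertibility and both bounds.\<close>

lemma perturbed_solution:
  fixes \<beta> h :: "real ^ 'v ^ 'v::finite"
  assumes \<beta>: "\<beta> \<in> coefficients G" and h: "\<And>w v. (w, v) \<notin> dir G \<Longrightarrow> h $ w $ v = 0"
  obtains C where "C > 0"
    "\<forall>\<^sub>F \<gamma> in nhds 0. \<beta> + \<gamma> *\<^sub>R h \<in> coefficients G \<and>
       (\<forall>e. norm (solution (\<beta> + \<gamma> *\<^sub>R h) e) \<le> 2 * norm (solution \<beta> e) \<and>
         norm (solution (\<beta> + \<gamma> *\<^sub>R h) e - solution \<beta> e) \<le> 2 * C * \<bar>\<gamma>\<bar> * norm (solution \<beta> e))"
proof -
  define K where "K = (\<lambda>x. solution \<beta> (transpose h *v x))"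
  have lin: "linear (solution \<beta>)" unfolding solution_def[abs_def] by (rule matrix_vector_mul_linear)
  have linK: "linear K"
    unfolding K_def using linear_compose[OF matrix_vector_mul_linear lin, of "transpose h"] by (simp add: comp_def)
  obtain C where C: "C > 0" "\<And>x. norm (K x) \<le> C * norm x"
    using linear_bounded_pos[OF linK] by blast
  have key: "x = solution \<beta> e + \<gamma> *\<^sub>R K x"
    if "transpose (Finite_Cartesian_Product.mat 1 - (\<beta> + \<gamma> *\<^sub>R h)) *v x = e" for \<gamma> x e
  proof -
    have "transpose (Finite_Cartesian_Product.mat 1 - \<beta>) *v x = e + \<gamma> *\<^sub>R (transpose h *v x)"
    proof (rule Finite_Cartesian_Product.vec_eq_iff[THEN iffD2], rule allI)
      fix v
      have "e $ v = x $ v - (\<Sum>w\<in>UNIV. (\<beta> + \<gamma> *\<^sub>R h) $ w $ v * x $ w)"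
        unfolding that[symmetric] by (rule transpose_mult_index)
      also have "\<dots> = x $ v - (\<Sum>w\<in>UNIV. \<beta> $ w $ v * x $ w) - \<gamma> * (\<Sum>w\<in>UNIV. h $ w $ v * x $ w)"
        by (simp add: distrib_right sum.distrib sum_distrib_left mult.assoc)
      finally show "(transpose (Finite_Cartesian_Product.mat 1 - \<beta>) *v x) $ v = (e + \<gamma> *\<^sub>R (transpose h *v x)) $ v"
        unfolding transpose_mult_index by (simp add: matrix_vector_mult_def Finite_Cartesian_Product.transpose_def)
    qed
    then have "x = solution \<beta> (e + \<gamma> *\<^sub>R (transpose h *v x))"
      by (rule solution_unique[OF \<beta>, symmetric])
    then show ?thesis by (simp add: K_def linear_add[OF lin] linear_cmul[OF lin])
  qed
  have half: "norm (\<gamma> *\<^sub>R K x) \<le> norm x / 2" if "\<bar>\<gamma>\<bar> < 1 / (2 * C)" for \<gamma> x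
  proof -
    have "norm (\<gamma> *\<^sub>R K x) \<le> \<bar>\<gamma>\<bar> * (C * norm x)" using C(2)[of x] by (simp add: mult_left_mono)
    also have "\<dots> \<le> 1 / (2 * C) * (C * norm x)" using that C(1) by (intro mult_right_mono) auto
    finally show ?thesis using C(1) by simp
  qed
  have main: "\<beta> + \<gamma> *\<^sub>R h \<in> coefficients G \<and>
       (\<forall>e. norm (solution (\<beta> + \<gamma> *\<^sub>R h) e) \<le> 2 * norm (solution \<beta> e) \<and>
         norm (solution (\<beta> + \<gamma> *\<^sub>R h) e - solution \<beta> e) \<le> 2 * C * \<bar>\<gamma>\<bar> * norm (solution \<beta> e))"
    if \<gamma>: "\<bar>\<gamma>\<bar> < 1 / (2 * C)" for \<gamma>
  proof
    have "x = 0" if "transpose (Finite_Cartesian_Product.mat 1 - (\<beta> + \<gamma> *\<^sub>R h)) *v x = 0" for x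
    proof -
      have "x = \<gamma> *\<^sub>R K x" using key[OF that] by (simp add: linear_0[OF lin])
      then have "norm x \<le> norm x / 2" using half[OF \<gamma>, of x] by metis
      then show ?thesis by simp
    qed
    then have "invertible (transpose (Finite_Cartesian_Product.mat 1 - (\<beta> + \<gamma> *\<^sub>R h)))"
      unfolding invertible_left_inverse matrix_left_invertible_ker by blast
    then have "det (Finite_Cartesian_Product.mat 1 - (\<beta> + \<gamma> *\<^sub>R h)) \<noteq> 0"
      by (simp add: invertible_det_nz)
    then show coef: "\<beta> + \<gamma> *\<^sub>R h \<in> coefficients G"
      using \<beta> h by (simp add: coefficients_def)
    show "\<forall>e. norm (solution (\<beta> + \<gamma> *\<^sub>R h) e) \<le> 2 * norm (solution \<beta> e) \<and>
         norm (solution (\<beta> + \<gamma> *\<^sub>R h) e - solution \<beta> e) \<le> 2 * C * \<bar>\<gamma>\<bar> * norm (solution \<beta> e)"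
    proof
      fix e
      let ?x = "solution (\<beta> + \<gamma> *\<^sub>R h) e"
      have x: "?x = solution \<beta> e + \<gamma> *\<^sub>R K ?x" by (rule key[OF solution_equation[OF coef]])
      have "norm ?x \<le> norm (solution \<beta> e) + norm (\<gamma> *\<^sub>R K ?x)"
        using norm_triangle_ineq[of "solution \<beta> e" "\<gamma> *\<^sub>R K ?x"] x by simp
      then have 1: "norm ?x \<le> 2 * norm (solution \<beta> e)" using half[OF \<gamma>, of ?x] by linarith
      have "?x - solution \<beta> e = \<gamma> *\<^sub>R K ?x" using x by (metis add_diff_cancel_left')
      then have "norm (?x - solution \<beta> e) = \<bar>\<gamma>\<bar> * norm (K ?x)" by simp
      also have "\<dots> \<le> \<bar>\<gamma>\<bar> * (C * (2 * norm (solution \<beta> e)))"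
        by (intro mult_left_mono order_trans[OF C(2)]) (use 1 C(1) in auto)
      finally have 2: "norm (?x - solution \<beta> e) \<le> 2 * C * \<bar>\<gamma>\<bar> * norm (solution \<beta> e)"
        by (simp add: mult_ac)
      show "norm ?x \<le> 2 * norm (solution \<beta> e) \<and>
         norm (?x - solution \<beta> e) \<le> 2 * C * \<bar>\<gamma>\<bar> * norm (solution \<beta> e)" using 1 2 by simp
    qed
  qed
  have "\<forall>\<^sub>F \<gamma> in nhds (0::real). \<bar>\<gamma>\<bar> < 1 / (2 * C)"
    using C(1) by (auto simp: eventually_nhds_metric dist_real_def intro!: exI[of _ "1 / (2 * C)"])
  then show thesis
    by (intro that[OF C(1)]) (rule eventually_mono[OF _ main])
qed

section \<open>Differentiability in quadratic mean forces a non-degenerate asymptotic variance\<close>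

context htc_sample begin

text \<open>Majorant, up to constants, of all coordinates and residuals along a path near 0; the
  summand 1 covers the constant monomial.\<close>

definition envelope :: "real ^ 'v \<Rightarrow> real" where
  "envelope e = 1 + (\<Sum>v\<in>UNIV. \<bar>solution \<beta> e $ v\<bar>)"

lemma envelope_ge: "1 \<le> envelope e" "norm (solution \<beta> e) \<le> envelope e"
  using norm_le_l1_cart[of "solution \<beta> e"] by (auto simp: envelope_def sum_nonneg)

lemma fourth_moment_envelope: "fourth_moment Q envelope"
proof -
  interpret prob_space Q by (rule Q_prob_space)
  show ?thesis
    unfolding envelope_def[abs_def]
    by (intro fourth_moment_add fourth_moment_const fourth_moment_sum fourth_moment_abs fourth_moment_solution[OF errors])
qed

text \<open>Linear growth near \<gamma> = 0 and Lipschitz dependence at it, with the envelope as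
  weight and uniformly in \<open>e\<close>. The product of two such families is integrable near
  0.\<close>

definition dominated_path :: "(real \<Rightarrow> real ^ 'v \<Rightarrow> real) \<Rightarrow> bool" where
  "dominated_path F \<longleftrightarrow> (\<forall>\<gamma>. F \<gamma> \<in> borel_measurable borel) \<and>
     (\<exists>c\<ge>0. \<forall>\<^sub>F \<gamma> in nhds 0. \<forall>e. \<bar>F \<gamma> e\<bar> \<le> c * envelope e \<and> \<bar>F \<gamma> e - F 0 e\<bar> \<le> c * \<bar>\<gamma>\<bar> * envelope e)"

lemma dominated_path_add:
  assumes F: "dominated_path F" and H: "dominated_path H"
  shows "dominated_path (\<lambda>\<gamma> e. F \<gamma> e + H \<gamma> e)"
proof -
  obtain c where c: "c \<ge> 0" "\<forall>\<^sub>F \<gamma> in nhds 0. \<forall>e. \<bar>F \<gamma> e\<bar> \<le> c * envelope e \<and> \<bar>F \<gamma> e - F 0 e\<bar> \<le> c * \<bar>\<gamma>\<bar> * envelope e"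
    using F unfolding dominated_path_def by blast
  obtain d where d: "d \<ge> 0" "\<forall>\<^sub>F \<gamma> in nhds 0. \<forall>e. \<bar>H \<gamma> e\<bar> \<le> d * envelope e \<and> \<bar>H \<gamma> e - H 0 e\<bar> \<le> d * \<bar>\<gamma>\<bar> * envelope e"
    using H unfolding dominated_path_def by blast
  have "\<forall>\<^sub>F \<gamma> in nhds 0. \<forall>e. \<bar>F \<gamma> e + H \<gamma> e\<bar> \<le> (c + d) * envelope e \<and>
      \<bar>(F \<gamma> e + H \<gamma> e) - (F 0 e + H 0 e)\<bar> \<le> (c + d) * \<bar>\<gamma>\<bar> * envelope e"
    using c(2) d(2)
  proof eventually_elim
    case (elim \<gamma>)
    show ?case
    proof
      fix e
      have "\<bar>F \<gamma> e + H \<gamma> e\<bar> \<le> c * envelope e + d * envelope e"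
        "\<bar>(F \<gamma> e + H \<gamma> e) - (F 0 e + H 0 e)\<bar> \<le> c * \<bar>\<gamma>\<bar> * envelope e + d * \<bar>\<gamma>\<bar> * envelope e"
        using elim[THEN spec, of e] by linarith+
      then show "\<bar>F \<gamma> e + H \<gamma> e\<bar> \<le> (c + d) * envelope e \<and>
          \<bar>(F \<gamma> e + H \<gamma> e) - (F 0 e + H 0 e)\<bar> \<le> (c + d) * \<bar>\<gamma>\<bar> * envelope e"
        by (simp add: distrib_right)
    qed
  qed
  moreover have "\<forall>\<gamma>. (\<lambda>e. F \<gamma> e + H \<gamma> e) \<in> borel_measurable borel"
    using F H by (auto simp: dominated_path_def intro: borel_measurable_add)
  ultimately show ?thesis
    unfolding dominated_path_def using c(1) d(1) by (intro conjI exI[of _ "c + d"]) auto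
qed

lemma dominated_path_scale:
  assumes F: "dominated_path F" shows "dominated_path (\<lambda>\<gamma> e. r * F \<gamma> e)"
proof -
  obtain c where c: "c \<ge> 0" "\<forall>\<^sub>F \<gamma> in nhds 0. \<forall>e. \<bar>F \<gamma> e\<bar> \<le> c * envelope e \<and> \<bar>F \<gamma> e - F 0 e\<bar> \<le> c * \<bar>\<gamma>\<bar> * envelope e"
    using F unfolding dominated_path_def by blast
  have "\<forall>\<^sub>F \<gamma> in nhds 0. \<forall>e. \<bar>r * F \<gamma> e\<bar> \<le> (\<bar>r\<bar> * c) * envelope e \<and>
      \<bar>r * F \<gamma> e - r * F 0 e\<bar> \<le> (\<bar>r\<bar> * c) * \<bar>\<gamma>\<bar> * envelope e"
    using c(2)
  proof eventually_elim
    case (elim \<gamma>)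
    show ?case
    proof
      fix e
      have "\<bar>r\<bar> * \<bar>F \<gamma> e\<bar> \<le> \<bar>r\<bar> * (c * envelope e)" "\<bar>r\<bar> * \<bar>F \<gamma> e - F 0 e\<bar> \<le> \<bar>r\<bar> * (c * \<bar>\<gamma>\<bar> * envelope e)"
        using elim[THEN spec, of e] by (auto intro: mult_left_mono)
      then show "\<bar>r * F \<gamma> e\<bar> \<le> (\<bar>r\<bar> * c) * envelope e \<and>
          \<bar>r * F \<gamma> e - r * F 0 e\<bar> \<le> (\<bar>r\<bar> * c) * \<bar>\<gamma>\<bar> * envelope e"
        by (simp add: abs_mult mult.assoc flip: right_diff_distrib)
    qed
  qed
  moreover have "\<forall>\<gamma>. (\<lambda>e. r * F \<gamma> e) \<in> borel_measurable borel"
    using F by (auto simp: dominated_path_def intro: borel_measurable_times)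
  ultimately show ?thesis
    unfolding dominated_path_def using c(1) by (intro conjI exI[of _ "\<bar>r\<bar> * c"]) auto
qed

lemma dominated_path_zero: "dominated_path (\<lambda>\<gamma> e. 0)"
  unfolding dominated_path_def by (intro conjI exI[of _ 0]) auto

lemma dominated_path_sum:
  "(\<And>i. i \<in> I \<Longrightarrow> dominated_path (F i)) \<Longrightarrow> dominated_path (\<lambda>\<gamma> e. \<Sum>i\<in>I. F i \<gamma> e)"
  by (induction I rule: infinite_finite_induct) (auto intro: dominated_path_zero dominated_path_add)

lemma dominated_path_diff:
  assumes "dominated_path F" "dominated_path H" shows "dominated_path (\<lambda>\<gamma> e. F \<gamma> e - H \<gamma> e)"
  using dominated_path_add[OF assms(1) dominated_path_scale[OF assms(2), of "- 1"]] by simp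

text \<open>The product rule \<open>(F \<gamma> e - F 0 e) * H \<gamma> e + F 0 e * (H \<gamma> e -
  H 0 e)\<close> bounds the difference of the integrals by a multiple of
  \<open>\<bar>\<gamma>\<bar>\<close>.\<close>

lemma tendsto_integral_dominated_paths:
  assumes F: "dominated_path F" and H: "dominated_path H"
  shows "((\<lambda>\<gamma>. \<integral>e. F \<gamma> e * H \<gamma> e \<partial>Q) \<longlongrightarrow> (\<integral>e. F 0 e * H 0 e \<partial>Q)) (at 0)"
proof -
  interpret prob_space Q by (rule Q_prob_space)
  obtain c where c: "c \<ge> 0" "\<forall>\<^sub>F \<gamma> in nhds 0. \<forall>e. \<bar>F \<gamma> e\<bar> \<le> c * envelope e \<and> \<bar>F \<gamma> e - F 0 e\<bar> \<le> c * \<bar>\<gamma>\<bar> * envelope e"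
    using F unfolding dominated_path_def by blast
  obtain d where d: "d \<ge> 0" "\<forall>\<^sub>F \<gamma> in nhds 0. \<forall>e. \<bar>H \<gamma> e\<bar> \<le> d * envelope e \<and> \<bar>H \<gamma> e - H 0 e\<bar> \<le> d * \<bar>\<gamma>\<bar> * envelope e"
    using H unfolding dominated_path_def by blast
  have meas [measurable]: "F \<gamma> \<in> borel_measurable Q" "H \<gamma> \<in> borel_measurable Q" for \<gamma>
    using F H unfolding dominated_path_def measurable_cong_sets[OF Q_sets refl] by auto
  have env: "integrable Q (\<lambda>e. (envelope e)\<^sup>2)"
    unfolding power2_eq_square by (rule integrable_mult2[OF fourth_moment_envelope fourth_moment_envelope])
  have prod: "\<bar>F \<gamma> e * H \<gamma> e\<bar> \<le> c * d * (envelope e)\<^sup>2"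
    if "\<bar>F \<gamma> e\<bar> \<le> c * envelope e" "\<bar>H \<gamma> e\<bar> \<le> d * envelope e" for \<gamma> e
  proof -
    have "\<bar>F \<gamma> e * H \<gamma> e\<bar> \<le> (c * envelope e) * (d * envelope e)"
      unfolding abs_mult using that by (intro mult_mono) auto
    then show ?thesis by (simp add: power2_eq_square mult_ac)
  qed
  have int: "integrable Q (\<lambda>e. F \<gamma> e * H \<gamma> e)"
    if "\<forall>e. \<bar>F \<gamma> e\<bar> \<le> c * envelope e" "\<forall>e. \<bar>H \<gamma> e\<bar> \<le> d * envelope e" for \<gamma>
  proof (rule Bochner_Integration.integrable_bound)
    show "integrable Q (\<lambda>e. c * d * (envelope e)\<^sup>2)" using env by simp
    show "AE e in Q. norm (F \<gamma> e * H \<gamma> e) \<le> norm (c * d * (envelope e)\<^sup>2)"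
    proof (rule AE_I2)
      fix e
      show "norm (F \<gamma> e * H \<gamma> e) \<le> norm (c * d * (envelope e)\<^sup>2)"
        using prod[of \<gamma> e] that abs_ge_self[of "c * d * (envelope e)\<^sup>2"] unfolding real_norm_def by fastforce
    qed
  qed measurable
  have int0: "integrable Q (\<lambda>e. F 0 e * H 0 e)"
    using eventually_nhds_x_imp_x[OF c(2)] eventually_nhds_x_imp_x[OF d(2)] by (intro int) auto
  have F0: "\<bar>F 0 e\<bar> \<le> c * envelope e" for e using eventually_nhds_x_imp_x[OF c(2)] by auto
  have "\<forall>\<^sub>F \<gamma> in nhds 0. \<bar>(\<integral>e. F \<gamma> e * H \<gamma> e \<partial>Q) - (\<integral>e. F 0 e * H 0 e \<partial>Q)\<bar> \<le>
      \<bar>\<gamma>\<bar> * (2 * c * d * (\<integral>e. (envelope e)\<^sup>2 \<partial>Q))"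
    using c(2) d(2)
  proof eventually_elim
    case (elim \<gamma>)
    have pt: "\<bar>F \<gamma> e * H \<gamma> e - F 0 e * H 0 e\<bar> \<le> \<bar>\<gamma>\<bar> * (2 * c * d) * (envelope e)\<^sup>2" for e
    proof -
      have "\<bar>F \<gamma> e * H \<gamma> e - F 0 e * H 0 e\<bar> = \<bar>(F \<gamma> e - F 0 e) * H \<gamma> e + F 0 e * (H \<gamma> e - H 0 e)\<bar>"
        by (simp add: algebra_simps)
      also have "\<dots> \<le> \<bar>F \<gamma> e - F 0 e\<bar> * \<bar>H \<gamma> e\<bar> + \<bar>F 0 e\<bar> * \<bar>H \<gamma> e - H 0 e\<bar>"
        by (metis abs_triangle_ineq abs_mult)
      also have "\<dots> \<le> (c * \<bar>\<gamma>\<bar> * envelope e) * (d * envelope e) + (c * envelope e) * (d * \<bar>\<gamma>\<bar> * envelope e)"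
        using elim(1)[THEN spec, of e] elim(2)[THEN spec, of e] F0[of e]
        by (intro add_mono mult_mono) auto
      finally show ?thesis by (simp add: power2_eq_square algebra_simps)
    qed
    have "\<bar>(\<integral>e. F \<gamma> e * H \<gamma> e \<partial>Q) - (\<integral>e. F 0 e * H 0 e \<partial>Q)\<bar> = \<bar>\<integral>e. F \<gamma> e * H \<gamma> e - F 0 e * H 0 e \<partial>Q\<bar>"
      using int[of \<gamma>] int0 elim by simp
    also have "\<dots> \<le> (\<integral>e. \<bar>F \<gamma> e * H \<gamma> e - F 0 e * H 0 e\<bar> \<partial>Q)" by (rule integral_abs_bound)
    also have "\<dots> \<le> (\<integral>e. \<bar>\<gamma>\<bar> * (2 * c * d) * (envelope e)\<^sup>2 \<partial>Q)"
      using int[of \<gamma>] int0 elim env pt by (intro integral_mono) auto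
    finally show ?case by (simp add: mult.assoc)
  qed
  then have "\<forall>\<^sub>F \<gamma> in at 0. norm ((\<integral>e. F \<gamma> e * H \<gamma> e \<partial>Q) - (\<integral>e. F 0 e * H 0 e \<partial>Q)) \<le>
      \<bar>\<gamma>\<bar> * (2 * c * d * (\<integral>e. (envelope e)\<^sup>2 \<partial>Q))"
    by (auto simp: eventually_at_filter elim: eventually_mono)
  moreover have "((\<lambda>\<gamma>::real. \<bar>\<gamma>\<bar> * (2 * c * d * (\<integral>e. (envelope e)\<^sup>2 \<partial>Q))) \<longlongrightarrow> 0) (at 0)"
    by (auto intro!: tendsto_eq_intros)
  ultimately have "((\<lambda>\<gamma>. (\<integral>e. F \<gamma> e * H \<gamma> e \<partial>Q) - (\<integral>e. F 0 e * H 0 e \<partial>Q)) \<longlongrightarrow> 0) (at 0)"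
    by (rule Lim_null_comparison)
  then show ?thesis by (simp add: LIM_zero_iff)
qed

lemma dominated_path_solution:
  assumes h: "\<And>w v. (w, v) \<notin> dir G \<Longrightarrow> h $ w $ v = 0"
  shows "dominated_path (\<lambda>\<gamma> e. solution (\<beta> + \<gamma> *\<^sub>R h) e $ v)"
proof -
  obtain C where C: "C > 0" "\<forall>\<^sub>F \<gamma> in nhds 0. \<beta> + \<gamma> *\<^sub>R h \<in> coefficients G \<and>
       (\<forall>e. norm (solution (\<beta> + \<gamma> *\<^sub>R h) e) \<le> 2 * norm (solution \<beta> e) \<and>
         norm (solution (\<beta> + \<gamma> *\<^sub>R h) e - solution \<beta> e) \<le> 2 * C * \<bar>\<gamma>\<bar> * norm (solution \<beta> e))"
    using perturbed_solution[OF coef h] by blast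
  define c where "c = 2 + 2 * C"
  have "\<forall>\<^sub>F \<gamma> in nhds 0. \<forall>e. \<bar>solution (\<beta> + \<gamma> *\<^sub>R h) e $ v\<bar> \<le> c * envelope e \<and>
      \<bar>solution (\<beta> + \<gamma> *\<^sub>R h) e $ v - solution (\<beta> + 0 *\<^sub>R h) e $ v\<bar> \<le> c * \<bar>\<gamma>\<bar> * envelope e"
    using C(2)
  proof eventually_elim
    case (elim \<gamma>)
    have "\<bar>solution (\<beta> + \<gamma> *\<^sub>R h) e $ v\<bar> \<le> c * envelope e \<and>
        \<bar>solution (\<beta> + \<gamma> *\<^sub>R h) e $ v - solution \<beta> e $ v\<bar> \<le> c * \<bar>\<gamma>\<bar> * envelope e" for e
    proof -
      let ?x = "solution (\<beta> + \<gamma> *\<^sub>R h) e" and ?s = "solution \<beta> e"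
      have "\<bar>?x $ v\<bar> \<le> norm ?x" by (rule component_le_norm_cart)
      also have "\<dots> \<le> 2 * norm ?s" using elim by simp
      also have "\<dots> \<le> c * envelope e"
        using C(1) envelope_ge(2)[of e] by (intro mult_mono) (auto simp: c_def)
      finally have 1: "\<bar>?x $ v\<bar> \<le> c * envelope e" .
      have "\<bar>?x $ v - ?s $ v\<bar> \<le> norm (?x - ?s)"
        using component_le_norm_cart[of "?x - ?s" v] by simp
      also have "\<dots> \<le> 2 * C * \<bar>\<gamma>\<bar> * norm ?s" using elim by blast
      also have "\<dots> \<le> c * \<bar>\<gamma>\<bar> * envelope e"
        using C(1) envelope_ge(2)[of e] by (intro mult_mono) (auto simp: c_def)
      finally show ?thesis using 1 by simp
    qed
    then show ?case by simp
  qed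
  moreover have "\<forall>\<gamma>. (\<lambda>e. solution (\<beta> + \<gamma> *\<^sub>R h) e $ v) \<in> borel_measurable borel"
    by (intro allI, rule measurable_compose[OF solution_measurable]) simp
  ultimately show ?thesis
    unfolding dominated_path_def using C(1) by (intro conjI exI[of _ c]) (auto simp: c_def)
qed

lemma dominated_path_resid:
  assumes h: "\<And>w v. (w, v) \<notin> dir G \<Longrightarrow> h $ w $ v = 0"
  shows "dominated_path (\<lambda>\<gamma> e. resid G b u (solution (\<beta> + \<gamma> *\<^sub>R h) e))"
  unfolding resid_def
  by (intro dominated_path_diff dominated_path_sum dominated_path_scale dominated_path_solution h)

text \<open>In the zero direction the residual is the error itself, so the errors are dominated by
  the envelope although that is built from the solution.\<close>

lemma dominated_path_error: "dominated_path (\<lambda>\<gamma> e. e $ u)"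
  using dominated_path_resid[of 0 u] by (simp add: resid_solution[OF coef])


text \<open>Here \<gamma> is an arbitrary coefficient matrix, not a step length; integrability rests
  on the fourth moments of \<open>Q\<close>.\<close>

lemma quadratic_integrable_law: "quadratic F f \<Longrightarrow> integrable (model_law \<gamma> Q) f"
proof -
  assume "quadratic F f"
  then obtain c where c: "f = (\<lambda>x. \<Sum>p\<in>UNIV. c p * monomial2 p x)"
    unfolding span_consistent_def by (auto simp: fun_eq_iff)
  interpret prob_space "model_law \<gamma> Q"
    unfolding model_law_solution by (rule prob_space.prob_space_distr[OF Q_prob_space solution_measurable_Q])
  have "integrable (model_law \<gamma> Q) (monomial2 p)" for p
    by (cases p) (simp add: integrable_mult2 fourth_moment_monomial[OF errors])
  then show ?thesis unfolding c by simp
qed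

lemma law_prob_space: "prob_space (model_law \<gamma> Q)" and law_sets: "sets (model_law \<gamma> Q) = sets borel"
  unfolding model_law_solution by (rule prob_space.prob_space_distr[OF Q_prob_space solution_measurable_Q]) simp

section \<open>Derivatives of expectations along a path\<close>

context
  fixes h :: "real ^ 'v ^ 'v"
  assumes h: "\<And>w v. (w, v) \<notin> dir G \<Longrightarrow> h $ w $ v = 0"
begin

text \<open>The law of the errors stays \<open>Q\<close>, so all expectations along the path are
  integrals over one fixed space.\<close>

abbreviation path where "path \<gamma> \<equiv> \<beta> + \<gamma> *\<^sub>R h"

lemma path_coefficients: "\<forall>\<^sub>F \<gamma> in nhds 0. path \<gamma> \<in> coefficients G"
  using perturbed_solution[OF coef h] by (metis (mono_tags, lifting) eventually_mono)

lemma quadratic_second_moment_bounded: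
  assumes f: "quadratic F f"
  obtains K where "K \<ge> 0" "\<forall>\<^sub>F \<gamma> in nhds 0. integrable (model_law (path \<gamma>) Q) (\<lambda>x. (f x)\<^sup>2) \<and>
    (\<integral>x. (f x)\<^sup>2 \<partial>model_law (path \<gamma>) Q) \<le> K"
proof -
  obtain c where c: "\<And>x. f x = (\<Sum>p\<in>UNIV. c p * monomial2 p x)"
    using f unfolding span_consistent_def by auto
  obtain C where C: "\<forall>\<^sub>F \<gamma> in nhds 0. path \<gamma> \<in> coefficients G \<and>
       (\<forall>e. norm (solution (path \<gamma>) e) \<le> 2 * norm (solution \<beta> e) \<and>
         norm (solution (path \<gamma>) e - solution \<beta> e) \<le> 2 * C * \<bar>\<gamma>\<bar> * norm (solution \<beta> e))"
    using perturbed_solution[OF coef h] by blast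
  \<comment> \<open>Each factor of a monomial is at most \<open>2 * envelope e\<close> in absolute
    value, hence the 4 for each product.\<close>
  define \<kappa> where "\<kappa> = (\<Sum>p\<in>UNIV. \<bar>c p\<bar> * 4)"
  have env: "integrable Q (\<lambda>e. \<kappa>\<^sup>2 * (envelope e) ^ 4)"
    using fourth_moment_envelope by (simp add: fourth_moment_def)
  have [measurable]: "f \<in> borel_measurable borel" by (rule quadratic_measurable[OF f])
  have bound: "(f (solution (path \<gamma>) e))\<^sup>2 \<le> \<kappa>\<^sup>2 * (envelope e) ^ 4"
    if "norm (solution (path \<gamma>) e) \<le> 2 * norm (solution \<beta> e)" for \<gamma> e
  proof -
    let ?x = "solution (path \<gamma>) e"
    have mono: "\<bar>monomial a ?x\<bar> \<le> 2 * envelope e" for a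
    proof (cases a)
      case None
      then show ?thesis using envelope_ge(1)[of e] by (simp add: monomial_def)
    next
      case (Some v)
      have "\<bar>?x $ v\<bar> \<le> norm ?x" by (rule component_le_norm_cart)
      then show ?thesis using Some that envelope_ge(2)[of e] by (simp add: monomial_def)
    qed
    have "\<bar>monomial2 p ?x\<bar> \<le> 4 * (envelope e)\<^sup>2" for p
    proof (cases p)
      case (Pair a d)
      have "\<bar>monomial a ?x * monomial d ?x\<bar> \<le> (2 * envelope e) * (2 * envelope e)"
        unfolding abs_mult using mono envelope_ge(1)[of e] by (intro mult_mono) auto
      then show ?thesis using Pair by (simp add: power2_eq_square)
    qed
    then have "\<bar>f ?x\<bar> \<le> (\<Sum>p\<in>UNIV. \<bar>c p\<bar> * (4 * (envelope e)\<^sup>2))"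
      unfolding c by (intro order_trans[OF sum_abs] sum_mono) (simp add: abs_mult mult_left_mono)
    also have "\<dots> = \<kappa> * (envelope e)\<^sup>2" by (simp add: \<kappa>_def sum_distrib_right mult.assoc)
    finally have "\<bar>f ?x\<bar>\<^sup>2 \<le> (\<kappa> * (envelope e)\<^sup>2)\<^sup>2" by (intro power_mono) auto
    then show ?thesis by (simp add: power_mult_distrib)
  qed
  have main: "integrable (model_law (path \<gamma>) Q) (\<lambda>x. (f x)\<^sup>2) \<and>
      (\<integral>x. (f x)\<^sup>2 \<partial>model_law (path \<gamma>) Q) \<le> (\<integral>e. \<kappa>\<^sup>2 * (envelope e) ^ 4 \<partial>Q)"
    if "\<forall>e. norm (solution (path \<gamma>) e) \<le> 2 * norm (solution \<beta> e)" for \<gamma>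
  proof -
    have [measurable]: "solution (path \<gamma>) \<in> measurable Q borel" by (rule solution_measurable_Q)
    have int: "integrable Q (\<lambda>e. (f (solution (path \<gamma>) e))\<^sup>2)"
      by (rule Bochner_Integration.integrable_bound[OF env]) (use bound that in auto)
    then have "(\<integral>e. (f (solution (path \<gamma>) e))\<^sup>2 \<partial>Q) \<le> (\<integral>e. \<kappa>\<^sup>2 * (envelope e) ^ 4 \<partial>Q)"
      using env bound that by (intro integral_mono) auto
    then show ?thesis
      using int by (simp add: integral_P) (simp add: model_law_solution integrable_distr_eq)
  qed
  show thesis
  proof (rule that)
    show "0 \<le> (\<integral>e. \<kappa>\<^sup>2 * (envelope e) ^ 4 \<partial>Q)" by simp
    show "\<forall>\<^sub>F \<gamma> in nhds 0. integrable (model_law (path \<gamma>) Q) (\<lambda>x. (f x)\<^sup>2) \<and>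
        (\<integral>x. (f x)\<^sup>2 \<partial>model_law (path \<gamma>) Q) \<le> (\<integral>e. \<kappa>\<^sup>2 * (envelope e) ^ 4 \<partial>Q)"
      using C by (rule eventually_mono) (use main in blast)
  qed
qed

text \<open>Differentiability in quadratic mean makes the mass that the path puts on a null set \<open>o(\<gamma>\<^sup>2)\<close>.\<close>

lemma null_function_derivative:
  assumes f: "quadratic F f" and null: "AE x in P. f x = 0"
  shows "((\<lambda>\<gamma>. (\<integral>x. f x \<partial>model_law (path \<gamma>) Q) / \<gamma>) \<longlongrightarrow> 0) (at 0)"
proof -
  define N where "N = {x. f x \<noteq> 0}"
  have [measurable]: "f \<in> borel_measurable borel" by (rule quadratic_measurable[OF f])
  have N [measurable]: "N \<in> sets borel" unfolding N_def by measurable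
  have "dqm (\<lambda>\<gamma>. model_law (path \<gamma>) Q)"
  proof -
    have "parametric_path G (\<lambda>\<gamma>. model_law (path \<gamma>) Q)"
      unfolding parametric_path_def
    proof (intro exI conjI)
      show "\<forall>\<^sub>F \<gamma> in nhds 0. path \<gamma> \<in> coefficients G \<and> Q \<in> error_laws G \<and>
          model_law (path \<gamma>) Q = model_law (path \<gamma>) Q"
        using path_coefficients errors by (simp add: eventually_mono)
      show "path differentiable (at 0)" by (intro derivative_intros)
      show "dqm (\<lambda>\<gamma>. Q)" by (rule dqm_const[OF Q_prob_space])
    qed
    then show ?thesis
      using regular unfolding regular_parameter_def Hellinger_differentiable_def by auto
  qed
  moreover have "measure (model_law (path 0) Q) N = 0"
  proof -
    have "AE x in P. x \<notin> N" using null by (simp add: N_def)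
    then have "N \<in> null_sets P" using AE_iff_null_sets[of N P] N P_sets by blast
    then show ?thesis by (simp add: measure_def null_setsD1)
  qed
  ultimately have lim: "((\<lambda>\<gamma>. measure (model_law (path \<gamma>) Q) N / \<gamma>\<^sup>2) \<longlongrightarrow> 0) (at 0)"
    by (intro dqm_null_set law_prob_space) (use N law_sets in auto)
  obtain K where K: "K \<ge> 0" "\<forall>\<^sub>F \<gamma> in nhds 0. integrable (model_law (path \<gamma>) Q) (\<lambda>x. (f x)\<^sup>2) \<and>
    (\<integral>x. (f x)\<^sup>2 \<partial>model_law (path \<gamma>) Q) \<le> K"
    using quadratic_second_moment_bounded[OF f] by blast
  have K': "\<forall>\<^sub>F \<gamma> in at 0. integrable (model_law (path \<gamma>) Q) (\<lambda>x. (f x)\<^sup>2) \<and>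
    (\<integral>x. (f x)\<^sup>2 \<partial>model_law (path \<gamma>) Q) \<le> K"
    using K(2) by (auto simp: eventually_at_filter elim: eventually_mono)
  show ?thesis
  proof (rule tendstoI)
    fix \<epsilon> :: real assume \<epsilon>: "\<epsilon> > 0"
    \<comment> \<open>Chosen so that \<open>\<eta> * K < \<epsilon> / 2\<close>, with
      \<open>+ 1\<close> for the case \<open>K = 0\<close>.\<close>
    define \<eta> where "\<eta> = \<epsilon> / (2 * (K + 1))"
    have \<eta>: "\<eta> > 0" using \<epsilon> K(1) by (simp add: \<eta>_def)
    have "\<eta> * K < \<epsilon> / 2" using \<epsilon> K(1) by (simp add: \<eta>_def field_simps)
    have "\<forall>\<^sub>F \<gamma> in at 0. measure (model_law (path \<gamma>) Q) N / \<gamma>\<^sup>2 < \<eta> * (\<epsilon> / 2)"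
      using order_tendstoD(2)[OF lim, of "\<eta> * (\<epsilon> / 2)"] \<eta> \<epsilon> by simp
    moreover have "\<forall>\<^sub>F \<gamma> in at (0::real). \<gamma> \<noteq> 0" by (simp add: eventually_at_filter)
    ultimately show "\<forall>\<^sub>F \<gamma> in at 0. dist ((\<integral>x. f x \<partial>model_law (path \<gamma>) Q) / \<gamma>) 0 < \<epsilon>"
      using K'
    proof eventually_elim
      case (elim \<gamma>)
      let ?L = "model_law (path \<gamma>) Q"
      interpret L: prob_space ?L by (rule law_prob_space)
      have pos: "\<bar>\<gamma>\<bar> * \<eta> > 0" using elim \<eta> by simp
      \<comment> \<open>With \<open>s = \<bar>\<gamma>\<bar> * \<eta>\<close> and
        \<open>t = \<bar>f x\<bar>\<close> this is \<open>t \<le> s * t\<^sup>2 + 1 / s\<close>.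
        After division by \<open>\<bar>\<gamma>\<bar>\<close>, the bounded second moment costs at
        most \<open>\<eta> * K\<close> and the mass of \<open>N\<close> enters through its ratio to
        \<gamma>^2, which is why the rate o(\<gamma>^2) is the right one.\<close>
      have pt: "\<bar>f x\<bar> \<le> (\<bar>\<gamma>\<bar> * \<eta>) * (f x)\<^sup>2 + indicator N x / (\<bar>\<gamma>\<bar> * \<eta>)" for x
      proof (cases "f x = 0")
        case True
        then show ?thesis by (simp add: N_def)
      next
        case False
        define s t where "s = \<bar>\<gamma>\<bar> * \<eta>" and "t = \<bar>f x\<bar>"
        have "0 \<le> (s * t - 1)\<^sup>2 + s * t" using pos by (simp add: s_def t_def)
        then have "s * t \<le> s\<^sup>2 * t\<^sup>2 + 1" by (simp add: power2_eq_square algebra_simps)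
        moreover have "s > 0" using pos by (simp add: s_def)
        ultimately have "t \<le> s * t\<^sup>2 + 1 / s" by (simp add: field_simps power2_eq_square)
        then show ?thesis using False by (simp add: N_def s_def t_def)
      qed
      have ind: "integrable ?L (indicator N :: _ \<Rightarrow> real)"
        by (rule integrable_real_indicator) (use N law_sets in \<open>auto simp: L.emeasure_eq_measure\<close>)
      have fi: "integrable ?L f" by (rule quadratic_integrable_law[OF f])
      have "\<bar>\<integral>x. f x \<partial>?L\<bar> \<le> (\<integral>x. \<bar>f x\<bar> \<partial>?L)" by (rule integral_abs_bound)
      also have "\<dots> \<le> (\<integral>x. (\<bar>\<gamma>\<bar> * \<eta>) * (f x)\<^sup>2 + indicator N x / (\<bar>\<gamma>\<bar> * \<eta>) \<partial>?L)"
        using fi ind elim pt by (intro integral_mono) auto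
      also have "\<dots> = (\<bar>\<gamma>\<bar> * \<eta>) * (\<integral>x. (f x)\<^sup>2 \<partial>?L) + measure ?L N / (\<bar>\<gamma>\<bar> * \<eta>)"
        using ind elim N law_sets by (simp add: law_sets)
      also have "\<dots> \<le> (\<bar>\<gamma>\<bar> * \<eta>) * K + measure ?L N / (\<bar>\<gamma>\<bar> * \<eta>)"
        using elim pos by (intro add_right_mono mult_left_mono) auto
      finally have "\<bar>\<integral>x. f x \<partial>?L\<bar> / \<bar>\<gamma>\<bar> \<le> ((\<bar>\<gamma>\<bar> * \<eta>) * K + measure ?L N / (\<bar>\<gamma>\<bar> * \<eta>)) / \<bar>\<gamma>\<bar>"
        by (rule divide_right_mono) simp
      also have "\<dots> = \<eta> * K + (measure ?L N / \<gamma>\<^sup>2) / \<eta>"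
        using elim \<eta> by (simp add: field_simps power2_eq_square)
      also have "\<dots> < \<epsilon> / 2 + \<epsilon> / 2"
      proof (rule add_strict_mono)
        show "\<eta> * K < \<epsilon> / 2" by fact
        show "(measure ?L N / \<gamma>\<^sup>2) / \<eta> < \<epsilon> / 2"
          using elim \<eta> by (simp add: divide_less_eq mult.commute)
      qed
      finally show ?case by (simp add: abs_divide)
    qed
  qed
qed

text \<open>Increment of the residual of \<open>u\<close>, taken at the unperturbed coefficients,
  per unit of \<gamma>. It depends on \<gamma> itself, so that no remainder term appears.\<close>

abbreviation drift where "drift u \<gamma> e \<equiv> (\<Sum>w\<in>UNIV. h $ w $ u * solution (path \<gamma>) e $ w)"

lemma dominated_path_drift: "dominated_path (drift u)"
  by (intro dominated_path_sum dominated_path_scale dominated_path_solution h)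

lemma fourth_moment_drift: "fourth_moment Q (drift u \<gamma>)"
proof -
  interpret prob_space Q by (rule Q_prob_space)
  show ?thesis by (intro fourth_moment_sum fourth_moment_scale fourth_moment_solution[OF errors])
qed

lemma resid_path:
  assumes "path \<gamma> \<in> coefficients G"
  shows "resid G b u (solution (path \<gamma>) e) = e $ u + \<gamma> * drift u \<gamma> e"
proof -
  let ?x = "solution (path \<gamma>) e"
  have "e $ u = ?x $ u - (\<Sum>w\<in>UNIV. path \<gamma> $ w $ u * ?x $ w)"
    using resid_solution[OF assms] resid_coef[OF assms] by metis
  moreover have "(\<Sum>w\<in>UNIV. path \<gamma> $ w $ u * ?x $ w) = (\<Sum>w\<in>UNIV. \<beta> $ w $ u * ?x $ w) + \<gamma> * drift u \<gamma> e"
    by (simp add: distrib_right sum.distrib sum_distrib_left mult.assoc)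
  ultimately show ?thesis unfolding resid_coef[OF coef] by simp
qed

lemma sum_parents:
  "(\<Sum>j<card (pa G u). f (nth_elem (pa G u) j) * h $ nth_elem (pa G u) j $ u) = (\<Sum>w\<in>UNIV. f w * h $ w $ u)"
proof -
  have "(\<Sum>j<card (pa G u). f (nth_elem (pa G u) j) * h $ nth_elem (pa G u) j $ u) = (\<Sum>w\<in>pa G u. f w * h $ w $ u)"
    by (rule sum_nth_elem[of "\<lambda>w. f w * h $ w $ u"])
  also have "\<dots> = (\<Sum>w\<in>UNIV. f w * h $ w $ u)"
    using h by (intro sum.mono_neutral_left) (auto simp: pa_def)
  finally show ?thesis .
qed

lemma sum_parents_drift:
  assumes "fourth_moment Q F"
  shows "(\<Sum>j<card (pa G u). (\<integral>e. F e * solution \<beta> e $ nth_elem (pa G u) j \<partial>Q) * h $ nth_elem (pa G u) j $ u) =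
    (\<integral>e. F e * drift u 0 e \<partial>Q)"
proof -
  interpret prob_space Q by (rule Q_prob_space)
  have int: "integrable Q (\<lambda>e. F e * solution \<beta> e $ w)" for w
    by (intro integrable_mult2 assms fourth_moment_solution[OF errors])
  have "(\<integral>e. F e * drift u 0 e \<partial>Q) = (\<integral>e. (\<Sum>w\<in>UNIV. (F e * solution \<beta> e $ w) * h $ w $ u) \<partial>Q)"
    by (simp add: sum_distrib_left mult_ac)
  also have "\<dots> = (\<Sum>w\<in>UNIV. (\<integral>e. F e * solution \<beta> e $ w \<partial>Q) * h $ w $ u)"
    using int by (simp add: Bochner_Integration.integral_sum)
  finally show ?thesis
    using sum_parents[of "\<lambda>w. \<integral>e. F e * solution \<beta> e $ w \<partial>Q" u] by simp
qed

text \<open>For a residual instrument the product of two residuals contributes two derivatives. The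
  one from the residual of \<open>u\<close> is the wanted entry of \<open>A\<close> applied to the
  direction; the one from the instrument is cancelled by the correction terms, whose derivatives are
  known from \<open>IH\<close>.\<close>

lemma row_derivative_if:
  assumes u: "u \<in> W" and i: "i < card (pa G u)"
    and IH: "\<And>y j. (y, u) \<in> prec \<Longrightarrow> y \<in> W \<Longrightarrow> j < card (pa G y) \<Longrightarrow>
      ((\<lambda>\<gamma>. (\<integral>x. \<phi> y x $v j \<partial>model_law (path \<gamma>) Q) / \<gamma>) \<longlongrightarrow> h $ nth_elem (pa G y) j $ y) (at 0)"
  shows "((\<lambda>\<gamma>. (\<integral>x. R u x $v i \<partial>model_law (path \<gamma>) Q) / \<gamma>) \<longlongrightarrow>
    (\<Sum>j<card (pa G u). A u $$ (i, j) * h $ nth_elem (pa G u) j $ u)) (at 0)"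
proof -
  interpret prob_space Q by (rule Q_prob_space)
  let ?y = "nth_elem (Y u) i"
  have y_sib: "?y \<notin> {u} \<union> sib G u" by (rule Y_sib[OF u nth_Y[OF u i]])
  have fe: "fourth_moment Q (\<lambda>e. e $ v)" for v by (rule fourth_moment_error[OF errors])
  have fs: "fourth_moment Q (\<lambda>e. solution \<gamma> e $ v)" for \<gamma> v by (rule fourth_moment_solution[OF errors])
  have Aij: "A u $$ (i, j) = (\<integral>e. instr G b u ?y (solution \<beta> e) * solution \<beta> e $ nth_elem (pa G u) j \<partial>Q)"
    if "j < card (pa G u)" for j
    using that i card_Y[OF u] by (simp add: Amat_def expect_under_def integral_P)
  have nz: "\<forall>\<^sub>F \<gamma> in at 0. path \<gamma> \<in> coefficients G \<and> \<gamma> \<noteq> 0"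
    using path_coefficients by (auto simp: eventually_at_filter elim: eventually_mono)
  show ?thesis
  proof (cases "?y \<in> htr G u")
    case False
    have "((\<lambda>\<gamma>. \<integral>e. solution (path \<gamma>) e $ ?y * drift u \<gamma> e \<partial>Q) \<longlongrightarrow>
        (\<integral>e. solution (path 0) e $ ?y * drift u 0 e \<partial>Q)) (at 0)"
      by (rule tendsto_integral_dominated_paths[OF dominated_path_solution[OF h] dominated_path_drift])
    also have "(\<integral>e. solution (path 0) e $ ?y * drift u 0 e \<partial>Q) =
        (\<Sum>j<card (pa G u). A u $$ (i, j) * h $ nth_elem (pa G u) j $ u)"
      using sum_parents_drift[OF fs[of \<beta> ?y], of u] False by (simp add: Aij instr_def)
    finally show ?thesis
    proof (rule Lim_transform_eventually)
      show "\<forall>\<^sub>F \<gamma> in at 0. (\<integral>e. solution (path \<gamma>) e $ ?y * drift u \<gamma> e \<partial>Q) =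
          (\<integral>x. R u x $v i \<partial>model_law (path \<gamma>) Q) / \<gamma>"
        using nz
      proof eventually_elim
        case (elim \<gamma>)
        have "(\<integral>x. R u x $v i \<partial>model_law (path \<gamma>) Q) =
            (\<integral>e. solution (path \<gamma>) e $ ?y * e $ u + \<gamma> * (solution (path \<gamma>) e $ ?y * drift u \<gamma> e) \<partial>Q)"
          using False elim
          by (simp add: row_index[OF u i] integral_P resid_path distrib_left mult.left_commute)
        also have "\<dots> = (\<integral>e. solution (path \<gamma>) e $ ?y * e $ u \<partial>Q) +
            \<gamma> * (\<integral>e. solution (path \<gamma>) e $ ?y * drift u \<gamma> e \<partial>Q)"
          using integrable_mult2[OF fs fe] integrable_mult2[OF fs fourth_moment_drift] by simp
        \<comment> \<open>Half-trek reachability does not depend on the coefficients, so the zero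
          correlation persists at the perturbed matrix.\<close>
        also have "(\<integral>e. solution (path \<gamma>) e $ ?y * e $ u \<partial>Q) = 0"
          by (rule solution_error_uncorrelated[OF _ errors y_sib False]) (use elim in simp)
        finally show ?case using elim by simp
      qed
    qed
  next
    case True
    have y: "(?y, u) \<in> prec" "?y \<in> W" using Y_htr[OF u nth_Y[OF u i] True] by auto
    let ?k = "card (pa G ?y)"
    let ?E = "\<lambda>j. E (\<lambda>x. x $ nth_elem (pa G ?y) j * resid G b u x)"
    let ?r = "\<lambda>\<gamma> e. resid G b u (solution (path \<gamma>) e)"
    let ?I = "\<lambda>j \<gamma>. \<integral>x. \<phi> ?y x $v j \<partial>model_law (path \<gamma>) Q"
    have "((\<lambda>\<gamma>. (\<integral>e. e $ ?y * drift u \<gamma> e \<partial>Q) + (\<integral>e. ?r \<gamma> e * drift ?y \<gamma> e \<partial>Q) -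
          (\<Sum>j<?k. ?E j * (?I j \<gamma> / \<gamma>))) \<longlongrightarrow>
        (\<integral>e. e $ ?y * drift u 0 e \<partial>Q) + (\<integral>e. ?r 0 e * drift ?y 0 e \<partial>Q) -
          (\<Sum>j<?k. ?E j * h $ nth_elem (pa G ?y) j $ ?y)) (at 0)"
      by (intro tendsto_diff tendsto_add tendsto_sum tendsto_mult_left
          tendsto_integral_dominated_paths[OF dominated_path_error dominated_path_drift]
          tendsto_integral_dominated_paths[OF dominated_path_resid[OF h] dominated_path_drift] IH[OF y]) auto
    also have "(\<integral>e. ?r 0 e * drift ?y 0 e \<partial>Q) = (\<Sum>j<?k. ?E j * h $ nth_elem (pa G ?y) j $ ?y)"
    proof -
      have "?E j = (\<integral>e. e $ u * solution \<beta> e $ nth_elem (pa G ?y) j \<partial>Q)" for j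
        by (simp add: expect_under_def integral_P resid_solution[OF coef] mult.commute)
      then show ?thesis
        using sum_parents_drift[OF fe[of u], of ?y] by (simp add: resid_solution[OF coef])
    qed
    also have "(\<integral>e. e $ ?y * drift u 0 e \<partial>Q) = (\<Sum>j<card (pa G u). A u $$ (i, j) * h $ nth_elem (pa G u) j $ u)"
      using sum_parents_drift[OF fe[of ?y], of u] True by (simp add: Aij instr_def resid_solution[OF coef])
    finally have lim: "((\<lambda>\<gamma>. (\<integral>e. e $ ?y * drift u \<gamma> e \<partial>Q) + (\<integral>e. ?r \<gamma> e * drift ?y \<gamma> e \<partial>Q) -
          (\<Sum>j<?k. ?E j * (?I j \<gamma> / \<gamma>))) \<longlongrightarrow>
        (\<Sum>j<card (pa G u). A u $$ (i, j) * h $ nth_elem (pa G u) j $ u)) (at 0)"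
      by simp
    show ?thesis
    proof (rule Lim_transform_eventually[OF lim])
      show "\<forall>\<^sub>F \<gamma> in at 0. (\<integral>e. e $ ?y * drift u \<gamma> e \<partial>Q) + (\<integral>e. ?r \<gamma> e * drift ?y \<gamma> e \<partial>Q) -
          (\<Sum>j<?k. ?E j * (?I j \<gamma> / \<gamma>)) = (\<integral>x. R u x $v i \<partial>model_law (path \<gamma>) Q) / \<gamma>"
        using nz
      proof eventually_elim
        case (elim \<gamma>)
        let ?L = "model_law (path \<gamma>) Q"
        have fr: "fourth_moment Q (?r \<gamma>)"
          using elim fourth_moment_add[OF fe fourth_moment_scale[OF fourth_moment_drift], of u \<gamma> u \<gamma>]
          by (simp add: resid_path)
        have prod: "(\<integral>x. resid G b ?y x * resid G b u x \<partial>?L) =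
            \<gamma> * ((\<integral>e. e $ ?y * drift u \<gamma> e \<partial>Q) + (\<integral>e. ?r \<gamma> e * drift ?y \<gamma> e \<partial>Q))"
        proof -
          \<comment> \<open>The second-order term is absorbed by keeping the perturbed residual
            \<open>?r\<close> in the last product.\<close>
          have eq: "resid G b ?y (solution (path \<gamma>) e) * ?r \<gamma> e =
              e $ ?y * e $ u + \<gamma> * (e $ ?y * drift u \<gamma> e) + \<gamma> * (?r \<gamma> e * drift ?y \<gamma> e)" for e
          proof -
            have "(a + \<gamma> * d) * r = a * c + \<gamma> * (a * d') + \<gamma> * (r * d)" if "r = c + \<gamma> * d'" for a c d d' r :: real
              unfolding that by (simp add: algebra_simps)
            from this[OF resid_path[of \<gamma> u e], of "e $ ?y" "drift ?y \<gamma> e"]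
            show ?thesis using elim by (simp only: resid_path[of \<gamma> ?y e])
          qed
          have "(\<integral>x. resid G b ?y x * resid G b u x \<partial>?L) =
              (\<integral>e. e $ ?y * e $ u + \<gamma> * (e $ ?y * drift u \<gamma> e) + \<gamma> * (?r \<gamma> e * drift ?y \<gamma> e) \<partial>Q)"
            by (simp add: integral_P eq)
          also have "\<dots> = (\<integral>e. e $ ?y * e $ u \<partial>Q) + \<gamma> * (\<integral>e. e $ ?y * drift u \<gamma> e \<partial>Q) +
              \<gamma> * (\<integral>e. ?r \<gamma> e * drift ?y \<gamma> e \<partial>Q)"
            using integrable_mult2[OF fe fe] integrable_mult2[OF fe fourth_moment_drift]
              integrable_mult2[OF fr fourth_moment_drift] by simp
          finally show ?thesis using errors_uncorrelated[OF errors y_sib] by (simp add: distrib_left)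
        qed
        have prod_int: "integrable ?L (\<lambda>x. resid G b ?y x * resid G b u x)"
          by (rule quadratic_integrable_law[OF span_consistent_mult[OF affine_resid[OF y(2)] affine_resid[OF u]]])
        have \<phi>_int: "integrable ?L (\<lambda>x. \<phi> ?y x $v j)" if "j < ?k" for j
          by (rule quadratic_integrable_law[OF quadratic_influence[OF y(2) that]])
        have "(\<integral>x. R u x $v i \<partial>?L) = (\<integral>x. resid G b ?y x * resid G b u x \<partial>?L) - (\<integral>x. (\<Sum>j<?k. ?E j * \<phi> ?y x $v j) \<partial>?L)"
          using True prod_int \<phi>_int
          by (simp only: row_index[OF u i] if_True)
            (intro Bochner_Integration.integral_diff Bochner_Integration.integrable_sum integrable_mult_right, auto)
        also have "(\<integral>x. (\<Sum>j<?k. ?E j * \<phi> ?y x $v j) \<partial>?L) = (\<Sum>j<?k. ?E j * ?I j \<gamma>)"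
          using \<phi>_int by (subst Bochner_Integration.integral_sum) auto
        finally have R_eq: "(\<integral>x. R u x $v i \<partial>?L) =
            \<gamma> * ((\<integral>e. e $ ?y * drift u \<gamma> e \<partial>Q) + (\<integral>e. ?r \<gamma> e * drift ?y \<gamma> e \<partial>Q)) - (\<Sum>j<?k. ?E j * ?I j \<gamma>)"
          unfolding prod .
        have "(\<Sum>j<?k. ?E j * (?I j \<gamma> / \<gamma>)) = (\<Sum>j<?k. ?E j * ?I j \<gamma>) / \<gamma>"
          by (simp add: sum_divide_distrib)
        then show ?case
          unfolding R_eq using elim by (simp add: diff_divide_distrib)
      qed
    qed
  qed
qed

text \<open>Inverting the moment matrix cancels \<open>A\<close> in the derivative of the rows. The
  influence functions thus have the pathwise derivative of the coefficients themselves, for every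
  direction supported on the edges.\<close>

lemma influence_derivative:
  assumes "u \<in> W" "j < card (pa G u)"
  shows "((\<lambda>\<gamma>. (\<integral>x. \<phi> u x $v j \<partial>model_law (path \<gamma>) Q) / \<gamma>) \<longlongrightarrow> h $ nth_elem (pa G u) j $ u) (at 0)"
  using HTC_identified_wf[OF ident] assms
proof (induction u arbitrary: j rule: wf_induct_rule)
  case (less u)
  note u = \<open>u \<in> W\<close> and j = \<open>j < card (pa G u)\<close>
  let ?k = "card (pa G u)"
  let ?C = "inv_mat (A u)"
  let ?h = "\<lambda>l. h $ nth_elem (pa G u) l $ u"
  have eq: "(\<integral>x. \<phi> u x $v j \<partial>model_law (path \<gamma>) Q) / \<gamma> =
      (\<Sum>i<?k. ?C $$ (j, i) * ((\<integral>x. R u x $v i \<partial>model_law (path \<gamma>) Q) / \<gamma>))" for \<gamma>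
  proof -
    have "(\<integral>x. \<phi> u x $v j \<partial>model_law (path \<gamma>) Q) =
        (\<Sum>i<?k. ?C $$ (j, i) * (\<integral>x. R u x $v i \<partial>model_law (path \<gamma>) Q))"
      unfolding influence_index[OF u j]
      using quadratic_integrable_law[OF quadratic_row[OF u]] by (subst Bochner_Integration.integral_sum) auto
    then show ?thesis by (simp add: sum_divide_distrib)
  qed
  have "((\<lambda>\<gamma>. \<Sum>i<?k. ?C $$ (j, i) * ((\<integral>x. R u x $v i \<partial>model_law (path \<gamma>) Q) / \<gamma>)) \<longlongrightarrow>
      (\<Sum>i<?k. ?C $$ (j, i) * (\<Sum>l<?k. A u $$ (i, l) * ?h l))) (at 0)"
    by (intro tendsto_sum tendsto_mult_left row_derivative_if u less.IH) auto
  also have "(\<Sum>i<?k. ?C $$ (j, i) * (\<Sum>l<?k. A u $$ (i, l) * ?h l)) =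
      (\<Sum>l<?k. (\<Sum>i<?k. ?C $$ (j, i) * A u $$ (i, l)) * ?h l)"
    by (simp add: sum_distrib_left sum_distrib_right mult.assoc) (rule sum.swap)
  also have "\<dots> = (\<Sum>l<?k. (if l = j then 1 else 0) * ?h l)"
  proof (rule sum.cong[OF refl])
    fix l assume "l \<in> {..<?k}"
    then have l: "l < ?k" by simp
    have "(\<Sum>i<?k. ?C $$ (j, i) * A u $$ (i, l)) = (?C * A u) $$ (j, l)"
      by (rule mult_mat_index[symmetric, OF inv_mat_carrier[OF A_carrier[OF u]] A_carrier[OF u] j l])
    also have "\<dots> = (if l = j then 1 else 0)"
      using inv_mat_inverse(2)[OF A_carrier[OF u] A_det[OF u]] j l by simp
    finally show "(\<Sum>i<?k. ?C $$ (j, i) * A u $$ (i, l)) * ?h l = (if l = j then 1 else 0) * ?h l" by simp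
  qed
  also have "\<dots> = ?h j"
    using j by (simp add: if_distrib[where f="\<lambda>t. t * _"] cong: if_cong)
  finally show ?case unfolding eq .
qed

end

section \<open>The asymptotic variance as a second moment matrix\<close>

lemma integral_double_sum:
  fixes f :: "nat \<Rightarrow> nat \<Rightarrow> 'x \<Rightarrow> real"
  assumes int: "\<And>i j. i < n \<Longrightarrow> j < m \<Longrightarrow> integrable N (f i j)"
  shows "(\<integral>x. (\<Sum>i<n. \<Sum>j<m. c i j * f i j x) \<partial>N) = (\<Sum>i<n. \<Sum>j<m. c i j * (\<integral>x. f i j x \<partial>N))"
proof -
  have "(\<integral>x. (\<Sum>i<n. \<Sum>j<m. c i j * f i j x) \<partial>N) = (\<Sum>i<n. \<integral>x. (\<Sum>j<m. c i j * f i j x) \<partial>N)"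
    using int by (intro Bochner_Integration.integral_sum Bochner_Integration.integrable_sum integrable_mult_right) auto
  also have "\<dots> = (\<Sum>i<n. \<Sum>j<m. \<integral>x. c i j * f i j x \<partial>N)"
    using int by (intro sum.cong refl Bochner_Integration.integral_sum integrable_mult_right) auto
  finally show ?thesis by simp
qed

text \<open>Linearity moves the two inverse matrices inside the expectation, where they turn the
  rows into influence functions.\<close>

lemma V_true_index:
  assumes u: "u \<in> W" and ij: "i < card (pa G u)" "j < card (pa G u)"
  shows "V_true G Y prec \<beta> Q u $$ (i, j) = (\<integral>x. \<phi> u x $v i * \<phi> u x $v j \<partial>P)"
proof -
  let ?k = "card (pa G u)"
  let ?B = "inv_mat (A u)"
  define S where "S = Matrix.mat ?k ?k (\<lambda>(i, j). E (\<lambda>x. R u x $v i * R u x $v j))"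
  have B: "?B \<in> carrier_mat ?k ?k" by (rule inv_mat_carrier[OF A_carrier[OF u]])
  have BT: "transpose_mat ?B \<in> carrier_mat ?k ?k" using B by simp
  have S: "S \<in> carrier_mat ?k ?k" by (simp add: S_def)
  have int: "integrable P (\<lambda>x. R u x $v l * R u x $v m)" if "l < ?k" "m < ?k" for l m
    by (rule consistent_emp_quadratic(2)[OF quadratic_row[OF u that(1)] quadratic_row[OF u that(2)]])
  have "V_true G Y prec \<beta> Q u $$ (i, j) = (?B * S * transpose_mat ?B) $$ (i, j)"
    by (simp add: V_true_def asym_var_def Let_def card_Y[OF u] S_def)
  also have "\<dots> = (\<Sum>m<?k. (?B * S) $$ (i, m) * transpose_mat ?B $$ (m, j))"
    by (rule mult_mat_index[OF mult_carrier_mat[OF B S] BT ij])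
  also have "\<dots> = (\<Sum>m<?k. \<Sum>l<?k. ?B $$ (i, l) * ?B $$ (j, m) * (\<integral>x. R u x $v l * R u x $v m \<partial>P))"
  proof (rule sum.cong[OF refl])
    fix m assume "m \<in> {..<?k}"
    then have m: "m < ?k" by simp
    have "(?B * S) $$ (i, m) * transpose_mat ?B $$ (m, j) = (\<Sum>l<?k. ?B $$ (i, l) * S $$ (l, m)) * ?B $$ (j, m)"
      using mult_mat_index[OF B S ij(1) m] B m ij by simp
    also have "\<dots> = (\<Sum>l<?k. ?B $$ (i, l) * S $$ (l, m) * ?B $$ (j, m))"
      by (rule sum_distrib_right)
    also have "\<dots> = (\<Sum>l<?k. ?B $$ (i, l) * ?B $$ (j, m) * (\<integral>x. R u x $v l * R u x $v m \<partial>P))"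
      using m by (intro sum.cong) (auto simp: S_def expect_under_def)
    finally show "(?B * S) $$ (i, m) * transpose_mat ?B $$ (m, j) =
        (\<Sum>l<?k. ?B $$ (i, l) * ?B $$ (j, m) * (\<integral>x. R u x $v l * R u x $v m \<partial>P))" .
  qed
  also have "\<dots> = (\<integral>x. (\<Sum>m<?k. \<Sum>l<?k. ?B $$ (i, l) * ?B $$ (j, m) * (R u x $v l * R u x $v m)) \<partial>P)"
    by (rule integral_double_sum[symmetric]) (rule int)
  also have "\<dots> = (\<integral>x. \<phi> u x $v i * \<phi> u x $v j \<partial>P)"
  proof (rule Bochner_Integration.integral_cong[OF refl])
    fix x
    show "(\<Sum>m<?k. \<Sum>l<?k. ?B $$ (i, l) * ?B $$ (j, m) * (R u x $v l * R u x $v m)) = \<phi> u x $v i * \<phi> u x $v j"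
      unfolding influence_index[OF u ij(1)] influence_index[OF u ij(2)] sum_product
      by (subst sum.swap) (simp add: mult_ac)
  qed
  finally show ?thesis .
qed

lemma V_true_carrier: "u \<in> W \<Longrightarrow> V_true G Y prec \<beta> Q u \<in> carrier_mat (card (pa G u)) (card (pa G u))"
  by (rule mat_consistentD(2)[OF V_hat_consistent])

lemma quadratic_combination:
  "u \<in> W \<Longrightarrow> quadratic (\<lambda>z x. \<Sum>j<card (pa G u). a j * \<phi>h z u x $v j) (\<lambda>x. \<Sum>j<card (pa G u). a j * \<phi> u x $v j)"
  by (intro span_consistent_sum span_consistent_scale consistent_const quadratic_influence) auto

theorem V_true_positive_definite:
  assumes u: "u \<in> W"
  shows "positive_definite (card (pa G u)) (V_true G Y prec \<beta> Q u)"
  unfolding positive_definite_def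
proof (intro conjI ballI impI)
  let ?k = "card (pa G u)"
  let ?V = "V_true G Y prec \<beta> Q u"
  show V: "?V \<in> carrier_mat ?k ?k" by (rule V_true_carrier[OF u])
  show "transpose_mat ?V = ?V"
    using V by (intro eq_matI) (auto simp: V_true_index[OF u] mult.commute)
  fix a :: "real Matrix.vec" assume a: "a \<in> carrier_vec ?k" "a \<noteq> 0\<^sub>v ?k"
  define f where "f x = (\<Sum>j<?k. a $v j * \<phi> u x $v j)" for x
  have f: "quadratic (\<lambda>z x. \<Sum>j<?k. a $v j * \<phi>h z u x $v j) f"
    unfolding f_def by (rule quadratic_combination[OF u])
  have fint: "integrable P (\<lambda>x. (f x)\<^sup>2)"
    using consistent_emp_quadratic(2)[OF f f] by (simp add: power2_eq_square)
  have int: "integrable P (\<lambda>x. \<phi> u x $v i * \<phi> u x $v j)" if "i < ?k" "j < ?k" for i j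
    by (rule consistent_emp_quadratic(2)[OF quadratic_influence[OF u that(1)] quadratic_influence[OF u that(2)]])
  have "(\<integral>x. (f x)\<^sup>2 \<partial>P) = (\<integral>x. (\<Sum>i<?k. \<Sum>j<?k. a $v i * a $v j * (\<phi> u x $v i * \<phi> u x $v j)) \<partial>P)"
    by (simp add: f_def power2_eq_square sum_product mult_ac)
  also have "\<dots> = (\<Sum>i<?k. \<Sum>j<?k. a $v i * a $v j * (\<integral>x. \<phi> u x $v i * \<phi> u x $v j \<partial>P))"
    by (rule integral_double_sum) (rule int)
  also have "\<dots> = quad_form ?V a"
    unfolding quad_form_sum[OF V a(1)] by (intro sum.cong refl) (simp add: V_true_index[OF u])
  finally have q: "quad_form ?V a = (\<integral>x. (f x)\<^sup>2 \<partial>P)" by simp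
  have "(\<integral>x. (f x)\<^sup>2 \<partial>P) \<noteq> 0"
  proof
    assume "(\<integral>x. (f x)\<^sup>2 \<partial>P) = 0"
    then have "AE x in P. (f x)\<^sup>2 = 0"
      using integral_nonneg_eq_0_iff_AE[OF fint] by simp
    then have null: "AE x in P. f x = 0" by simp
    \<comment> \<open>Column \<open>u\<close> carries \<open>a\<close> on the parents of
      \<open>u\<close> and all else is 0, so the derivative of the expectation of \<open>f\<close>
      is the squared norm of \<open>a\<close>.\<close>
    define h :: "real ^ 'v ^ 'v" where
      "h = (\<chi> w v. if v = u then (\<Sum>j<?k. if nth_elem (pa G u) j = w then a $v j else 0) else 0)"
    have h0: "h $ w $ v = 0" if "(w, v) \<notin> dir G" for w v
    proof (cases "v = u")
      case True
      have "nth_elem (pa G u) j \<noteq> w" if "j < ?k" for j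
        using nth_elem_in[OF that] \<open>(w, v) \<notin> dir G\<close> True by (auto simp: pa_def)
      then show ?thesis using True by (simp add: h_def)
    next
      case False
      then show ?thesis by (simp add: h_def)
    qed
    have hj: "h $ nth_elem (pa G u) j $ u = a $v j" if j: "j < ?k" for j
    proof -
      have "(\<Sum>l<?k. if nth_elem (pa G u) l = nth_elem (pa G u) j then a $v l else 0) =
          (\<Sum>l<?k. if l = j then a $v l else 0)"
        using j by (intro sum.cong) (auto simp: nth_elem_eq_iff)
      also have "\<dots> = a $v j" using j by simp
      finally show ?thesis by (simp add: h_def)
    qed
    have 1: "((\<lambda>\<gamma>. (\<integral>x. f x \<partial>model_law (\<beta> + \<gamma> *\<^sub>R h) Q) / \<gamma>) \<longlongrightarrow> 0) (at 0)"
      by (rule null_function_derivative[OF h0 f null])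
    have eq: "(\<integral>x. f x \<partial>model_law (\<beta> + \<gamma> *\<^sub>R h) Q) / \<gamma> =
        (\<Sum>j<?k. a $v j * ((\<integral>x. \<phi> u x $v j \<partial>model_law (\<beta> + \<gamma> *\<^sub>R h) Q) / \<gamma>))" for \<gamma>
    proof -
      have "(\<integral>x. f x \<partial>model_law (\<beta> + \<gamma> *\<^sub>R h) Q) =
          (\<Sum>j<?k. a $v j * (\<integral>x. \<phi> u x $v j \<partial>model_law (\<beta> + \<gamma> *\<^sub>R h) Q))"
        unfolding f_def using quadratic_integrable_law[OF quadratic_influence[OF u]]
        by (subst Bochner_Integration.integral_sum) auto
      then show ?thesis by (simp add: sum_divide_distrib)
    qed
    have "((\<lambda>\<gamma>. (\<integral>x. f x \<partial>model_law (\<beta> + \<gamma> *\<^sub>R h) Q) / \<gamma>) \<longlongrightarrow> (\<Sum>j<?k. a $v j * a $v j)) (at 0)"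
      unfolding eq
    proof (intro tendsto_sum tendsto_mult_left)
      fix j assume "j \<in> {..<?k}"
      then have j: "j < ?k" by simp
      show "((\<lambda>\<gamma>. (\<integral>x. \<phi> u x $v j \<partial>model_law (\<beta> + \<gamma> *\<^sub>R h) Q) / \<gamma>) \<longlongrightarrow> a $v j) (at 0)"
        using influence_derivative[OF h0 u j] hj[OF j] by simp
    qed
    with 1 have "(\<Sum>j<?k. a $v j * a $v j) = 0"
      using tendsto_unique[OF trivial_limit_at] by blast
    then have "\<forall>j<?k. a $v j = 0"
      by (subst (asm) sum_nonneg_eq_0_iff) auto
    then have "a = 0\<^sub>v ?k" using a(1) by (intro eq_vecI) auto
    then show False using a(2) by simp
  qed
  then show "quad_form ?V a > 0"
    unfolding q using Bochner_Integration.integral_nonneg[of P "\<lambda>x. (f x)\<^sup>2"] by (simp add: less_le)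
qed

end

section \<open>Characteristic functions of normalised sums\<close>

lemma iid_characteristic_function_tendsto:
  assumes iid: "iid_sample M X P" and f: "f \<in> borel_measurable borel" "integrable P (\<lambda>x. (f x)\<^sup>2)"
    and mean: "(\<integral>x. f x \<partial>P) = 0"
  shows "(\<lambda>n. \<integral>\<omega>. iexp (sqrt (real n) * empirical n (\<lambda>i. X i \<omega>) f) \<partial>M) \<longlonglongrightarrow>
    of_real (exp (- (\<integral>x. (f x)\<^sup>2 \<partial>P) / 2))"
proof -
  interpret prob_space M using iid by (rule iid_sample_prob_space)
  note f(1)[measurable]
  have [measurable]: "X i \<in> borel_measurable M" for i
    by (rule iid_sample_measurable[OF iid])
  define v where "v = (\<integral>x. (f x)\<^sup>2 \<partial>P)"
  have sq: "integrable M (\<lambda>\<omega>. (f (X i \<omega>))\<^sup>2)" "expectation (\<lambda>\<omega>. (f (X i \<omega>))\<^sup>2) = v" for i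
    using iid_sample_compose(3,4)[OF iid, of "\<lambda>x. (f x)\<^sup>2" i] f by (auto simp: v_def)
  have m: "expectation (\<lambda>\<omega>. f (X i \<omega>)) = 0" for i
    using iid_sample_compose(4)[OF iid f(1)] mean by simp
  have scaled: "sqrt (real n) * empirical n (\<lambda>i. X i \<omega>) f = (\<Sum>i<n. f (X i \<omega>)) / sqrt (real n)" for n \<omega>
    by (cases "n = 0") (simp_all add: empirical_def field_simps)
  show ?thesis
  \<comment> \<open>The central limit theorem normalises by the standard deviation, so zero variance
    is treated apart: then all summands vanish almost surely.\<close>
  proof (cases "v = 0")
    case True
    have null: "AE \<omega> in M. f (X i \<omega>) = 0" for i
      using sq[of i] True integral_nonneg_eq_0_iff_AE[OF sq(1)[of i]] by simp
    have "(\<integral>\<omega>. iexp (sqrt (real n) * empirical n (\<lambda>i. X i \<omega>) f) \<partial>M) = (\<integral>\<omega>. 1 \<partial>M)" for n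
    proof (rule integral_cong_AE)
      have "AE \<omega> in M. \<forall>i. f (X i \<omega>) = 0" using null by (simp add: AE_all_countable)
      then show "AE \<omega> in M. iexp (sqrt (real n) * empirical n (\<lambda>i. X i \<omega>) f) = 1"
        by eventually_elim (simp add: empirical_def)
      show "(\<lambda>\<omega>. iexp (sqrt (real n) * empirical n (\<lambda>i. X i \<omega>) f)) \<in> borel_measurable M"
        unfolding empirical_def by measurable
    qed simp
    then show ?thesis using True by (simp add: v_def prob_space)
  next
    case False
    have "v \<ge> 0" by (simp add: v_def)
    define s where "s = sqrt v"
    have s: "s > 0" "s\<^sup>2 = v" using False \<open>v \<ge> 0\<close> by (auto simp: s_def)
    have weak: "weak_conv_m (\<lambda>n. distr M borel (\<lambda>\<omega>. (\<Sum>i<n. f (X i \<omega>)) / sqrt (n * s\<^sup>2))) std_normal_distribution"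
      by (rule central_limit_theorem_zero_mean[where X="\<lambda>i \<omega>. f (X i \<omega>)" and \<mu>="distr P borel f"])
        (use iid_sample_compose(1,2)[OF iid f(1)] m sq s in auto)
    \<comment> \<open>Evaluating at the standard deviation undoes the normalisation by it.\<close>
    have "(\<lambda>n. char (distr M borel (\<lambda>\<omega>. (\<Sum>i<n. f (X i \<omega>)) / sqrt (n * s\<^sup>2))) s) \<longlonglongrightarrow> char std_normal_distribution s"
      by (rule levy_continuity1[OF _ real_dist_normal_dist weak]) (intro real_distribution_distr, measurable)
    moreover have "char (distr M borel (\<lambda>\<omega>. (\<Sum>i<n. f (X i \<omega>)) / sqrt (n * s\<^sup>2))) s =
        (\<integral>\<omega>. iexp (sqrt (real n) * empirical n (\<lambda>i. X i \<omega>) f) \<partial>M)" for n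
    proof -
      have "char (distr M borel (\<lambda>\<omega>. (\<Sum>i<n. f (X i \<omega>)) / sqrt (n * s\<^sup>2))) s =
          (\<integral>\<omega>. iexp (s * ((\<Sum>i<n. f (X i \<omega>)) / sqrt (n * s\<^sup>2))) \<partial>M)"
        unfolding char_def by (subst integral_distr) auto
      moreover have "s * ((\<Sum>i<n. f (X i \<omega>)) / sqrt (n * s\<^sup>2)) = sqrt (real n) * empirical n (\<lambda>i. X i \<omega>) f" for \<omega>
        unfolding scaled using s(1) by (simp add: real_sqrt_mult)
      ultimately show ?thesis by (simp only:)
    qed
    ultimately show ?thesis
      unfolding char_std_normal_distribution v_def[symmetric] s(2)[symmetric] by simp
  qed
qed

text \<open>The two probabilities differ by at most that of the symmetric difference.\<close>

lemma (in prob_space) prob_difference_tendsto_0: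
  assumes S [measurable]: "\<And>n. {\<omega> \<in> space M. S (n, \<omega>)} \<in> sets M" and T [measurable]: "\<And>n. {\<omega> \<in> space M. T (n, \<omega>)} \<in> sets M"
    and eq: "\<forall>\<^sub>F z in whp M. S z = T z"
  shows "(\<lambda>n. prob {\<omega> \<in> space M. S (n, \<omega>)} - prob {\<omega> \<in> space M. T (n, \<omega>)}) \<longlonglongrightarrow> 0"
proof -
  have meas: "{\<omega> \<in> space M. S (n, \<omega>) \<noteq> T (n, \<omega>)} \<in> sets M" for n
  proof -
    have "{\<omega> \<in> space M. S (n, \<omega>) \<noteq> T (n, \<omega>)} =
        ({\<omega> \<in> space M. S (n, \<omega>)} - {\<omega> \<in> space M. T (n, \<omega>)}) \<union> ({\<omega> \<in> space M. T (n, \<omega>)} - {\<omega> \<in> space M. S (n, \<omega>)})"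
      by auto
    then show ?thesis using S T by auto
  qed
  have lim: "(\<lambda>n. prob {\<omega> \<in> space M. \<not> S (n, \<omega>) = T (n, \<omega>)}) \<longlonglongrightarrow> 0"
    using eq eventually_whp_null[of "\<lambda>z. S z = T z"] meas by simp
  have le: "prob {\<omega> \<in> space M. U (n, \<omega>)} \<le> prob {\<omega> \<in> space M. U' (n, \<omega>)} + prob {\<omega> \<in> space M. \<not> S (n, \<omega>) = T (n, \<omega>)}"
    if "{\<omega> \<in> space M. U' (n, \<omega>)} \<in> sets M" "\<And>\<omega>. U (n, \<omega>) \<Longrightarrow> \<not> U' (n, \<omega>) \<Longrightarrow> S (n, \<omega>) \<noteq> T (n, \<omega>)" for U U' n
  proof -
    have "prob {\<omega> \<in> space M. U (n, \<omega>)} \<le> prob ({\<omega> \<in> space M. U' (n, \<omega>)} \<union> {\<omega> \<in> space M. \<not> S (n, \<omega>) = T (n, \<omega>)})"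
      using that meas by (intro finite_measure_mono) auto
    also have "\<dots> \<le> prob {\<omega> \<in> space M. U' (n, \<omega>)} + prob {\<omega> \<in> space M. \<not> S (n, \<omega>) = T (n, \<omega>)}"
      using that meas by (intro measure_Un_le) auto
    finally show ?thesis .
  qed
  show ?thesis
  proof (rule Lim_null_comparison[OF _ lim], rule always_eventually, rule allI)
    fix n
    show "norm (prob {\<omega> \<in> space M. S (n, \<omega>)} - prob {\<omega> \<in> space M. T (n, \<omega>)}) \<le>
        prob {\<omega> \<in> space M. \<not> S (n, \<omega>) = T (n, \<omega>)}"
      using le[of T n S, OF T] le[of S n T, OF S] by auto
  qed
qed

lemma positive_definite_congruence:
  assumes V: "positive_definite k V" and C: "C \<in> carrier_mat r k"
    and inj: "\<And>x. x \<in> carrier_vec r \<Longrightarrow> transpose_mat C *\<^sub>v x = 0\<^sub>v k \<Longrightarrow> x = 0\<^sub>v r"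
  shows "positive_definite r (C * V * transpose_mat C)"
  unfolding positive_definite_def
proof (intro conjI ballI impI)
  have Vc: "V \<in> carrier_mat k k" "transpose_mat V = V" using V by (auto simp: positive_definite_def)
  have CT: "transpose_mat C \<in> carrier_mat k r" using C by simp
  have CV: "C * V \<in> carrier_mat r k" using C Vc by simp
  show "C * V * transpose_mat C \<in> carrier_mat r r" by (rule mult_carrier_mat[OF CV CT])
  show "transpose_mat (C * V * transpose_mat C) = C * V * transpose_mat C"
    unfolding transpose_mult[OF CV CT] transpose_mult[OF C Vc(1)] Vc(2) Matrix.transpose_transpose
    by (rule assoc_mult_mat[symmetric, OF C Vc(1) CT])
  fix x :: "real Matrix.vec" assume x: "x \<in> carrier_vec r" "x \<noteq> 0\<^sub>v r"
  let ?y = "transpose_mat C *\<^sub>v x"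
  have y: "?y \<in> carrier_vec k" "?y \<noteq> 0\<^sub>v k" using CT x inj by auto
  have "(C * V * transpose_mat C) *\<^sub>v x = C *\<^sub>v (V *\<^sub>v ?y)"
    using assoc_mult_mat_vec[OF CV CT x(1)] assoc_mult_mat_vec[OF C Vc(1) y(1)] by simp
  then have "quad_form (C * V * transpose_mat C) x = scalar_prod x (C *\<^sub>v (V *\<^sub>v ?y))"
    by (simp add: quad_form_def)
  also have "\<dots> = quad_form V ?y"
    unfolding quad_form_def
    by (rule transpose_vec_mult_scalar[symmetric, OF C mult_mat_vec_carrier[OF Vc(1) y(1)] x(1)])
  finally show "quad_form (C * V * transpose_mat C) x > 0"
    using V y by (simp add: positive_definite_def)
qed

section \<open>The Wald statistic\<close>

context htc_sample begin

abbreviation Vh where "Vh z \<equiv> V_hat G Y prec (fst z) (\<lambda>i. X i (snd z))"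

text \<open>Full row rank enters as injectivity of the transpose, a form that is immediate for the
  identity matrix and for a unit row, from which the confidence regions arise.\<close>

context
  fixes v :: 'v and C :: "real Matrix.mat" and r :: nat
  assumes v: "v \<in> W" and C: "C \<in> carrier_mat r (card (pa G v))"
    and inj: "\<And>x. x \<in> carrier_vec r \<Longrightarrow> transpose_mat C *\<^sub>v x = 0\<^sub>v (card (pa G v)) \<Longrightarrow> x = 0\<^sub>v r"
begin

abbreviation (input) k where "k \<equiv> card (pa G v)"
abbreviation S where "S \<equiv> C * V_true G Y prec \<beta> Q v * transpose_mat C"
abbreviation Sh where "Sh z \<equiv> C * Vh z v * transpose_mat C"
abbreviation wald where "wald z \<equiv> real (fst z) * quad_form (inv_mat (Sh z)) (C *\<^sub>v bh z v - C *\<^sub>v b v)"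

lemma S_positive_definite: "positive_definite r S"
  by (rule positive_definite_congruence[OF V_true_positive_definite[OF v] C inj])

lemma Sh_consistent: "mat_consistent M r r Sh S"
  by (intro mat_consistent_mult[OF mat_consistent_mult[OF mat_consistent_const[OF C] V_hat_consistent[OF v]]
        mat_consistent_transpose[OF mat_consistent_const[OF C]]])

lemma det_Sh: "\<forall>\<^sub>F z in whp M. Determinant.det (Sh z) \<noteq> 0"
proof -
  have "((\<lambda>z. Determinant.det (Sh z)) \<longlongrightarrow> Determinant.det S) (whp M)"
    using consistent_det[OF Sh_consistent] by (simp add: consistent_def)
  then show ?thesis
    by (rule tendsto_imp_eventually_ne[OF _ positive_definite_det[OF S_positive_definite]])
qed

lemma invertible_Sh: "(\<lambda>n. measure M {\<omega> \<in> space M. invertible_mat (Sh (n, \<omega>))}) \<longlonglongrightarrow> 1"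
proof -
  interpret prob_space M by (rule iid_sample_prob_space[OF iid])
  have [measurable]: "(\<lambda>\<omega>. Determinant.det (Sh (n, \<omega>))) \<in> borel_measurable M" for n
    using consistent_det[OF Sh_consistent] unfolding consistent_def by blast
  have "\<forall>\<^sub>F z in whp M. invertible_mat (Sh z)"
    using det_Sh by (rule eventually_mono) (simp add: invertible_mat_iff_det[OF mat_consistentD(1)[OF Sh_consistent]])
  moreover have "{\<omega> \<in> space M. invertible_mat (Sh (n, \<omega>))} \<in> sets M" for n
    unfolding invertible_mat_iff_det[OF mat_consistentD(1)[OF Sh_consistent]] by measurable
  ultimately show ?thesis by (simp add: eventually_whp_prob)
qed

lemma inv_Sh_consistent: "mat_consistent M r r (\<lambda>z. inv_mat (Sh z)) (inv_mat S)"
  by (rule mat_consistent_inv[OF Sh_consistent positive_definite_det[OF S_positive_definite]])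

abbreviation contrast where "contrast z \<equiv> C *\<^sub>v bh z v - C *\<^sub>v b v"

lemma contrast_carrier: "contrast z \<in> carrier_vec r"
  by (intro minus_carrier_vec mult_mat_vec_carrier[OF C] beta_hat_carrier v coef_carrier)

lemma contrast_index:
  "a < r \<Longrightarrow> contrast z $v a = (\<Sum>l<k. C $$ (a, l) * (bh z v $v l - b v $v l))"
proof -
  assume a: "a < r"
  have "contrast z $v a = (C *\<^sub>v bh z v) $v a - (C *\<^sub>v b v) $v a"
    using a C by (intro index_minus_vec) simp
  then show ?thesis
    unfolding mult_mat_vec_index[OF C beta_hat_carrier[OF v] a] mult_mat_vec_index[OF C coef_carrier a]
    by (simp add: sum_subtractf right_diff_distrib)
qed

lemma wald_sum:
  "wald z = (\<Sum>a<r. \<Sum>c<r. (sqrt (real (fst z)) * contrast z $v a) * (sqrt (real (fst z)) * contrast z $v c) *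
     inv_mat (Sh z) $$ (a, c))"
proof -
  have "(sqrt (real (fst z)) * s) * (sqrt (real (fst z)) * t) * h = real (fst z) * (s * t * h)" for s t h
  proof -
    have "(sqrt (real (fst z)) * s) * (sqrt (real (fst z)) * t) * h =
        (sqrt (real (fst z)) * sqrt (real (fst z))) * (s * t * h)" by (simp only: mult_ac)
    then show ?thesis by simp
  qed
  then show ?thesis
    unfolding quad_form_sum[OF mat_consistentD(1)[OF inv_Sh_consistent] contrast_carrier] sum_distrib_left
    by (simp only:)
qed

text \<open>Without the factor \<open>n\<close> the statistic is a polynomial in consistent
  quantities, and measurability is read off from \<open>consistent\<close>.\<close>

lemma wald_measurable: "(\<lambda>\<omega>. wald (n, \<omega>)) \<in> borel_measurable M"
proof -
  \<comment> \<open>The limit is 0, written unsimplified to match the closure rules.\<close>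
  have "consistent M (\<lambda>z. \<Sum>a<r. \<Sum>c<r. contrast z $v a * contrast z $v c * inv_mat (Sh z) $$ (a, c))
      (\<Sum>a<r. \<Sum>c<r. (\<Sum>l<k. C $$ (a, l) * (b v $v l - b v $v l)) * (\<Sum>l<k. C $$ (c, l) * (b v $v l - b v $v l)) *
        inv_mat S $$ (a, c))"
  proof (intro consistent_sum consistent_mult)
    fix a assume "a \<in> {..<r}"
    then show "consistent M (\<lambda>z. contrast z $v a) (\<Sum>l<k. C $$ (a, l) * (b v $v l - b v $v l))"
      by (simp only: contrast_index lessThan_iff)
        (intro consistent_sum consistent_mult consistent_const consistent_diff consistent_beta_hat v, auto)
  next
    fix a c assume "a \<in> {..<r}" "c \<in> {..<r}"
    then show "consistent M (\<lambda>z. contrast z $v c) (\<Sum>l<k. C $$ (c, l) * (b v $v l - b v $v l))"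
      by (simp only: contrast_index lessThan_iff)
        (intro consistent_sum consistent_mult consistent_const consistent_diff consistent_beta_hat v, auto)
    show "consistent M (\<lambda>z. inv_mat (Sh z) $$ (a, c)) (inv_mat S $$ (a, c))"
      using mat_consistentD(3)[OF inv_Sh_consistent] \<open>a \<in> {..<r}\<close> \<open>c \<in> {..<r}\<close> by simp
  qed
  then have "(\<lambda>\<omega>. \<Sum>a<r. \<Sum>c<r. contrast (n, \<omega>) $v a * contrast (n, \<omega>) $v c * inv_mat (Sh (n, \<omega>)) $$ (a, c)) \<in> borel_measurable M"
    unfolding consistent_def by blast
  then show ?thesis
    unfolding quad_form_sum[OF mat_consistentD(1)[OF inv_Sh_consistent] contrast_carrier]
    by (intro borel_measurable_times) auto
qed

abbreviation lin where "lin a \<equiv> scaled_mean (\<lambda>x. \<Sum>l<k. C $$ (a, l) * \<phi> v x $v l)"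

lemma lin_mean_zero: "(\<integral>x. (\<Sum>l<k. c l * \<phi> v x $v l) \<partial>P) = 0"
  using quadratic_integrable[OF quadratic_influence[OF v]] influence_mean_zero[OF v]
  by (subst Bochner_Integration.integral_sum) auto

lemma contrast_linear: "a < r \<Longrightarrow> ((\<lambda>z. sqrt (real (fst z)) * contrast z $v a - lin a z) \<longlongrightarrow> 0) (whp M)"
proof -
  assume a: "a < r"
  have eq: "sqrt (real (fst z)) * contrast z $v a - lin a z =
      (\<Sum>l<k. C $$ (a, l) * (scaled_error v l z - scaled_mean (\<lambda>x. \<phi> v x $v l) z))" for z
    unfolding contrast_index[OF a] empirical_sum
    by (simp add: sum_distrib_left sum_subtractf[symmetric] algebra_simps)
  have "((\<lambda>z. \<Sum>l<k. C $$ (a, l) * (scaled_error v l z - scaled_mean (\<lambda>x. \<phi> v x $v l) z)) \<longlongrightarrow>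
      (\<Sum>l<k. C $$ (a, l) * 0)) (whp M)"
    by (intro tendsto_sum tendsto_mult_left asymptotically_linear v) simp
  then show ?thesis unfolding eq by simp
qed

lemma wald_approximation:
  "((\<lambda>z. wald z - (\<Sum>a<r. \<Sum>c<r. lin a z * lin c z * inv_mat S $$ (a, c))) \<longlongrightarrow> 0) (whp M)"
proof -
  let ?d = "\<lambda>a z. sqrt (real (fst z)) * contrast z $v a - lin a z"
  let ?H = "\<lambda>z. inv_mat (Sh z)"
  let ?J = "inv_mat S"
  have bounded_in_prob: "bounded_in_prob M (lin a)" for a
    by (rule bounded_in_prob_quadratic[OF quadratic_combination[OF v] lin_mean_zero])
  \<comment> \<open>Each normalised contrast is \<open>lin + ?d\<close>: the terms with
    \<open>?d\<close> are o_P(1) times a convergent matrix, and what is left is bounded in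
    probability times the error of that matrix.\<close>
  have eq: "wald z - (\<Sum>a<r. \<Sum>c<r. lin a z * lin c z * ?J $$ (a, c)) =
      (\<Sum>a<r. \<Sum>c<r. (?d a z * ?d c z + lin a z * ?d c z + lin c z * ?d a z) * ?H z $$ (a, c) +
        (lin a z * lin c z) * (?H z $$ (a, c) - ?J $$ (a, c)))" for z
    unfolding wald_sum sum_subtractf[symmetric] by (intro sum.cong refl) (simp add: algebra_simps)
  have "((\<lambda>z. \<Sum>a<r. \<Sum>c<r. (?d a z * ?d c z + lin a z * ?d c z + lin c z * ?d a z) * ?H z $$ (a, c) +
        (lin a z * lin c z) * (?H z $$ (a, c) - ?J $$ (a, c))) \<longlongrightarrow>
      (\<Sum>a<r. \<Sum>c<r. (0 * 0 + 0 + 0) * ?J $$ (a, c) + 0)) (whp M)"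
  proof (intro tendsto_sum tendsto_add)
    fix a c assume "a \<in> {..<r}" "c \<in> {..<r}"
    then have ac: "a < r" "c < r" by auto
    have H: "((\<lambda>z. ?H z $$ (a, c)) \<longlongrightarrow> ?J $$ (a, c)) (whp M)"
      using mat_consistentD(3)[OF inv_Sh_consistent ac] by (simp add: consistent_def)
    show "((\<lambda>z. (?d a z * ?d c z + lin a z * ?d c z + lin c z * ?d a z) * ?H z $$ (a, c)) \<longlongrightarrow>
        (0 * 0 + 0 + 0) * ?J $$ (a, c)) (whp M)"
      by (intro tendsto_mult tendsto_add contrast_linear ac H bounded_in_prob_mult_null[OF bounded_in_prob])
    have "((\<lambda>z. ?H z $$ (a, c) - ?J $$ (a, c)) \<longlongrightarrow> 0) (whp M)"
      using tendsto_diff[OF H tendsto_const[of "?J $$ (a, c)"]] by simp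
    then show "((\<lambda>z. (lin a z * lin c z) * (?H z $$ (a, c) - ?J $$ (a, c))) \<longlongrightarrow> 0) (whp M)"
      by (rule bounded_in_prob_mult_null[OF bounded_in_prob_mult[OF bounded_in_prob bounded_in_prob]])
  qed
  then show ?thesis unfolding eq by simp
qed

theorem wald_weak_convergence: "weak_conv_m (\<lambda>n. distr M borel (\<lambda>\<omega>. wald (n, \<omega>))) (chi_squared r)"
proof -
  interpret prob_space M by (rule iid_sample_prob_space[OF iid])
  have Vc: "V_true G Y prec \<beta> Q v \<in> carrier_mat k k" by (rule V_true_carrier[OF v])
  have Sc: "S \<in> carrier_mat r r" by (rule mat_consistentD(2)[OF Sh_consistent])
  obtain B where B: "B \<in> carrier_mat r r" "B * S * transpose_mat B = 1\<^sub>m r" "inv_mat S = transpose_mat B * B"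
    using positive_definite_whitening[OF S_positive_definite] by blast
  \<comment> \<open>\<open>D\<close> whitens: the combinations \<open>\<psi> i\<close> of influence
    functions have the identity as covariance matrix, so that the quadratic form in
    \<open>inv_mat S\<close> becomes the sum of squares \<open>N\<close>.\<close>
  define D where "D = B * C"
  have D: "D \<in> carrier_mat r k" unfolding D_def by (rule mult_carrier_mat[OF B(1) C])
  have BT: "transpose_mat B \<in> carrier_mat r r" and CT: "transpose_mat C \<in> carrier_mat k r" and DT: "transpose_mat D \<in> carrier_mat k r"
    using B C D by auto
  have DVD: "D * V_true G Y prec \<beta> Q v * transpose_mat D = 1\<^sub>m r"
  proof -
    have CV: "C * V_true G Y prec \<beta> Q v \<in> carrier_mat r k" by (rule mult_carrier_mat[OF C Vc])
    have "D * V_true G Y prec \<beta> Q v * transpose_mat D = B * (C * V_true G Y prec \<beta> Q v) * (transpose_mat C * transpose_mat B)"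
      unfolding D_def transpose_mult[OF B(1) C] assoc_mult_mat[OF B(1) C Vc] ..
    also have "\<dots> = B * (C * V_true G Y prec \<beta> Q v) * transpose_mat C * transpose_mat B"
      by (rule assoc_mult_mat[symmetric, OF mult_carrier_mat[OF B(1) CV] CT BT])
    also have "\<dots> = B * S * transpose_mat B"
      unfolding assoc_mult_mat[OF B(1) CV CT] ..
    finally show ?thesis using B(2) by simp
  qed
  define \<psi> where "\<psi> i x = (\<Sum>l<k. D $$ (i, l) * \<phi> v x $v l)" for i x
  have \<psi>: "quadratic (\<lambda>z x. \<Sum>l<k. D $$ (i, l) * \<phi>h z v x $v l) (\<psi> i)" for i
    unfolding \<psi>_def[abs_def] by (rule quadratic_combination[OF v])
  have \<psi>_cov: "(\<integral>x. \<psi> i x * \<psi> j x \<partial>P) = (if i = j then 1 else 0)" if ij: "i < r" "j < r" for i j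
  proof -
    have "(\<integral>x. \<psi> i x * \<psi> j x \<partial>P) = (\<integral>x. (\<Sum>l<k. \<Sum>m<k. D $$ (i, l) * D $$ (j, m) * (\<phi> v x $v l * \<phi> v x $v m)) \<partial>P)"
      by (simp add: \<psi>_def sum_product mult_ac)
    also have "\<dots> = (\<Sum>l<k. \<Sum>m<k. D $$ (i, l) * D $$ (j, m) * (\<integral>x. \<phi> v x $v l * \<phi> v x $v m \<partial>P))"
      by (rule integral_double_sum)
        (rule consistent_emp_quadratic(2)[OF quadratic_influence[OF v] quadratic_influence[OF v]])
    also have "\<dots> = (\<Sum>m<k. \<Sum>l<k. D $$ (i, l) * V_true G Y prec \<beta> Q v $$ (l, m) * D $$ (j, m))"
      by (subst sum.swap) (auto simp: V_true_index[OF v] intro!: sum.cong)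
    also have "\<dots> = (\<Sum>m<k. (D * V_true G Y prec \<beta> Q v) $$ (i, m) * transpose_mat D $$ (m, j))"
    proof (rule sum.cong[OF refl])
      fix m assume "m \<in> {..<k}"
      then have m: "m < k" by simp
      show "(\<Sum>l<k. D $$ (i, l) * V_true G Y prec \<beta> Q v $$ (l, m) * D $$ (j, m)) =
          (D * V_true G Y prec \<beta> Q v) $$ (i, m) * transpose_mat D $$ (m, j)"
        unfolding mult_mat_index[OF D Vc ij(1) m] using D m ij by (simp add: sum_distrib_right)
    qed
    also have "\<dots> = (D * V_true G Y prec \<beta> Q v * transpose_mat D) $$ (i, j)"
      by (rule mult_mat_index[symmetric, OF mult_carrier_mat[OF D Vc] DT ij])
    finally show ?thesis unfolding DVD using ij by simp
  qed
  define T where "T n \<omega> i = scaled_mean (\<psi> i) (n, \<omega>)" for n \<omega> i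
  have Xm [measurable]: "X i \<in> borel_measurable M" for i by (rule iid_sample_measurable[OF iid])
  have \<psi>m [measurable]: "\<psi> i \<in> borel_measurable borel" for i by (rule quadratic_measurable[OF \<psi>])
  have Tm [measurable]: "(\<lambda>\<omega>. T n \<omega> i) \<in> borel_measurable M" for n i
    unfolding T_def empirical_def fst_conv snd_conv by measurable
  \<comment> \<open>As in the Cramer-Wold device, for each \<open>t\<close> the univariate limit
    applies to the combination of the \<open>\<psi> i\<close>, whose variance is the sum of the
    \<open>(t i)\<^sup>2\<close>.\<close>
  have char: "(\<lambda>n. \<integral>\<omega>. iexp (\<Sum>i<r. t i * T n \<omega> i) \<partial>M) \<longlonglongrightarrow> of_real (exp (- (\<Sum>i<r. (t i)\<^sup>2) / 2))" for t
  proof -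
    define f where "f x = (\<Sum>i<r. t i * \<psi> i x)" for x
    have f: "quadratic (\<lambda>z x. \<Sum>i<r. t i * (\<Sum>l<k. D $$ (i, l) * \<phi>h z v x $v l)) f"
      unfolding f_def[abs_def] by (intro span_consistent_sum span_consistent_scale consistent_const \<psi>)
    have \<psi>_mean: "(\<integral>x. \<psi> i x \<partial>P) = 0" for i unfolding \<psi>_def by (rule lin_mean_zero)
    have f_mean: "(\<integral>x. f x \<partial>P) = 0"
      unfolding f_def using quadratic_integrable[OF \<psi>] \<psi>_mean
      by (subst Bochner_Integration.integral_sum) auto
    have f_int: "integrable P (\<lambda>x. (f x)\<^sup>2)"
      using consistent_emp_quadratic(2)[OF f f] by (simp add: power2_eq_square)
    have "(\<integral>x. (f x)\<^sup>2 \<partial>P) = (\<integral>x. (\<Sum>i<r. \<Sum>j<r. t i * t j * (\<psi> i x * \<psi> j x)) \<partial>P)"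
      by (simp add: f_def power2_eq_square sum_product mult_ac)
    also have "\<dots> = (\<Sum>i<r. \<Sum>j<r. t i * t j * (\<integral>x. \<psi> i x * \<psi> j x \<partial>P))"
      by (rule integral_double_sum) (rule consistent_emp_quadratic(2)[OF \<psi> \<psi>])
    also have "\<dots> = (\<Sum>i<r. \<Sum>j<r. if i = j then (t i)\<^sup>2 else 0)"
      by (intro sum.cong refl) (auto simp: \<psi>_cov power2_eq_square)
    also have "\<dots> = (\<Sum>i<r. (t i)\<^sup>2)" by simp
    finally have f_var: "(\<integral>x. (f x)\<^sup>2 \<partial>P) = (\<Sum>i<r. (t i)\<^sup>2)" .
    have "sqrt (real n) * empirical n (\<lambda>i. X i \<omega>) f = (\<Sum>i<r. t i * T n \<omega> i)" for n \<omega>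
      unfolding f_def[abs_def] T_def fst_conv snd_conv empirical_sum by (simp add: sum_distrib_left mult.left_commute)
    then show ?thesis
      using iid_characteristic_function_tendsto[OF iid quadratic_measurable[OF f] f_int f_mean]
      unfolding f_var by simp
  qed
  define N where "N z = (\<Sum>i<r. (T (fst z) (snd z) i)\<^sup>2)" for z
  have N_eq: "N z = (\<Sum>a<r. \<Sum>c<r. lin a z * lin c z * inv_mat S $$ (a, c))" for z
  proof -
    have T_lin: "T (fst z) (snd z) i = (\<Sum>a<r. B $$ (i, a) * lin a z)" if i: "i < r" for i
    proof -
      have "\<psi> i = (\<lambda>x. \<Sum>a<r. B $$ (i, a) * (\<Sum>l<k. C $$ (a, l) * \<phi> v x $v l))"
      proof
        fix x
        have "\<psi> i x = (\<Sum>l<k. (\<Sum>a<r. B $$ (i, a) * C $$ (a, l)) * \<phi> v x $v l)"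
          unfolding \<psi>_def D_def by (intro sum.cong refl) (simp add: mult_mat_index[OF B(1) C i] del: index_mult_mat)
        also have "\<dots> = (\<Sum>a<r. B $$ (i, a) * (\<Sum>l<k. C $$ (a, l) * \<phi> v x $v l))"
          by (simp add: sum_distrib_left sum_distrib_right mult.assoc) (rule sum.swap)
        finally show "\<psi> i x = (\<Sum>a<r. B $$ (i, a) * (\<Sum>l<k. C $$ (a, l) * \<phi> v x $v l))" .
      qed
      then show ?thesis
        unfolding T_def by (simp only: empirical_sum[of _ _ "\<lambda>a. B $$ (i, a)"] prod.collapse)
          (simp only: sum_distrib_left mult.left_commute)
    qed
    have "N z = (\<Sum>i<r. \<Sum>a<r. \<Sum>c<r. (B $$ (i, a) * lin a z) * (B $$ (i, c) * lin c z))"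
      unfolding N_def by (intro sum.cong refl) (simp only: lessThan_iff T_lin power2_eq_square sum_product)
    also have "\<dots> = (\<Sum>a<r. \<Sum>c<r. \<Sum>i<r. (B $$ (i, a) * lin a z) * (B $$ (i, c) * lin c z))"
      by (subst sum.swap, rule sum.cong[OF refl], rule sum.swap)
    also have "\<dots> = (\<Sum>a<r. \<Sum>c<r. lin a z * lin c z * inv_mat S $$ (a, c))"
    proof (intro sum.cong refl)
      fix a c assume "a \<in> {..<r}" "c \<in> {..<r}"
      then have ac: "a < r" "c < r" by auto
      have "inv_mat S $$ (a, c) = (\<Sum>i<r. B $$ (i, a) * B $$ (i, c))"
        unfolding B(3) mult_mat_index[OF BT B(1) ac] using B(1) ac by (intro sum.cong) auto
      then show "(\<Sum>i<r. (B $$ (i, a) * lin a z) * (B $$ (i, c) * lin c z)) = lin a z * lin c z * inv_mat S $$ (a, c)"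
        by (simp only: sum_distrib_left) (intro sum.cong refl, simp only: mult_ac)
    qed
    finally show ?thesis .
  qed
  show ?thesis
    unfolding chi_squared_def
  proof (rule weak_conv_if_laplace[OF prob_space_axioms prob_space_gaussian_vector, where Y=N])
    show "(\<lambda>\<omega>. N (n, \<omega>)) \<in> borel_measurable M" for n
      unfolding N_def fst_conv snd_conv by measurable
    show "(\<lambda>\<omega>. wald (n, \<omega>)) \<in> borel_measurable M" for n by (rule wald_measurable)
    show "(\<lambda>z. \<Sum>i<r. (z i)\<^sup>2) \<in> borel_measurable (gaussian_vector r)" by measurable
    show "N z \<ge> 0" for z unfolding N_def by (intro sum_nonneg) simp
    show "(\<lambda>n. \<integral>\<omega>. exp (- (real m * N (n, \<omega>)) / 2) \<partial>M) \<longlonglongrightarrow>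
        (\<integral>z. exp (- (real m * (\<Sum>i<r. (z i)\<^sup>2)) / 2) \<partial>gaussian_vector r)" for m
      unfolding N_def fst_conv snd_conv by (rule laplace_transform_tendsto[OF Tm char]) simp
    show "((\<lambda>z. wald z - N z) \<longlongrightarrow> 0) (whp M)"
      unfolding N_eq by (rule wald_approximation)
  qed (simp add: sum_nonneg)
qed

text \<open>Weak convergence gives distribution functions at continuity points; for
  \<open>r \<noteq> 0\<close> every point is one.\<close>

lemma wald_cdf:
  assumes "r \<noteq> 0"
  shows "(\<lambda>n. measure M {\<omega> \<in> space M. wald (n, \<omega>) \<le> q}) \<longlonglongrightarrow> cdf (chi_squared r) q"
proof -
  note wald_measurable[measurable]
  have "cdf (distr M borel (\<lambda>\<omega>. wald (n, \<omega>))) q = measure M {\<omega> \<in> space M. wald (n, \<omega>) \<le> q}" for n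
    unfolding cdf_def by (subst measure_distr[OF wald_measurable]) (auto intro!: arg_cong[where f="measure M"])
  moreover have "(\<lambda>n. cdf (distr M borel (\<lambda>\<omega>. wald (n, \<omega>))) q) \<longlonglongrightarrow> cdf (chi_squared r) q"
    using wald_weak_convergence isCont_cdf_chi_squared[OF assms] unfolding weak_conv_m_def weak_conv_def by blast
  ultimately show ?thesis by (simp only:)
qed

end

end

section \<open>Confidence regions from the Wald statistic\<close>

lemma inv_mat_1:
  assumes A: "A \<in> carrier_mat 1 1" and d: "Determinant.det A \<noteq> 0"
  shows "A $$ (0, 0) \<noteq> 0" "inv_mat A $$ (0, 0) = 1 / A $$ (0, 0)"
proof -
  have "(A * inv_mat A) $$ (0, 0) = A $$ (0, 0) * inv_mat A $$ (0, 0)"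
    by (subst mult_mat_index[OF A inv_mat_carrier[OF A]]) auto
  then have "A $$ (0, 0) * inv_mat A $$ (0, 0) = 1" using inv_mat_inverse(1)[OF A d] by simp
  then show "A $$ (0, 0) \<noteq> 0" "inv_mat A $$ (0, 0) = 1 / A $$ (0, 0)"
    by (auto simp: eq_divide_eq mult.commute)
qed

context htc_sample begin

text \<open>The Wald statistic for the identity matrix, evaluated at the true coefficient
  vector.\<close>

lemma confidence_ellipsoid:
  assumes v: "v \<in> W" and k: "card (pa G v) \<noteq> 0" and \<alpha>: "0 < \<alpha>" "\<alpha> < 1"
  shows "asymptotic_confidence_region M (1 - \<alpha>) (coef G \<beta> v)
    (\<lambda>n \<omega>. {\<beta>' \<in> carrier_vec (card (pa G v)).
       real n * quad_form (inv_mat (V_hat G Y prec n (\<lambda>i. X i \<omega>) v)) (beta_hat G Y prec n (\<lambda>i. X i \<omega>) v - \<beta>')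
         \<le> quantile (chi_squared (card (pa G v))) (1 - \<alpha>)})"
proof -
  let ?k = "card (pa G v)"
  let ?q = "quantile (chi_squared ?k) (1 - \<alpha>)"
  have inj: "x = 0\<^sub>v ?k" if "x \<in> carrier_vec ?k" "transpose_mat (1\<^sub>m ?k) *\<^sub>v x = 0\<^sub>v ?k" for x :: "real Matrix.vec"
    using that by simp
  have V: "1\<^sub>m ?k * Vh z v * transpose_mat (1\<^sub>m ?k) = Vh z v" for z
    using mat_consistentD(1)[OF V_hat_consistent[OF v], of z] by simp
  have b: "1\<^sub>m ?k *\<^sub>v bh z v = bh z v" "1\<^sub>m ?k *\<^sub>v coef G \<beta> v = coef G \<beta> v" for z
    using beta_hat_carrier[OF v, of z] coef_carrier[of v] by simp_all
  have "cdf (chi_squared ?k) ?q = 1 - \<alpha>"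
    by (rule cdf_quantile[OF real_distribution_chi_squared isCont_cdf_chi_squared[OF k]]) (use \<alpha> in auto)
  then show ?thesis
    using wald_cdf[OF v one_carrier_mat inj k, of ?q] coef_carrier[of v]
    unfolding V b by (simp add: asymptotic_confidence_region_def)
qed

text \<open>The Wald statistic for a unit row: the square of the normal quantile is the matching
  threshold for one degree of freedom. The half-width takes the absolute value because the lower
  quantile is not positive.\<close>

lemma marginal_interval:
  assumes v: "v \<in> W" and j: "j < card (pa G v)" and \<alpha>: "0 < \<alpha>" "\<alpha> < 1"
  shows "asymptotic_confidence_region M (1 - \<alpha>) (\<beta> $ nth_elem (pa G v) j $ v)
    (\<lambda>n \<omega>. let h = \<bar>quantile std_normal_distribution (\<alpha> / 2)\<bar> * sqrt (V_hat G Y prec n (\<lambda>i. X i \<omega>) v $$ (j, j) / real n)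
       in {(beta_hat G Y prec n (\<lambda>i. X i \<omega>) v $v j) - h .. (beta_hat G Y prec n (\<lambda>i. X i \<omega>) v $v j) + h})"
proof -
  interpret prob_space M by (rule iid_sample_prob_space[OF iid])
  let ?k = "card (pa G v)"
  define q where "q = quantile std_normal_distribution (\<alpha> / 2)"
  define C :: "real Matrix.mat" where "C = Matrix.mat 1 ?k (\<lambda>(i, l). if l = j then 1 else 0)"
  have C: "C \<in> carrier_mat 1 ?k" by (simp add: C_def)
  have C_sum: "(\<Sum>l<?k. C $$ (0, l) * f l) = f j" for f :: "nat \<Rightarrow> real"
  proof -
    have "(\<Sum>l<?k. C $$ (0, l) * f l) = (\<Sum>l<?k. if l = j then f l else 0)"
      by (intro sum.cong) (auto simp: C_def)
    then show ?thesis using j by simp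
  qed
  have inj: "x = 0\<^sub>v 1" if x: "x \<in> carrier_vec 1" "transpose_mat C *\<^sub>v x = 0\<^sub>v ?k" for x
  proof -
    have CT: "transpose_mat C \<in> carrier_mat ?k 1" using C by simp
    have "(transpose_mat C *\<^sub>v x) $v j = x $v 0"
      unfolding mult_mat_vec_index[OF CT x(1) j] using j C by (simp add: C_def)
    then have "x $v 0 = 0" using x(2) j by simp
    then show ?thesis using x(1) by (intro eq_vecI) auto
  qed
  let ?Vjj = "\<lambda>z. Vh z v $$ (j, j)"
  let ?d = "\<lambda>z. bh z v $v j - coef G \<beta> v $v j"
  let ?S = "\<lambda>z. C * Vh z v * transpose_mat C"
  let ?wald = "\<lambda>z. real (fst z) * quad_form (inv_mat (?S z)) (C *\<^sub>v bh z v - C *\<^sub>v coef G \<beta> v)"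
  have cover: "\<beta> $ nth_elem (pa G v) j $ v = coef G \<beta> v $v j"
    using j by (simp add: coef_def)
  have Sc: "?S z \<in> carrier_mat 1 1" for z
    by (rule mat_consistentD(1)[OF Sh_consistent[OF v C inj]])
  have S00: "?S z $$ (0, 0) = ?Vjj z" for z
  proof -
    have Vc: "Vh z v \<in> carrier_mat ?k ?k" by (rule mat_consistentD(1)[OF V_hat_consistent[OF v]])
    have CT: "transpose_mat C \<in> carrier_mat ?k 1" using C by simp
    have "?S z $$ (0, 0) = (\<Sum>m<?k. (C * Vh z v) $$ (0, m) * transpose_mat C $$ (m, 0))"
      by (rule mult_mat_index[OF mult_carrier_mat[OF C Vc] CT]) auto
    also have "\<dots> = (\<Sum>m<?k. C $$ (0, m) * Vh z v $$ (j, m))"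
    proof (rule sum.cong[OF refl])
      fix m assume "m \<in> {..<?k}"
      then have m: "m < ?k" by simp
      have "(C * Vh z v) $$ (0, m) = Vh z v $$ (j, m)"
        by (subst mult_mat_index[OF C Vc _ m]) (simp_all add: C_sum)
      then show "(C * Vh z v) $$ (0, m) * transpose_mat C $$ (m, 0) = C $$ (0, m) * Vh z v $$ (j, m)"
        using m C by simp
    qed
    finally show ?thesis by (simp add: C_sum)
  qed
  have V_pos: "V_true G Y prec \<beta> Q v $$ (j, j) > 0"
  proof -
    have V: "V_true G Y prec \<beta> Q v \<in> carrier_mat ?k ?k" by (rule V_true_carrier[OF v])
    have "unit_vec ?k j \<noteq> (0\<^sub>v ?k :: real Matrix.vec)"
      using j by (metis index_unit_vec(1) index_zero_vec(1) zero_neq_one)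
    then have "quad_form (V_true G Y prec \<beta> Q v) (unit_vec ?k j) > 0"
      using V_true_positive_definite[OF v] by (simp add: positive_definite_def)
    moreover have "quad_form (V_true G Y prec \<beta> Q v) (unit_vec ?k j) = V_true G Y prec \<beta> Q v $$ (j, j)"
    proof -
      have "quad_form (V_true G Y prec \<beta> Q v) (unit_vec ?k j) =
          (\<Sum>a<?k. \<Sum>c<?k. if c = j then if a = j then V_true G Y prec \<beta> Q v $$ (a, c) else 0 else 0)"
        unfolding quad_form_sum[OF V unit_vec_carrier] using j by (intro sum.cong) (auto simp: unit_vec_def)
      then show ?thesis using j by simp
    qed
    ultimately show ?thesis by simp
  qed
  have Vcons: "consistent M ?Vjj (V_true G Y prec \<beta> Q v $$ (j, j))"
    by (rule mat_consistentD(3)[OF V_hat_consistent[OF v] j j])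
  then have Vpos: "\<forall>\<^sub>F z in whp M. ?Vjj z > 0"
    using V_pos order_tendstoD(1) unfolding consistent_def by blast
  have meas: "(\<lambda>\<omega>. ?Vjj (n, \<omega>)) \<in> borel_measurable M" "(\<lambda>\<omega>. bh (n, \<omega>) v $v j) \<in> borel_measurable M" for n
    using Vcons consistent_beta_hat[OF v j] unfolding consistent_def by blast+
  note meas[unfolded fst_conv snd_conv, measurable]
  note wald_measurable[OF v C inj, unfolded fst_conv snd_conv, measurable]
  define I where "I z \<longleftrightarrow> \<bar>?d z\<bar> \<le> \<bar>q\<bar> * sqrt (?Vjj z / real (fst z))" for z
  have I_meas: "{\<omega> \<in> space M. I (n, \<omega>)} \<in> sets M" for n
    unfolding I_def fst_conv snd_conv by measurable
  have det: "\<forall>\<^sub>F z in whp M. Determinant.det (?S z) \<noteq> 0"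
    by (rule det_Sh[OF v C inj])
  have contrast_carrier_1: "C *\<^sub>v bh z v - C *\<^sub>v coef G \<beta> v \<in> carrier_vec 1" for z
    by (rule contrast_carrier[OF v C inj])
  have contrast_0: "(C *\<^sub>v bh z v - C *\<^sub>v coef G \<beta> v) $v 0 = ?d z" for z
    by (subst contrast_index[OF v C inj]) (simp_all add: C_sum)
  \<comment> \<open>Squaring is legitimate where the variance estimate is positive,
    \<open>n \<ge> 1\<close> and \<open>?S\<close> is invertible, and this happens with probability
    tending to one.\<close>
  have "\<forall>\<^sub>F z in whp M. I z = (?wald z \<le> q\<^sup>2)"
    using Vpos eventually_whp_ge[of 1 M] det
  proof eventually_elim
    case (elim z)
    have n: "real (fst z) > 0" using elim(2) by simp
    have "quad_form (inv_mat (?S z)) (C *\<^sub>v bh z v - C *\<^sub>v coef G \<beta> v) = ?d z * ?d z * inv_mat (?S z) $$ (0, 0)"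
      unfolding quad_form_sum[OF inv_mat_carrier[OF Sc] contrast_carrier_1]
      by (simp add: contrast_0)
    also have "\<dots> = (?d z)\<^sup>2 / ?Vjj z"
      using inv_mat_1(2)[OF Sc elim(3)] S00 by (simp add: power2_eq_square)
    finally have w: "?wald z = real (fst z) * (?d z)\<^sup>2 / ?Vjj z" by simp
    have "I z \<longleftrightarrow> \<bar>?d z\<bar>\<^sup>2 \<le> (\<bar>q\<bar> * sqrt (?Vjj z / real (fst z)))\<^sup>2"
      unfolding I_def using elim(1) n by (subst power_mono_iff) auto
    also have "(\<bar>q\<bar> * sqrt (?Vjj z / real (fst z)))\<^sup>2 = q\<^sup>2 * (?Vjj z / real (fst z))"
      using elim(1) n by (simp add: power_mult_distrib)
    also have "\<bar>?d z\<bar>\<^sup>2 \<le> q\<^sup>2 * (?Vjj z / real (fst z)) \<longleftrightarrow> ?wald z \<le> q\<^sup>2"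
      unfolding w using elim(1) n by (simp add: field_simps)
    finally show ?case .
  qed
  then have "(\<lambda>n. prob {\<omega> \<in> space M. I (n, \<omega>)} - prob {\<omega> \<in> space M. ?wald (n, \<omega>) \<le> q\<^sup>2}) \<longlonglongrightarrow> 0"
    by (intro prob_difference_tendsto_0[of I "\<lambda>z. ?wald z \<le> q\<^sup>2"] I_meas)
      (unfold fst_conv snd_conv, measurable)
  moreover have "(\<lambda>n. prob {\<omega> \<in> space M. ?wald (n, \<omega>) \<le> q\<^sup>2}) \<longlonglongrightarrow> 1 - \<alpha>"
    using wald_cdf[OF v C inj, of "q\<^sup>2"] cdf_chi_squared_1[OF \<alpha>] unfolding q_def by simp
  ultimately have "(\<lambda>n. prob {\<omega> \<in> space M. I (n, \<omega>)}) \<longlonglongrightarrow> 1 - \<alpha>"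
    using tendsto_add by fastforce
  moreover have "I (n, \<omega>) \<longleftrightarrow> \<beta> $ nth_elem (pa G v) j $ v \<in>
      (let h = \<bar>q\<bar> * sqrt (?Vjj (n, \<omega>) / real n) in {bh (n, \<omega>) v $v j - h .. bh (n, \<omega>) v $v j + h})" for n \<omega>
    unfolding I_def cover Let_def fst_conv snd_conv atLeastAtMost_iff by linarith
  ultimately show ?thesis
    unfolding asymptotic_confidence_region_def q_def by simp
qed

end

text \<open>All conclusions rest on one limit theorem for the Wald statistic and on positive
  definiteness of the asymptotic variance. For \<open>k = 0\<close> the ellipsoid is the whole
  one-point space and always covers, hence the side condition.\<close>

theorem proposition12:
  fixes G :: "'v::finite mgraph" and W :: "'v set" and Y :: "'v \<Rightarrow> 'v set"
    and prec :: "('v \<times> 'v) set" and v :: 'v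
    and \<beta> :: "real ^ 'v ^ 'v" and Q :: "(real ^ 'v) measure"
    and M :: "'a measure" and X :: "nat \<Rightarrow> 'a \<Rightarrow> real ^ 'v" and \<alpha> :: real
  defines "k \<equiv> card (pa G v)"
  defines "b \<equiv> (\<lambda>n \<omega>. beta_hat G Y prec n (\<lambda>i. X i \<omega>) v)"
  defines "V \<equiv> (\<lambda>n \<omega>. V_hat G Y prec n (\<lambda>i. X i \<omega>) v)"
  assumes "mixed_graph G" and "HTC_identified G W Y prec" and "v \<in> W"
    and "regular_parameter G W Y \<beta> Q"
    and "iid_sample M X (model_law \<beta> Q)"
    and "0 < \<alpha>" and "\<alpha> < 1"
  shows
    "(k \<noteq> 0 \<longrightarrow> asymptotic_confidence_region M (1 - \<alpha>) (coef G \<beta> v)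
        (\<lambda>n \<omega>. {\<beta>' \<in> carrier_vec k.
           real n * quad_form (inv_mat (V n \<omega>)) (b n \<omega> - \<beta>') \<le> quantile (chi_squared k) (1 - \<alpha>)}))
   \<and> (\<forall>j<k. asymptotic_confidence_region M (1 - \<alpha>) (\<beta> $ nth_elem (pa G v) j $ v)
        (\<lambda>n \<omega>. let h = \<bar>quantile std_normal_distribution (\<alpha> / 2)\<bar> * sqrt (V n \<omega> $$ (j, j) / real n)
                in {(b n \<omega> $v j) - h .. (b n \<omega> $v j) + h}))
   \<and> (\<forall>r. \<forall>C \<in> carrier_mat r k. vec_space.rank r C = r \<longrightarrow>
        (\<forall>c \<in> carrier_vec r. C *\<^sub>v coef G \<beta> v = c \<longrightarrow>
           weak_conv_m
             (\<lambda>n. distr M borel (\<lambda>\<omega>. real n *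
                quad_form (inv_mat (C * V n \<omega> * transpose_mat C)) (C *\<^sub>v b n \<omega> - c)))
             (chi_squared r)) \<and>
        generically G (\<lambda>\<beta>' \<Omega>. \<forall>Q' (M' :: 'a measure) X'.
           regular_parameter G W Y \<beta>' Q' \<and> error_cov Q' = \<Omega> \<and> iid_sample M' X' (model_law \<beta>' Q') \<longrightarrow>
           invertible_mat (C * V_true G Y prec \<beta>' Q' v * transpose_mat C) \<and>
           (\<lambda>n. measure M' {\<omega> \<in> space M'.
              invertible_mat (C * V_hat G Y prec n (\<lambda>i. X' i \<omega>) v * transpose_mat C)}) \<longlonglongrightarrow> 1))"
proof -
  interpret htc_sample G W Y prec \<beta> Q M X
    by unfold_locales fact+
  have ellipsoid: "k \<noteq> 0 \<longrightarrow> asymptotic_confidence_region M (1 - \<alpha>) (coef G \<beta> v)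
        (\<lambda>n \<omega>. {\<beta>' \<in> carrier_vec k.
           real n * quad_form (inv_mat (V n \<omega>)) (b n \<omega> - \<beta>') \<le> quantile (chi_squared k) (1 - \<alpha>)})"
    using confidence_ellipsoid[OF \<open>v \<in> W\<close>] \<open>0 < \<alpha>\<close> \<open>\<alpha> < 1\<close> unfolding k_def b_def V_def by blast
  have interval: "\<forall>j<k. asymptotic_confidence_region M (1 - \<alpha>) (\<beta> $ nth_elem (pa G v) j $ v)
        (\<lambda>n \<omega>. let h = \<bar>quantile std_normal_distribution (\<alpha> / 2)\<bar> * sqrt (V n \<omega> $$ (j, j) / real n)
                in {(b n \<omega> $v j) - h .. (b n \<omega> $v j) + h})"
    using marginal_interval[OF \<open>v \<in> W\<close>] \<open>0 < \<alpha>\<close> \<open>\<alpha> < 1\<close> unfolding k_def b_def V_def by blast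
  have wald_test: "weak_conv_m (\<lambda>n. distr M borel (\<lambda>\<omega>. real n *
          quad_form (inv_mat (C * V n \<omega> * transpose_mat C)) (C *\<^sub>v b n \<omega> - c))) (chi_squared r)"
    if C: "C \<in> carrier_mat r k" "vec_space.rank r C = r" and c: "C *\<^sub>v coef G \<beta> v = c" for r C c
    using wald_weak_convergence[OF \<open>v \<in> W\<close> C(1)[unfolded k_def]
        full_row_rank_transpose_injective[OF C[unfolded k_def]]]
    unfolding b_def V_def c[symmetric] by simp
  have gen: "generically G (\<lambda>\<beta>' \<Omega>. \<forall>Q' (M' :: 'a measure) X'.
           regular_parameter G W Y \<beta>' Q' \<and> error_cov Q' = \<Omega> \<and> iid_sample M' X' (model_law \<beta>' Q') \<longrightarrow>
           invertible_mat (C * V_true G Y prec \<beta>' Q' v * transpose_mat C) \<and>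
           (\<lambda>n. measure M' {\<omega> \<in> space M'.
              invertible_mat (C * V_hat G Y prec n (\<lambda>i. X' i \<omega>) v * transpose_mat C)}) \<longlonglongrightarrow> 1)"
    if C: "C \<in> carrier_mat r k" "vec_space.rank r C = r" for r C
    unfolding generically_def
  \<comment> \<open>Invertibility holds at every regular parameter, so the almost-everywhere
    statement is proved pointwise by opening the locale at the coefficients given by
    \<theta>.\<close>
  proof (rule AE_I2, intro allI impI)
    fix \<theta> Q' and M' :: "'a measure" and X'
    let ?\<beta> = "param_coefficients G \<theta>"
    assume "regular_parameter G W Y ?\<beta> Q' \<and> error_cov Q' = param_cov G \<theta> \<and> iid_sample M' X' (model_law ?\<beta> Q')"
    then interpret H: htc_sample G W Y prec ?\<beta> Q' M' X'
      using \<open>HTC_identified G W Y prec\<close> by unfold_locales auto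
    note C' = \<open>v \<in> W\<close> C(1)[unfolded k_def] full_row_rank_transpose_injective[OF C[unfolded k_def]]
    show "invertible_mat (C * V_true G Y prec ?\<beta> Q' v * transpose_mat C) \<and>
           (\<lambda>n. measure M' {\<omega> \<in> space M'.
              invertible_mat (C * V_hat G Y prec n (\<lambda>i. X' i \<omega>) v * transpose_mat C)}) \<longlonglongrightarrow> 1"
    proof
      show "invertible_mat (C * V_true G Y prec ?\<beta> Q' v * transpose_mat C)"
        using H.S_positive_definite[OF C'] positive_definite_det invertible_mat_iff_det
        unfolding positive_definite_def by blast
      show "(\<lambda>n. measure M' {\<omega> \<in> space M'.
              invertible_mat (C * V_hat G Y prec n (\<lambda>i. X' i \<omega>) v * transpose_mat C)}) \<longlonglongrightarrow> 1"
        using H.invertible_Sh[OF C'] by simp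
    qed
  qed
  show ?thesis
    using ellipsoid interval wald_test gen by blast
qed

end
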